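(* \textsc{Blue Leader Stackelberg Equilibrium} is NP-hard, even when restricted to instances on which \textsc{Best Red Response} is computable in linear time and the recharging time is $\tau=3$. That is, there is a class $\mathcal{C}$ of Escape Sensing Games with recharging time $3$ such that \textsc{Best Red Response} is solvable in linear time on games from $\mathcal{C}$, while it is NP-hard to decide, given a game from $\mathcal{C}$ and a number $\ell$, whether $\max_{\sigma}\min_{\psi:\ \psi\text{ valid w.r.t. }\sigma}v(\psi)\geq\ell$.
   Context: An Escape Sensing Game (ESG) consists of: a finite set of targets $T=\{t_1,\dots,t_n\}$, each $t_i$ with a value $v_i\in\mathbb{R}^+$ (rational when part of a computational input); a finite set of sensors $S=\{s_1,\dots,s_k\}$; a recharging time $\tau\in\mathbb{N}\cup\{\infty\}$ common to all sensors; and a sensing matrix $D\in\{0,1\}^{n\times k}$, where $D_{i,j}=1$ means that sensor $s_j$ is capable of sensing target $t_i$. A target ordering (strategy of the blue player) is a bijection $\sigma:T\to[n]$. A sensing plan (strategy of the red player) is a map $\psi:S\to 2^T$ with $\psi(s)\cap\psi(s')=\emptyset$ for all $s\neq s'\in S$. The plan $\psi$ is valid with respect to $\sigma$ if (i) for each $s_j\in S$ and $t_i\in\psi(s_j)$ we have $D_{i,j}=1$, and (ii) for each $s\in S$ and all distinct $t,t'\in\psi(s)$ we have $|\sigma(t)-\sigma(t')|>\tau$. The value of not-sensed targets is $v(\psi)=\sum_{t_i\in T\setminus\bigcup_{s\in S}\psi(s)}v_i$. \textsc{Best Red Response}: given an ESG and a target ordering $\sigma$, find a sensing plan $\psi$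 that is valid with respect to $\sigma$ and minimizes $v(\psi)$ among all such plans. \textsc{Blue Leader Stackelberg Equilibrium}: given an ESG, solve the bilevel problem $\max_{\sigma}\min_{\psi:\ \psi\text{ valid w.r.t. }\sigma}v(\psi)$, where $\sigma$ ranges over all target orderings. Its decision version asks whether this value is at least a given $\ell$. *)

theory Defs
  imports Complex_Main "HOL-Library.Extended_Nat" "HOL-Library.Disjoint_Sets"
begin

section \<open>Escape Sensing Games\<close>

text \<open>
  Targets are \<open>{..<targets G}\<close> and sensors are \<open>{..<sensors G}\<close>; the remaining
  fields are only relevant on these ranges.  Values are rational, as games occur here as
  computational inputs.
\<close>

record esg =
  targets :: nat
  sensors :: nat
  target_value :: "nat \<Rightarrow> rat"
  recharge :: enat
  can_sense :: "nat \<Rightarrow> nat \<Rightarrow> bool"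

definition is_esg :: "esg \<Rightarrow> bool" where
  "is_esg G \<longleftrightarrow> (\<forall>i<targets G. target_value G i > 0)"

definition target_ordering :: "esg \<Rightarrow> (nat \<Rightarrow> nat) \<Rightarrow> bool" where
  "target_ordering G \<sigma> \<longleftrightarrow> bij_betw \<sigma> {..<targets G} {1..targets G}"

definition sensing_plan :: "esg \<Rightarrow> (nat \<Rightarrow> nat set) \<Rightarrow> bool" where
  "sensing_plan G \<psi> \<longleftrightarrow>
     (\<forall>j<sensors G. \<psi> j \<subseteq> {..<targets G}) \<and> disjoint_family_on \<psi> {..<sensors G}"

definition valid_plan :: "esg \<Rightarrow> (nat \<Rightarrow> nat) \<Rightarrow> (nat \<Rightarrow> nat set) \<Rightarrow> bool" where
  "valid_plan G \<sigma> \<psi> \<longleftrightarrow> sensing_plan G \<psi> \<and>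
     (\<forall>j<sensors G. \<forall>i\<in>\<psi> j. can_sense G i j) \<and>
     (\<forall>j<sensors G. \<forall>t\<in>\<psi> j. \<forall>t'\<in>\<psi> j. t \<noteq> t' \<longrightarrow>
        enat (nat \<bar>int (\<sigma> t) - int (\<sigma> t')\<bar>) > recharge G)"

definition not_sensed_value :: "esg \<Rightarrow> (nat \<Rightarrow> nat set) \<Rightarrow> rat" where
  "not_sensed_value G \<psi> =
     (\<Sum>i \<in> {..<targets G} - (\<Union>j<sensors G. \<psi> j). target_value G i)"

definition best_red_response :: "esg \<Rightarrow> (nat \<Rightarrow> nat) \<Rightarrow> (nat \<Rightarrow> nat set) \<Rightarrow> bool" where
  "best_red_response G \<sigma> \<psi> \<longleftrightarrow> valid_plan G \<sigma> \<psi> \<and>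
     (\<forall>\<psi>'. valid_plan G \<sigma> \<psi>' \<longrightarrow> not_sensed_value G \<psi> \<le> not_sensed_value G \<psi>')"

definition blue_leader_value :: "esg \<Rightarrow> rat" where
  "blue_leader_value G =
     Max ((\<lambda>\<sigma>. Min (not_sensed_value G ` {\<psi>. valid_plan G \<sigma> \<psi>})) ` {\<sigma>. target_ordering G \<sigma>})"


text \<open>The sets under \<^const>\<open>Max\<close> and \<^const>\<open>Min\<close> are finite and nonempty.\<close>

lemma finite_not_sensed_values: "finite (not_sensed_value G ` X)"
proof (rule finite_subset)
  show "not_sensed_value G ` X \<subseteq> sum (target_value G) ` Pow {..<targets G}"
    by (auto simp: not_sensed_value_def)
qed simp

lemma valid_plan_exists: "valid_plan G \<sigma> (\<lambda>_. {})"
  by (simp add: valid_plan_def sensing_plan_def disjoint_family_on_def)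

lemma target_ordering_exists: "target_ordering G Suc"
  unfolding target_ordering_def
  by (rule bij_betw_byWitness[where f' = "\<lambda>i. i - 1"]) auto

lemma blue_leader_value_ge_iff:
  "blue_leader_value G \<ge> l \<longleftrightarrow>
     (\<exists>\<sigma>. target_ordering G \<sigma> \<and> (\<forall>\<psi>. valid_plan G \<sigma> \<psi> \<longrightarrow> not_sensed_value G \<psi> \<ge> l))"
proof -
  let ?m = "\<lambda>\<sigma>. Min (not_sensed_value G ` {\<psi>. valid_plan G \<sigma> \<psi>})"
  have ne: "not_sensed_value G ` {\<psi>. valid_plan G \<sigma> \<psi>} \<noteq> {}" for \<sigma>
    using valid_plan_exists by blast
  have "?m \<sigma> \<in> not_sensed_value G ` UNIV" for \<sigma>
    using Min_in[OF finite_not_sensed_values ne] by blast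
  then have "finite (?m ` {\<sigma>. target_ordering G \<sigma>})"
    by (intro finite_subset[OF _ finite_not_sensed_values[of G UNIV]]) blast
  moreover have "{\<sigma>. target_ordering G \<sigma>} \<noteq> {}"
    using target_ordering_exists by blast
  ultimately have "blue_leader_value G \<ge> l \<longleftrightarrow> (\<exists>\<sigma>. target_ordering G \<sigma> \<and> ?m \<sigma> \<ge> l)"
    unfolding blue_leader_value_def by (subst Max_ge_iff) auto
  moreover have "?m \<sigma> \<ge> l \<longleftrightarrow> (\<forall>\<psi>. valid_plan G \<sigma> \<psi> \<longrightarrow> not_sensed_value G \<psi> \<ge> l)" for \<sigma>
    using ne by (subst Min_ge_iff) (auto intro: finite_not_sensed_values)
  ultimately show ?thesis by simp
qed


section \<open>Word RAM\<close>

text \<open>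
  A random access machine with registers, a memory accessible only through addresses
  held in registers, and unit-cost instructions on machine words.  The word size enters as
  a bound on all numbers occurring during a run (see \<open>ram_computes\<close>); below this bound is
  always polynomial in the input length \<open>N\<close>, i.e. words have \<open>O(log N)\<close> bits, so that
  polynomial time on this machine is the same as on Turing machines.  Arithmetic is that
  of \<^typ>\<open>nat\<close>, so subtraction is truncated.
\<close>

datatype binop = Plus | Minus | Times | Div

fun binop_fun :: "binop \<Rightarrow> nat \<Rightarrow> nat \<Rightarrow> nat" where
  "binop_fun Plus a b = a + b"
| "binop_fun Minus a b = a - b"
| "binop_fun Times a b = a * b"
| "binop_fun Div a b = a div b"

datatype instr =
    Const nat nat
  | Arith binop nat nat nat
  | Load nat nat
  | Store nat nat
  | JumpIfZero nat nat

record ram_state =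
  pc :: nat
  reg :: "nat \<Rightarrow> nat"
  mem :: "nat \<Rightarrow> nat"

fun exec_instr :: "instr \<Rightarrow> ram_state \<Rightarrow> ram_state" where
  "exec_instr (Const r a) s = s\<lparr>pc := pc s + 1, reg := (reg s)(r := a)\<rparr>"
| "exec_instr (Arith f r a b) s =
     s\<lparr>pc := pc s + 1, reg := (reg s)(r := binop_fun f (reg s a) (reg s b))\<rparr>"
| "exec_instr (Load r a) s = s\<lparr>pc := pc s + 1, reg := (reg s)(r := mem s (reg s a))\<rparr>"
| "exec_instr (Store a r) s = s\<lparr>pc := pc s + 1, mem := (mem s)(reg s a := reg s r)\<rparr>"
| "exec_instr (JumpIfZero r l) s = s\<lparr>pc := (if reg s r = 0 then l else pc s + 1)\<rparr>"

definition ram_halted :: "instr list \<Rightarrow> ram_state \<Rightarrow> bool" where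
  "ram_halted P s \<longleftrightarrow> pc s \<ge> length P"

definition ram_step :: "instr list \<Rightarrow> ram_state \<Rightarrow> ram_state" where
  "ram_step P s = (if ram_halted P s then s else exec_instr (P ! pc s) s)"

text \<open>
  Input and output are bit strings stored one bit per memory cell, starting at
  address \<open>0\<close>, with their length in register \<open>0\<close>.
\<close>

definition ram_init :: "bool list \<Rightarrow> ram_state" where
  "ram_init x = \<lparr>pc = 0,
     reg = (\<lambda>r. if r = 0 then length x else 0),
     mem = (\<lambda>a. if a < length x then of_bool (x ! a) else 0)\<rparr>"

definition ram_output :: "ram_state \<Rightarrow> bool list \<Rightarrow> bool" where
  "ram_output s y \<longleftrightarrow> reg s 0 = length y \<and> (\<forall>a<length y. mem s a = of_bool (y ! a))"

definition fits_words :: "nat \<Rightarrow> ram_state \<Rightarrow> bool" where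
  "fits_words W s \<longleftrightarrow> (\<forall>r. reg s r \<le> W) \<and> (\<forall>a. mem s a \<le> W)"

text \<open>
  On input \<open>x\<close>, program \<open>P\<close> halts with output \<open>y\<close> after at most \<open>T\<close> steps, and no
  number larger than \<open>W\<close> occurs on the way.
\<close>

definition ram_computes :: "instr list \<Rightarrow> bool list \<Rightarrow> bool list \<Rightarrow> nat \<Rightarrow> nat \<Rightarrow> bool" where
  "ram_computes P x y T W \<longleftrightarrow>
     (\<exists>t\<le>T. ram_halted P ((ram_step P ^^ t) (ram_init x)) \<and>
        ram_output ((ram_step P ^^ t) (ram_init x)) y \<and>
        (\<forall>t'\<le>t. fits_words W ((ram_step P ^^ t') (ram_init x))))"


section \<open>Polynomial time and NP-hardness\<close>

definition poly_bound :: "nat \<Rightarrow> nat \<Rightarrow> nat" where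
  "poly_bound c n = n ^ c + c"

definition poly_time_computable :: "(bool list \<Rightarrow> bool list) \<Rightarrow> bool" where
  "poly_time_computable f \<longleftrightarrow> (\<exists>P c. \<forall>x.
     ram_computes P x (f x) (poly_bound c (length x)) (poly_bound c (length x)))"

definition class_P :: "bool list set set" where
  "class_P = {L. poly_time_computable (\<lambda>x. [x \<in> L])}"

text \<open>Each bit is preceded by \<^const>\<open>True\<close>, and \<^const>\<open>False\<close> marks the end, so the
  code is prefix-free.\<close>

definition self_delimiting :: "bool list \<Rightarrow> bool list" where
  "self_delimiting x = concat (map (\<lambda>b. [True, b]) x) @ [False]"

definition class_NP :: "bool list set set" where
  "class_NP = {L. \<exists>V\<in>class_P. \<exists>c. \<forall>x.
     x \<in> L \<longleftrightarrow> (\<exists>y. length y \<le> poly_bound c (length x) \<and> self_delimiting x @ y \<in> V)}"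

text \<open>
  NP-hardness, under polynomial-time many-one reductions, of a decision problem
  restricted to a class of instances: \<open>Yes\<close> and \<open>No\<close> are the (codes of) the instances
  with positive and with negative answer, and a reduction may only produce elements
  of \<open>Yes \<union> No\<close>.
\<close>

definition NP_hard :: "bool list set \<Rightarrow> bool list set \<Rightarrow> bool" where
  "NP_hard Yes No \<longleftrightarrow> (\<forall>L\<in>class_NP. \<exists>f. poly_time_computable f \<and>
     (\<forall>x. (x \<in> L \<longrightarrow> f x \<in> Yes) \<and> (x \<notin> L \<longrightarrow> f x \<in> No)))"


section \<open>Encoding of games\<close>

fun binary :: "nat \<Rightarrow> bool list" where
  "binary n = (if n = 0 then [] else odd n # binary (n div 2))"

declare binary.simps [simp del]

definition enc_nat :: "nat \<Rightarrow> bool list" where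
  "enc_nat n = self_delimiting (binary n)"

definition enc_int :: "int \<Rightarrow> bool list" where
  "enc_int a = (a < 0) # enc_nat (nat \<bar>a\<bar>)"

definition enc_rat :: "rat \<Rightarrow> bool list" where
  "enc_rat q = enc_int (fst (quotient_of q)) @ enc_int (snd (quotient_of q))"

definition enc_enat :: "enat \<Rightarrow> bool list" where
  "enc_enat m = (case m of enat a \<Rightarrow> True # enc_nat a | \<infinity> \<Rightarrow> [False])"

text \<open>A 0/1 matrix with \<open>n\<close> rows and \<open>k\<close> columns, row by row.\<close>

definition enc_matrix :: "nat \<Rightarrow> nat \<Rightarrow> (nat \<Rightarrow> nat \<Rightarrow> bool) \<Rightarrow> bool list" where
  "enc_matrix n k M = concat (map (\<lambda>i. map (M i) [0..<k]) [0..<n])"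

definition enc_esg :: "esg \<Rightarrow> bool list" where
  "enc_esg G = enc_nat (targets G) @ enc_nat (sensors G) @ enc_enat (recharge G) @
     concat (map (\<lambda>i. enc_rat (target_value G i)) [0..<targets G]) @
     enc_matrix (targets G) (sensors G) (can_sense G)"

definition enc_ordering :: "esg \<Rightarrow> (nat \<Rightarrow> nat) \<Rightarrow> bool list" where
  "enc_ordering G \<sigma> = concat (map (\<lambda>i. enc_nat (\<sigma> i)) [0..<targets G])"

definition enc_plan :: "esg \<Rightarrow> (nat \<Rightarrow> nat set) \<Rightarrow> bool list" where
  "enc_plan G \<psi> = enc_matrix (targets G) (sensors G) (\<lambda>i j. i \<in> \<psi> j)"

lemma self_delimiting_append_eq:
  "self_delimiting x @ u = self_delimiting y @ v \<longleftrightarrow> x = y \<and> u = v"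
proof (induction x arbitrary: y)
  case Nil then show ?case by (cases y) (auto simp: self_delimiting_def)
next
  case (Cons a x) then show ?case by (cases y) (auto simp: self_delimiting_def)
qed

lemma binary_eq_iff: "binary m = binary n \<longleftrightarrow> m = n"
proof (induction m arbitrary: n rule: less_induct)
  case (less m)
  show ?case
  proof (cases "m = 0 \<or> n = 0")
    case True
    have "binary k = [] \<longleftrightarrow> k = 0" for k by (subst binary.simps) simp
    with True show ?thesis by metis
  next
    case False
    have m: "binary m = odd m # binary (m div 2)" and n: "binary n = odd n # binary (n div 2)"
      using False by (subst binary.simps, simp)+
    have "binary m = binary n \<longleftrightarrow> odd m = odd n \<and> m div 2 = n div 2"
      unfolding m n list.inject using less[of "m div 2" "n div 2"] False by auto
    also have "\<dots> \<longleftrightarrow> m = n" by (metis bit_eq_rec)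
    finally show ?thesis .
  qed
qed

lemma enc_nat_append_eq: "enc_nat a @ u = enc_nat b @ v \<longleftrightarrow> a = b \<and> u = v"
  by (simp add: enc_nat_def self_delimiting_append_eq binary_eq_iff)

lemma enc_int_append_eq: "enc_int a @ u = enc_int b @ v \<longleftrightarrow> a = b \<and> u = v"
  by (auto simp: enc_int_def enc_nat_append_eq)

lemma enc_rat_append_eq: "enc_rat a @ u = enc_rat b @ v \<longleftrightarrow> a = b \<and> u = v"
  by (auto simp: enc_rat_def enc_int_append_eq quotient_of_inject_eq[symmetric] prod_eq_iff)

lemma enc_enat_append_eq: "enc_enat a @ u = enc_enat b @ v \<longleftrightarrow> a = b \<and> u = v"
  by (auto simp: enc_enat_def enc_nat_append_eq split: enat.splits)

lemma concat_map_append_eq: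
  assumes "\<And>a b u v. f a @ u = g b @ v \<longleftrightarrow> F a = H b \<and> u = v" "length xs = length ys"
  shows "concat (map f xs) @ u = concat (map g ys) @ v \<longleftrightarrow> map F xs = map H ys \<and> u = v"
  using assms(2) by (induction rule: list_induct2) (auto simp: assms(1))

lemma enc_matrix_append_eq:
  "enc_matrix n k M @ u = enc_matrix n k M' @ v \<longleftrightarrow> (\<forall>i<n. \<forall>j<k. M i j = M' i j) \<and> u = v"
  unfolding enc_matrix_def
  by (subst concat_map_append_eq[where F = "\<lambda>i. map (M i) [0..<k]" and H = "\<lambda>i. map (M' i) [0..<k]"])
     auto

lemma enc_esg_append_eq:
  "enc_esg G @ u = enc_esg G' @ v \<longleftrightarrow>
     targets G = targets G' \<and> sensors G = sensors G' \<and> recharge G = recharge G' \<and>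
     (\<forall>i<targets G. target_value G i = target_value G' i) \<and>
     (\<forall>i<targets G. \<forall>j<sensors G. can_sense G i j = can_sense G' i j) \<and> u = v"
proof -
  let ?vals = "\<lambda>H. concat (map (\<lambda>i. enc_rat (target_value H i)) [0..<targets H])"
  have vals: "?vals G @ s = ?vals G' @ t \<longleftrightarrow>
      (\<forall>i<targets G. target_value G i = target_value G' i) \<and> s = t"
    if "targets G = targets G'" for s t
    using concat_map_append_eq[of "\<lambda>i. enc_rat (target_value G i)"
        "\<lambda>i. enc_rat (target_value G' i)" "target_value G" "target_value G'"
        "[0..<targets G]" "[0..<targets G']" s t] that
    by (simp add: enc_rat_append_eq atLeast0LessThan Ball_def)
  show ?thesis
  proof (cases "targets G = targets G' \<and> sensors G = sensors G'")
    case True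
    then show ?thesis
      using vals enc_matrix_append_eq[of "targets G" "sensors G" "can_sense G" u "can_sense G'" v]
      by (simp add: enc_esg_def enc_nat_append_eq enc_enat_append_eq)
  next
    case False
    then show ?thesis
      by (auto simp only: enc_esg_def append_assoc enc_nat_append_eq)
  qed
qed

lemma blue_leader_value_cong:
  assumes "enc_esg G = enc_esg G'"
  shows "blue_leader_value G = blue_leader_value G'"
proof -
  have *: "targets G = targets G'" "sensors G = sensors G'" "recharge G = recharge G'"
     "\<forall>i<targets G. target_value G i = target_value G' i"
     "\<forall>i<targets G. \<forall>j<sensors G. can_sense G i j = can_sense G' i j"
    using assms enc_esg_append_eq[of G "[]" G' "[]"] by simp_all
  have o: "target_ordering G = target_ordering G'"
    by (intro ext) (simp add: target_ordering_def *(1))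
  have s: "sensing_plan G \<psi> = sensing_plan G' \<psi>" for \<psi>
    by (simp add: sensing_plan_def *(1,2))
  have c: "(\<forall>j<sensors G. \<forall>i\<in>\<psi> j. can_sense G i j) =
      (\<forall>j<sensors G. \<forall>i\<in>\<psi> j. can_sense G' i j)" if "sensing_plan G \<psi>" for \<psi>
    using that *(5) unfolding sensing_plan_def by blast
  have v: "valid_plan G = valid_plan G'"
    by (intro ext) (simp add: valid_plan_def s[symmetric] *(2,3)[symmetric] c cong: conj_cong)
  have n: "not_sensed_value G = not_sensed_value G'"
    unfolding not_sensed_value_def *(1,2)[symmetric] using *(4) by (intro ext sum.cong) auto
  show ?thesis unfolding blue_leader_value_def o v n ..
qed


section \<open>The two computational problems on a class of games\<close>

definition brr_linear_time :: "esg set \<Rightarrow> bool" where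
  "brr_linear_time C \<longleftrightarrow> (\<exists>P c. \<forall>G\<in>C. \<forall>\<sigma>. target_ordering G \<sigma> \<longrightarrow>
     (let x = enc_esg G @ enc_ordering G \<sigma> in
       \<exists>\<psi>. best_red_response G \<sigma> \<psi> \<and>
         ram_computes P x (enc_plan G \<psi>) (c * length x + c) (poly_bound c (length x))))"

definition blse_NP_hard :: "esg set \<Rightarrow> bool" where
  "blse_NP_hard C \<longleftrightarrow> NP_hard
     {enc_esg G @ enc_rat l | G l. G \<in> C \<and> blue_leader_value G \<ge> l}
     {enc_esg G @ enc_rat l | G l. G \<in> C \<and> \<not> blue_leader_value G \<ge> l}"

text \<open>An input string never encodes both a positive and a negative instance.\<close>

lemma blse_yes_no_disjoint:
  "{enc_esg G @ enc_rat l | G l. G \<in> C \<and> blue_leader_value G \<ge> l} \<inter>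
  {enc_esg G @ enc_rat l | G l. G \<in> C \<and> \<not> blue_leader_value G \<ge> l} = {}"
proof -
  have "blue_leader_value G = blue_leader_value G' \<and> l = l'"
    if "enc_esg G @ enc_rat l = enc_esg G' @ enc_rat l'" for G G' l l'
  proof -
    have G: "enc_esg G @ [] = enc_esg G' @ []" and l: "enc_rat l @ [] = enc_rat l' @ []"
      using that unfolding enc_esg_append_eq by simp_all
    show ?thesis
      using blue_leader_value_cong[OF G[unfolded append_Nil2]] l[unfolded enc_rat_append_eq]
      by simp
  qed
  then show ?thesis
    unfolding disjoint_iff mem_Collect_eq by metis
qed

end

theory Submission
  imports Defs
begin

text \<open>
  Every sensor guards a target of its own which is so valuable that it must be sensed; the remaining targets, the
  lights, can be sensed by the sensors of at least six guards each.  A light certainly escapes if all these guards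
  are within distance three of it, so the blue player tries to surround lights by their guards.  Since two
  lights have at most one common guard and at most three guards of a light are shared, the red player can sense
  all other lights simultaneously, and a local rule tells by which sensor.  Idle sensors pad the
  input so that evaluating this rule takes linear time.

  A light with six guards that escapes has no room for anything else around it, and two escaping lights with a common guard
  have it exactly in the middle between them.  So a guard is used by at most two escaping lights, and by only one if
  it also belongs to an anchor, a valuable light whose other guards are private.  A light for a triple of
  guards, two of them with anchors, has anchors on both sides and hence uses its three guards exclusively: the blue player
  packs disjoint triples.  As in the reduction to three-dimensional matching, wheels and clause triples express
  satisfiability of a formula, and the variables of the formula say which component of a random access machine
  has which value at which time.

  Programs for the word RAM are obtained from a language of bounded loops in which every loop
  caps its accumulator, so that running times are polynomial for syntactic reasons.
\<close>


section \<open>A small language compiled to the word RAM\<close>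

text \<open>With recharging time 3 there are just six positions around a light, and the parameters
  are tuned to this number. If two nearby lights were to compete for a sensor, neither would have a
  private guard out of reach, as such a guard is uncontested; so both would have at most three far
  guards, and counting positions excludes the situation. This is the origin of six guards, three of
  them possibly shared, and one common guard per pair. A seventh guard makes a light impossible to
  surround; this is how a triple is forbidden while the numbers of targets stay the same. The
  weights are lexicographic: one guard outweighs all lights, one anchor all triples. The amount of
  padding is fixed after the program of the red player: the cost of computing a matrix entry is
  polynomial in the number of targets alone, the exponent of the padding is read off that
  polynomial, and hardness is shown for every exponent.\<close>

datatype expr =
    Num nat
  | Var nat
  | Bin binop expr expr
  | Inp expr
  | Fold nat expr expr expr expr

type_synonym env = "nat \<Rightarrow> nat"

fun eval :: "bool list \<Rightarrow> env \<Rightarrow> expr \<Rightarrow> nat" where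
  "eval x s (Num a) = a"
| "eval x s (Var k) = s k"
| "eval x s (Bin f a b) = binop_fun f (eval x s a) (eval x s b)"
| "eval x s (Inp a) = (if eval x s a < length x then of_bool (x ! eval x s a) else 0)"
| "eval x s (Fold k n c i b) = rec_nat (min (eval x s c) (eval x s i))
     (\<lambda>j a. min (eval x s c) (eval x (s(k := j, Suc k := a)) b)) (eval x s n)"

text \<open>The accumulator after an arbitrary number of rounds, so that invariants can speak about
  unfinished loops.\<close>

definition iter :: "bool list \<Rightarrow> env \<Rightarrow> nat \<Rightarrow> expr \<Rightarrow> expr \<Rightarrow> expr \<Rightarrow> nat \<Rightarrow> nat" where
  "iter x s k c i b = rec_nat (min (eval x s c) (eval x s i))
     (\<lambda>j a. min (eval x s c) (eval x (s(k := j, Suc k := a)) b))"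

lemma iter_0: "iter x s k c i b 0 = min (eval x s c) (eval x s i)"
  and iter_Suc: "iter x s k c i b (Suc j) =
    min (eval x s c) (eval x (s(k := j, Suc k := iter x s k c i b j)) b)"
  by (simp_all add: iter_def)

lemma eval_Fold: "eval x s (Fold k n c i b) = iter x s k c i b (eval x s n)"
  by (simp add: iter_def)

lemma iter_le: "iter x s k c i b j \<le> eval x s c"
  by (cases j) (simp_all add: iter_0 iter_Suc)

declare eval.simps(5) [simp del]

text \<open>An upper bound on machine steps. The constants count the instructions emitted around the
  subexpressions; a loop needs ten of them outside of its rounds and six in each round.\<close>

fun cost :: "bool list \<Rightarrow> env \<Rightarrow> expr \<Rightarrow> nat" where
  "cost x s (Num a) = 1"
| "cost x s (Var k) = 1"
| "cost x s (Bin f a b) = cost x s a + cost x s b + 1"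
| "cost x s (Inp a) = cost x s a + 4"
| "cost x s (Fold k n c i b) = cost x s n + cost x s c + cost x s i + 10 +
     (\<Sum>j<eval x s n. cost x (s(k := j, Suc k := iter x s k c i b j)) b + 6)"

fun fits_expr :: "nat \<Rightarrow> bool list \<Rightarrow> env \<Rightarrow> expr \<Rightarrow> bool" where
  "fits_expr W x s (Num a) \<longleftrightarrow> a \<le> W"
| "fits_expr W x s (Var k) \<longleftrightarrow> True"
| "fits_expr W x s (Bin f a b) \<longleftrightarrow> fits_expr W x s a \<and> fits_expr W x s b \<and>
     binop_fun f (eval x s a) (eval x s b) \<le> W"
| "fits_expr W x s (Inp a) \<longleftrightarrow> fits_expr W x s a"
| "fits_expr W x s (Fold k n c i b) \<longleftrightarrow> fits_expr W x s n \<and> fits_expr W x s c \<and> fits_expr W x s i \<and>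
     (\<forall>j<eval x s n. fits_expr W x (s(k := j, Suc k := iter x s k c i b j)) b)"

datatype stmt =
    Emit expr
  | Seq stmt stmt
  | For nat expr stmt
  | LetIn nat expr stmt

fun out :: "bool list \<Rightarrow> env \<Rightarrow> stmt \<Rightarrow> bool list" where
  "out x s (Emit e) = [eval x s e \<noteq> 0]"
| "out x s (Seq p q) = out x s p @ out x s q"
| "out x s (For k n p) = concat (map (\<lambda>i. out x (s(k := i)) p) [0..<eval x s n])"
| "out x s (LetIn k e p) = out x (s(k := eval x s e)) p"

fun scost :: "bool list \<Rightarrow> env \<Rightarrow> stmt \<Rightarrow> nat" where
  "scost x s (Emit e) = cost x s e + 5"
| "scost x s (Seq p q) = scost x s p + scost x s q"
| "scost x s (For k n p) = cost x s n + 5 + (\<Sum>i<eval x s n. scost x (s(k := i)) p + 4)"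
| "scost x s (LetIn k e p) = cost x s e + scost x (s(k := eval x s e)) p + 3"

fun fits_stmt :: "nat \<Rightarrow> bool list \<Rightarrow> env \<Rightarrow> stmt \<Rightarrow> bool" where
  "fits_stmt W x s (Emit e) \<longleftrightarrow> fits_expr W x s e"
| "fits_stmt W x s (Seq p q) \<longleftrightarrow> fits_stmt W x s p \<and> fits_stmt W x s q"
| "fits_stmt W x s (For k n p) \<longleftrightarrow> fits_expr W x s n \<and> (\<forall>i<eval x s n. fits_stmt W x (s(k := i)) p)"
| "fits_stmt W x s (LetIn k e p) \<longleftrightarrow> fits_expr W x s e \<and> fits_stmt W x (s(k := eval x s e)) p"


subsection \<open>Compilation\<close>

text \<open>Register 0 holds the input length, 1 the number of bits written so far, 2 and 3 the
  constants one and zero; the remaining registers alternate between temporaries and variables.\<close>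

definition tmp :: "nat \<Rightarrow> nat" where "tmp d = 4 + 2 * d"
definition vreg :: "nat \<Rightarrow> nat" where "vreg k = 5 + 2 * k"

lemma tmp_vreg_simps [simp]:
  "tmp d = tmp d' \<longleftrightarrow> d = d'" "vreg d = vreg d' \<longleftrightarrow> d = d'" "tmp d \<noteq> vreg k" "vreg k \<noteq> tmp d"
  "0 \<noteq> tmp d" "0 \<noteq> vreg k" "tmp d \<noteq> 0" "vreg k \<noteq> 0" "tmp d \<noteq> Suc 0" "vreg k \<noteq> Suc 0" "Suc 0 \<noteq> tmp d" "Suc 0 \<noteq> vreg k"
  "tmp d \<noteq> 1" "vreg k \<noteq> 1" "1 \<noteq> tmp d" "1 \<noteq> vreg k"
  "tmp d \<noteq> 2" "tmp d \<noteq> 3" "vreg k \<noteq> 2" "vreg k \<noteq> 3" "2 \<noteq> tmp d" "3 \<noteq> tmp d" "2 \<noteq> vreg k" "3 \<noteq> vreg k"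
  unfolding tmp_def vreg_def by presburger+

text \<open>Code at address \<open>p\<close>, needed since jump targets are absolute, that leaves
  the value in temporary \<open>d\<close> and spares all lower temporaries. The cap is obtained from
  truncated subtraction: \<open>a - (a - c)\<close> is the minimum. Register 3 is zero, so a jump on
  it is unconditional. A loop saves the two variables that it shadows and restores them at the
  end.\<close>

fun cexpr :: "expr \<Rightarrow> nat \<Rightarrow> nat \<Rightarrow> instr list" where
  "cexpr (Num a) d p = [Const (tmp d) a]"
| "cexpr (Var k) d p = [Arith Plus (tmp d) (vreg k) 3]"
| "cexpr (Bin f a b) d p =
     (let ca = cexpr a d p; cb = cexpr b (Suc d) (p + length ca)
      in ca @ cb @ [Arith f (tmp d) (tmp d) (tmp (Suc d))])"
| "cexpr (Inp a) d p =
     (let ca = cexpr a d p; q = p + length ca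
      in ca @ [Arith Minus (tmp (Suc d)) 0 (tmp d), JumpIfZero (tmp (Suc d)) (q + 4),
               Load (tmp d) (tmp d), JumpIfZero 3 (q + 5), Const (tmp d) 0])"
| "cexpr (Fold k n c i b) d p =
     (let cn = cexpr n d p; cc = cexpr c (d + 1) (p + length cn);
          ci = cexpr i (d + 2) (p + length cn + length cc);
          q = p + length cn + length cc + length ci;
          cb = cexpr b (d + 5) (q + 7)
      in cn @ cc @ ci @
         [Arith Plus (tmp (d + 3)) (vreg k) 3, Arith Plus (tmp (d + 4)) (vreg (Suc k)) 3,
          Arith Plus (vreg k) 3 3, Arith Minus (tmp (d + 5)) (tmp (d + 2)) (tmp (d + 1)),
          Arith Minus (vreg (Suc k)) (tmp (d + 2)) (tmp (d + 5)),
          Arith Minus (tmp (d + 2)) (tmp d) (vreg k), JumpIfZero (tmp (d + 2)) (q + 7 + length cb + 4)] @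
         cb @
         [Arith Minus (tmp (d + 2)) (tmp (d + 5)) (tmp (d + 1)),
          Arith Minus (vreg (Suc k)) (tmp (d + 5)) (tmp (d + 2)),
          Arith Plus (vreg k) (vreg k) 2, JumpIfZero 3 (q + 5),
          Arith Plus (tmp d) (vreg (Suc k)) 3, Arith Plus (vreg k) (tmp (d + 3)) 3,
          Arith Plus (vreg (Suc k)) (tmp (d + 4)) 3])"

text \<open>Subtracting from one twice turns any number into a bit. Output is written directly
  behind the input, at the address given by registers 0 and 1, so the input stays readable.\<close>

fun cstmt :: "stmt \<Rightarrow> nat \<Rightarrow> nat \<Rightarrow> instr list" where
  "cstmt (Emit e) d p =
     cexpr e d p @ [Arith Minus (tmp d) 2 (tmp d), Arith Minus (tmp d) 2 (tmp d),
       Arith Plus (tmp (Suc d)) 0 1, Store (tmp (Suc d)) (tmp d), Arith Plus 1 1 2]"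
| "cstmt (Seq a b) d p = (let ca = cstmt a d p in ca @ cstmt b d (p + length ca))"
| "cstmt (For k n a) d p =
     (let cn = cexpr n d p; q = p + length cn; ca = cstmt a (d + 3) (q + 4)
      in cn @ [Arith Plus (tmp (d + 1)) (vreg k) 3, Arith Plus (vreg k) 3 3,
           Arith Minus (tmp (d + 2)) (tmp d) (vreg k), JumpIfZero (tmp (d + 2)) (q + 4 + length ca + 2)] @
         ca @ [Arith Plus (vreg k) (vreg k) 2, JumpIfZero 3 (q + 2), Arith Plus (vreg k) (tmp (d + 1)) 3])"
| "cstmt (LetIn k e a) d p =
     (let ce = cexpr e d p; q = p + length ce; ca = cstmt a (d + 2) (q + 2)
      in ce @ [Arith Plus (tmp (d + 1)) (vreg k) 3, Arith Plus (vreg k) (tmp d) 3] @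
         ca @ [Arith Plus (vreg k) (tmp (d + 1)) 3])"

text \<open>The loop at the end moves the output down to address 0. The two regions may overlap;
  going upwards is safe because a source cell never lies below its destination.\<close>

definition cprog :: "stmt \<Rightarrow> instr list" where
  "cprog a = (let ca = cstmt a 0 2; q = 2 + length ca in
     [Const 2 1, Arith Plus (vreg 0) 0 3] @ ca @
     [Arith Plus (tmp 0) 3 3, Arith Minus (tmp 1) 1 (tmp 0), JumpIfZero (tmp 1) (q + 8),
      Arith Plus (tmp 1) 0 (tmp 0), Load (tmp 1) (tmp 1), Store (tmp 0) (tmp 1),
      Arith Plus (tmp 0) (tmp 0) 2, JumpIfZero 3 (q + 1), Arith Plus 0 1 3])"

definition env0 :: "bool list \<Rightarrow> env" where
  "env0 x = (\<lambda>k. if k = 0 then length x else 0)"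


subsection \<open>Executions\<close>

text \<open>The number of steps is only bounded, as the cost functions overestimate: reading beyond
  the end of the input, for example, takes one instruction less than a proper access.\<close>

definition reach :: "instr list \<Rightarrow> nat \<Rightarrow> nat \<Rightarrow> ram_state \<Rightarrow> ram_state \<Rightarrow> bool" where
  "reach P W n s s' \<longleftrightarrow> (\<exists>m\<le>n. (ram_step P ^^ m) s = s' \<and> (\<forall>i\<le>m. fits_words W ((ram_step P ^^ i) s)))"

lemma reach_refl: "fits_words W s \<Longrightarrow> reach P W n s s"
  unfolding reach_def by (intro exI[of _ 0]) auto

lemma reach_trans:
  assumes "reach P W n s s'" "reach P W m s' s''" shows "reach P W (n + m) s s''"
proof -
  obtain a where a: "a \<le> n" "(ram_step P ^^ a) s = s'" "\<forall>i\<le>a. fits_words W ((ram_step P ^^ i) s)"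
    using assms(1) unfolding reach_def by blast
  obtain b where b: "b \<le> m" "(ram_step P ^^ b) s' = s''" "\<forall>i\<le>b. fits_words W ((ram_step P ^^ i) s')"
    using assms(2) unfolding reach_def by blast
  have "fits_words W ((ram_step P ^^ i) s)" if "i \<le> b + a" for i
  proof (cases "i \<le> a")
    case False
    then have "i = (i - a) + a" "i - a \<le> b" using that by auto
    then show ?thesis using b(3) a(2) by (metis comp_apply funpow_add)
  qed (use a in auto)
  then show ?thesis unfolding reach_def using a b
    by (intro exI[of _ "b + a"]) (auto simp: funpow_add)
qed

lemma reach_mono: "reach P W n s s' \<Longrightarrow> n \<le> m \<Longrightarrow> reach P W m s s'"
  unfolding reach_def using le_trans by blast

lemma reach_fits: "reach P W n s s' \<Longrightarrow> fits_words W s'"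
  unfolding reach_def by blast

definition code_at :: "instr list \<Rightarrow> nat \<Rightarrow> instr list \<Rightarrow> bool" where
  "code_at P p c \<longleftrightarrow> (\<forall>i<length c. p + i < length P \<and> P ! (p + i) = c ! i)"

lemma code_at_append: "code_at P p (a @ b) \<longleftrightarrow> code_at P p a \<and> code_at P (p + length a) b"
proof
  assume L: "code_at P p (a @ b)"
  have "p + length a + i < length P \<and> P ! (p + length a + i) = b ! i" if "i < length b" for i
    using L[unfolded code_at_def, rule_format, of "length a + i"] that by (simp add: add.assoc)
  moreover have "p + i < length P \<and> P ! (p + i) = a ! i" if "i < length a" for i
    using L[unfolded code_at_def, rule_format, of i] that by (simp add: nth_append)
  ultimately show "code_at P p a \<and> code_at P (p + length a) b" by (simp add: code_at_def)
next
  assume R: "code_at P p a \<and> code_at P (p + length a) b"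
  have "p + i < length P \<and> P ! (p + i) = (a @ b) ! i" if "i < length (a @ b)" for i
  proof (cases "i < length a")
    case False
    then show ?thesis
      using conjunct2[OF R, unfolded code_at_def, rule_format, of "i - length a"] that
      by (auto simp: nth_append)
  qed (use R in \<open>auto simp: code_at_def nth_append\<close>)
  then show "code_at P p (a @ b)" by (simp add: code_at_def)
qed

lemma code_at_Cons: "code_at P p (i # c) \<longleftrightarrow> p < length P \<and> P ! p = i \<and> code_at P (Suc p) c"
proof -
  have "code_at P p [i] \<longleftrightarrow> p < length P \<and> P ! p = i" by (simp add: code_at_def)
  then show ?thesis using code_at_append[of P p "[i]" c] by simp
qed

lemma code_at_Nil [simp]: "code_at P p []" by (simp add: code_at_def)

abbreviation St :: "nat \<Rightarrow> (nat \<Rightarrow> nat) \<Rightarrow> (nat \<Rightarrow> nat) \<Rightarrow> ram_state" where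
  "St p R M \<equiv> \<lparr>pc = p, reg = R, mem = M\<rparr>"

definition fitf :: "nat \<Rightarrow> (nat \<Rightarrow> nat) \<Rightarrow> bool" where "fitf W R \<longleftrightarrow> (\<forall>r. R r \<le> W)"

lemma fits_St: "fits_words W (St p R M) \<longleftrightarrow> fitf W R \<and> fitf W M"
  by (simp add: fits_words_def fitf_def)

lemma fitf_upd [intro]: "fitf W R \<Longrightarrow> v \<le> W \<Longrightarrow> fitf W (R(r := v))"
  by (simp add: fitf_def)

lemma fitfD: "fitf W R \<Longrightarrow> R r \<le> W" by (simp add: fitf_def)

lemma reach_Cons:
  assumes "fits_words W s" "ram_step P s = s1" "reach P W n s1 s'"
  shows "reach P W (Suc n) s s'"
proof -
  have "reach P W 1 s s1"
    unfolding reach_def using assms(1,2) reach_fits reach_def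
  proof (intro exI[of _ 1] conjI allI impI)
    fix i :: nat assume "i \<le> 1"
    have "fits_words W s1" using assms(3) unfolding reach_def by (metis funpow_0 le0)
    then show "fits_words W ((ram_step P ^^ i) s)" using \<open>i \<le> 1\<close> assms(1,2)
      by (cases i) auto
  qed (use assms in auto)
  from reach_trans[OF this assms(3)] show ?thesis by simp
qed

lemma reach_instr:
  assumes "p < length P" "P ! p = i" "fitf W R" "fitf W M"
    "exec_instr i (St p R M) = s1" "reach P W n s1 s'"
  shows "reach P W (Suc n) (St p R M) s'"
  using assms by (intro reach_Cons[of W _ P s1]) (auto simp: ram_step_def ram_halted_def fits_St)

lemma reach_one:
  assumes "p < length P" "P ! p = i" "fitf W R" "fitf W M"
    "exec_instr i (St p R M) = St p' R' M'" "fitf W R'" "fitf W M'"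
  shows "reach P W 1 (St p R M) (St p' R' M')"
  using reach_instr[OF assms(1-5) reach_refl, of 0] assms by (simp add: fits_St)

definition rep :: "bool list \<Rightarrow> env \<Rightarrow> (nat \<Rightarrow> nat) \<Rightarrow> (nat \<Rightarrow> nat) \<Rightarrow> bool" where
  "rep x s R M \<longleftrightarrow> (\<forall>k. R (vreg k) = s k) \<and> R 0 = length x \<and> R 2 = 1 \<and> R 3 = 0 \<and>
     (\<forall>a<length x. M a = of_bool (x ! a))"

lemma rep_T: "rep x s R M \<Longrightarrow> rep x s (R(tmp d := v)) M"
  by (simp add: rep_def)

text \<open>Frame condition: everything except the temporaries from \<open>d\<close> on survives, in
  particular the values of earlier subexpressions in lower temporaries.\<close>

definition keeps :: "nat \<Rightarrow> (nat \<Rightarrow> nat) \<Rightarrow> (nat \<Rightarrow> nat) \<Rightarrow> bool" where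
  "keeps d R R' \<longleftrightarrow> (\<forall>r. (\<forall>j\<ge>d. r \<noteq> tmp j) \<longrightarrow> R' r = R r)"

lemma keepsT: "keeps d R R' \<Longrightarrow> e < d \<Longrightarrow> R' (tmp e) = R (tmp e)"
  and keepsV: "keeps d R R' \<Longrightarrow> R' (vreg k) = R (vreg k)"
  and keeps0: "keeps d R R' \<Longrightarrow> R' 0 = R 0"
  and keeps1: "keeps d R R' \<Longrightarrow> R' (Suc 0) = R (Suc 0)"
  and keeps2: "keeps d R R' \<Longrightarrow> R' 2 = R 2"
  and keeps3: "keeps d R R' \<Longrightarrow> R' 3 = R 3"
  by (auto simp: keeps_def)

lemma keeps_rep: "keeps d R R' \<Longrightarrow> rep x s R M \<Longrightarrow> rep x s R' M"
  by (simp add: rep_def keepsV keeps0 keeps2 keeps3)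

lemma keeps_refl: "keeps d R R" by (simp add: keeps_def)
lemma keeps_trans: "keeps d R R' \<Longrightarrow> keeps e R' R'' \<Longrightarrow> d \<le> e \<Longrightarrow> keeps d R R''"
  unfolding keeps_def by (metis le_trans)
lemma keeps_upd: "keeps d R R' \<Longrightarrow> d \<le> e \<Longrightarrow> keeps d R (R'(tmp e := v))"
  by (simp add: keeps_def)

lemma cexpr_correct:
  assumes "code_at P p (cexpr e d p)" "fits_expr W x s e" "rep x s R M" "fitf W R" "fitf W M"
  shows "\<exists>R'. reach P W (cost x s e) (St p R M) (St (p + length (cexpr e d p)) R' M) \<and>
     fitf W R' \<and> R' (tmp d) = eval x s e \<and> keeps d R R'"
  using assms
proof (induction e arbitrary: d p R s)
  case (Num a)
  let ?R = "R(tmp d := a)"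
  have c: "p < length P" "P ! p = Const (tmp d) a" using Num.prems(1) by (auto simp: code_at_Cons)
  have ff: "fitf W ?R" using Num.prems by - (rule fitf_upd, auto)
  have "reach P W 1 (St p R M) (St (Suc p) ?R M)"
    by (rule reach_one[OF c Num.prems(4,5) _ ff Num.prems(5)]) simp
  moreover have "?R (tmp d) = eval x s (Num a)" by simp
  moreover have "keeps d R ?R" by (simp add: keeps_upd keeps_refl)
  ultimately show ?case using ff by (simp only: cexpr.simps cost.simps list.size One_nat_def add_0_right add_Suc_right) blast
next
  case (Var k)
  let ?R = "R(tmp d := s k)"
  have c: "p < length P" "P ! p = Arith Plus (tmp d) (vreg k) 3" using Var.prems(1) by (auto simp: code_at_Cons)
  have r: "R (vreg k) = s k" "R 3 = 0" using Var.prems(3) by (auto simp: rep_def)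
  have ff: "fitf W ?R" using fitfD[OF Var.prems(4), of "vreg k"] r Var.prems by - (rule fitf_upd, auto)
  have "reach P W 1 (St p R M) (St (Suc p) ?R M)"
    by (rule reach_one[OF c Var.prems(4,5) _ ff Var.prems(5)]) (simp add: r)
  moreover have "?R (tmp d) = eval x s (Var k)" by simp
  moreover have "keeps d R ?R" by (simp add: keeps_upd keeps_refl)
  ultimately show ?case using ff by (simp only: cexpr.simps cost.simps list.size One_nat_def add_0_right add_Suc_right) blast
next
  case (Bin f a b)
  let ?ca = "cexpr a d p" let ?q = "p + length ?ca" let ?cb = "cexpr b (Suc d) ?q"
  have c: "code_at P p ?ca" "code_at P ?q ?cb"
    "?q + length ?cb < length P" "P ! (?q + length ?cb) = Arith f (tmp d) (tmp d) (tmp (Suc d))"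
    using Bin.prems(1) by (auto simp: Let_def code_at_append code_at_Cons add.assoc)
  obtain R1 where R1: "reach P W (cost x s a) (St p R M) (St ?q R1 M)" "fitf W R1"
    "R1 (tmp d) = eval x s a" "keeps d R R1"
    using Bin.IH(1)[OF c(1) _ Bin.prems(3,4,5)] Bin.prems(2) by auto
  have r1: "rep x s R1 M" using keeps_rep R1(4) Bin.prems(3) by blast
  obtain R2 where R2: "reach P W (cost x s b) (St ?q R1 M) (St (?q + length ?cb) R2 M)" "fitf W R2"
    "R2 (tmp (Suc d)) = eval x s b" "keeps (Suc d) R1 R2"
    using Bin.IH(2)[OF c(2) _ r1 R1(2) Bin.prems(5)] Bin.prems(2) by auto
  have d: "R2 (tmp d) = eval x s a" using R2(4) R1(3) by (simp add: keepsT)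
  let ?R = "R2(tmp d := eval x s (Bin f a b))"
  have ff: "fitf W ?R" using Bin.prems(2) R2(2) by - (rule fitf_upd, auto)
  have "reach P W 1 (St (?q + length ?cb) R2 M) (St (Suc (?q + length ?cb)) ?R M)"
    by (rule reach_one[OF c(3,4) R2(2) Bin.prems(5) _ ff Bin.prems(5)]) (simp add: d R2(3))
  note reach_trans[OF reach_trans[OF R1(1) R2(1)] this]
  moreover have "?R (tmp d) = eval x s (Bin f a b)" by simp
  moreover have "keeps d R ?R"
    using keeps_trans[OF R1(4) R2(4)] by (intro keeps_upd) auto
  moreover have "p + length (cexpr (Bin f a b) d p) = Suc (?q + length ?cb)"
    by (simp add: Let_def)
  ultimately show ?case using ff by (simp only: cost.simps) blast
next
  case (Inp a)
  let ?ca = "cexpr a d p" let ?q = "p + length ?ca"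
  have c: "code_at P p ?ca"
    "?q < length P" "P ! ?q = Arith Minus (tmp (Suc d)) 0 (tmp d)"
    "Suc ?q < length P" "P ! Suc ?q = JumpIfZero (tmp (Suc d)) (?q + 4)"
    "Suc (Suc ?q) < length P" "P ! Suc (Suc ?q) = Load (tmp d) (tmp d)"
    "Suc (Suc (Suc ?q)) < length P" "P ! Suc (Suc (Suc ?q)) = JumpIfZero 3 (?q + 5)"
    "Suc (Suc (Suc (Suc ?q))) < length P" "P ! Suc (Suc (Suc (Suc ?q))) = Const (tmp d) 0"
    using Inp.prems(1) by (auto simp: Let_def code_at_append code_at_Cons add.assoc)
  obtain R1 where R1: "reach P W (cost x s a) (St p R M) (St ?q R1 M)" "fitf W R1"
    "R1 (tmp d) = eval x s a" "keeps d R R1"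
    using Inp.IH[OF c(1) _ Inp.prems(3,4,5)] Inp.prems(2) by auto
  have r1: "rep x s R1 M" using keeps_rep R1(4) Inp.prems(3) by blast
  have N: "R1 0 = length x" "R1 3 = 0" using r1 by (auto simp: rep_def)
  have NW: "length x \<le> W" using fitfD[OF R1(2), of 0] N by simp
  have len: "p + length (cexpr (Inp a) d p) = ?q + 5" by (simp add: Let_def)
  note fM = Inp.prems(5)
  let ?R2 = "R1(tmp (Suc d) := length x - eval x s a)"
  have f2: "fitf W ?R2" using R1(2) NW by - (rule fitf_upd, auto)
  show ?case
  proof (cases "eval x s a < length x")
    case True
    let ?R3 = "?R2(tmp d := M (eval x s a))"
    have f3: "fitf W ?R3" using f2 Inp.prems(5) by - (rule fitf_upd, auto simp: fitfD)
    have "reach P W 1 (St ?q R1 M) (St (Suc ?q) ?R2 M)"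
      by (rule reach_one[OF c(2,3) R1(2) fM _ f2 fM]) (simp add: N R1(3))
    moreover have "reach P W 1 (St (Suc ?q) ?R2 M) (St (Suc (Suc ?q)) ?R2 M)"
      by (rule reach_one[OF c(4,5) f2 fM _ f2 fM]) (use True in simp)
    moreover have "reach P W 1 (St (Suc (Suc ?q)) ?R2 M) (St (Suc (Suc (Suc ?q))) ?R3 M)"
      by (rule reach_one[OF c(6,7) f2 fM _ f3 fM]) (simp add: R1(3))
    moreover have "reach P W 1 (St (Suc (Suc (Suc ?q))) ?R3 M) (St (?q + 5) ?R3 M)"
      by (rule reach_one[OF c(8,9) f3 fM _ f3 fM]) (simp add: N)
    ultimately have "reach P W (1+1+1+1) (St ?q R1 M) (St (?q + 5) ?R3 M)" by (meson reach_trans)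
    then have "reach P W 4 (St ?q R1 M) (St (?q + 5) ?R3 M)" by (rule reach_mono) simp
    note reach_trans[OF R1(1) this]
    moreover have "?R3 (tmp d) = eval x s (Inp a)" using True Inp.prems(3) by (simp add: rep_def)
    moreover have "keeps d R ?R3" using R1(4) by (intro keeps_upd) auto
    ultimately show ?thesis using f3 unfolding len by (simp only: cost.simps) blast
  next
    case False
    let ?R3 = "?R2(tmp d := 0)"
    have f3: "fitf W ?R3" using f2 by - (rule fitf_upd, auto)
    have "reach P W 1 (St ?q R1 M) (St (Suc ?q) ?R2 M)"
      by (rule reach_one[OF c(2,3) R1(2) fM _ f2 fM]) (simp add: N R1(3))
    moreover have "reach P W 1 (St (Suc ?q) ?R2 M) (St (?q + 4) ?R2 M)"
      by (rule reach_one[OF c(4,5) f2 fM _ f2 fM]) (use False in simp)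
    moreover have "reach P W 1 (St (?q + 4) ?R2 M) (St (?q + 5) ?R3 M)"
      by (rule reach_one[OF _ _ f2 fM _ f3 fM, where i = "Const (tmp d) 0"]) (use c(10,11) in \<open>simp_all add: numeral_eq_Suc del: fun_upd_apply\<close>)
    ultimately have "reach P W (1+1+1) (St ?q R1 M) (St (?q + 5) ?R3 M)" by (meson reach_trans)
    then have "reach P W (cost x s a + 4) (St p R M) (St (?q + 5) ?R3 M)"
      using reach_mono[OF reach_trans[OF R1(1)]] by simp
    moreover have "?R3 (tmp d) = eval x s (Inp a)" using False by simp
    moreover have "keeps d R ?R3" using R1(4) by (intro keeps_upd) auto
    ultimately show ?thesis using f3 unfolding len by (simp only: cost.simps) blast
  qed
next
  case (Fold k n c i b)
  let ?cn = "cexpr n d p" let ?p1 = "p + length ?cn"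
  let ?cc = "cexpr c (d + 1) ?p1" let ?p2 = "?p1 + length ?cc"
  let ?ci = "cexpr i (d + 2) ?p2" let ?q = "?p2 + length ?ci"
  let ?cb = "cexpr b (d + 5) (?q + 7)"
  let ?q2 = "?q + 7 + length ?cb"
  have len: "p + length (cexpr (Fold k n c i b) d p) = ?q2 + 7"
    by (simp add: Let_def)
  have c: "code_at P p ?cn" "code_at P ?p1 ?cc" "code_at P ?p2 ?ci" "code_at P (?q + 7) ?cb"
    and c0: "?q < length P" "P ! ?q = Arith Plus (tmp (d + 3)) (vreg k) 3"
    and c1: "?q + 1 < length P" "P ! (?q + 1) = Arith Plus (tmp (d + 4)) (vreg (Suc k)) 3"
    and c2: "?q + 2 < length P" "P ! (?q + 2) = Arith Plus (vreg k) 3 3"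
    and c3: "?q + 3 < length P" "P ! (?q + 3) = Arith Minus (tmp (d + 5)) (tmp (d + 2)) (tmp (d + 1))"
    and c4: "?q + 4 < length P" "P ! (?q + 4) = Arith Minus (vreg (Suc k)) (tmp (d + 2)) (tmp (d + 5))"
    and c5: "?q + 5 < length P" "P ! (?q + 5) = Arith Minus (tmp (d + 2)) (tmp d) (vreg k)"
    and c6: "?q + 6 < length P" "P ! (?q + 6) = JumpIfZero (tmp (d + 2)) (?q2 + 4)"
    and e0: "?q2 < length P" "P ! ?q2 = Arith Minus (tmp (d + 2)) (tmp (d + 5)) (tmp (d + 1))"
    and e1: "?q2 + 1 < length P" "P ! (?q2 + 1) = Arith Minus (vreg (Suc k)) (tmp (d + 5)) (tmp (d + 2))"
    and e2: "?q2 + 2 < length P" "P ! (?q2 + 2) = Arith Plus (vreg k) (vreg k) 2"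
    and e3: "?q2 + 3 < length P" "P ! (?q2 + 3) = JumpIfZero 3 (?q + 5)"
    and e4: "?q2 + 4 < length P" "P ! (?q2 + 4) = Arith Plus (tmp d) (vreg (Suc k)) 3"
    and e5: "?q2 + 5 < length P" "P ! (?q2 + 5) = Arith Plus (vreg k) (tmp (d + 3)) 3"
    and e6: "?q2 + 6 < length P" "P ! (?q2 + 6) = Arith Plus (vreg (Suc k)) (tmp (d + 4)) 3"
    using Fold.prems(1)
    by (auto simp: Let_def code_at_append code_at_Cons add.assoc numeral_eq_Suc)
  note fM = Fold.prems(5)
  obtain R1 where R1: "reach P W (cost x s n) (St p R M) (St ?p1 R1 M)" "fitf W R1"
    "R1 (tmp d) = eval x s n" "keeps d R R1"
    using Fold.IH(1)[OF c(1) _ Fold.prems(3,4,5)] Fold.prems(2) by auto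
  have r1: "rep x s R1 M" using keeps_rep R1(4) Fold.prems(3) by blast
  obtain R2 where R2: "reach P W (cost x s c) (St ?p1 R1 M) (St ?p2 R2 M)" "fitf W R2"
    "R2 (tmp (d+1)) = eval x s c" "keeps (d+1) R1 R2"
    using Fold.IH(2)[OF c(2) _ r1 R1(2) fM] Fold.prems(2) by auto
  have r2: "rep x s R2 M" using keeps_rep R2(4) r1 by blast
  obtain R3 where R3: "reach P W (cost x s i) (St ?p2 R2 M) (St ?q R3 M)" "fitf W R3"
    "R3 (tmp (d+2)) = eval x s i" "keeps (d+2) R2 R3"
    using Fold.IH(3)[OF c(3) _ r2 R2(2) fM] Fold.prems(2) by auto
  have r3: "rep x s R3 M" using keeps_rep R3(4) r2 by blast
  have T3: "R3 (tmp d) = eval x s n" "R3 (tmp (d+1)) = eval x s c"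
    using R1(3) R2(3,4) R3(4) by (auto simp: keepsT)
  have k3: "keeps d R R3" using R1(4) R2(4) R3(4) by (meson keeps_trans le_add1)
  have sW: "s j \<le> W" for j using r3 R3(2) by (metis fitfD rep_def)
  have nW: "eval x s n \<le> W" "eval x s c \<le> W" "eval x s i \<le> W"
    using T3 R3(2,3) by (metis fitfD)+
  have one: "1 \<le> W" "R3 2 = 1" "R3 3 = 0" using r3 fitfD[OF R3(2), of 2] by (auto simp: rep_def)
  define val where "val j = iter x s k c i b j" for j
  have valW: "val j \<le> W" for j unfolding val_def using iter_le nW(2) le_trans by blast
  \<comment> \<open>The temporaries \<open>d + 3\<close> and \<open>d + 4\<close> hold the shadowed
    values of the loop variables; \<open>d + 2\<close> and \<open>d + 5\<close> are scratch and do
    not occur in the invariant.\<close>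
  define inv where "inv j R' \<longleftrightarrow> fitf W R' \<and> R' (tmp d) = eval x s n \<and> R' (tmp (d+1)) = eval x s c \<and>
    R' (tmp (d+3)) = s k \<and> R' (tmp (d+4)) = s (Suc k) \<and> rep x (s(k := j, Suc k := val j)) R' M \<and>
    (\<forall>r. (\<forall>j\<ge>d. r \<noteq> tmp j) \<longrightarrow> r \<noteq> vreg k \<longrightarrow> r \<noteq> vreg (Suc k) \<longrightarrow> R' r = R r)" for j R'
  let ?A = "R3(tmp (d+3) := s k)" let ?B = "?A(tmp (d+4) := s (Suc k))" let ?C = "?B(vreg k := 0)"
  let ?D = "?C(tmp (d+5) := eval x s i - eval x s c)"
  let ?E = "?D(vreg (Suc k) := eval x s i - (eval x s i - eval x s c))"
  have fA: "fitf W ?A" using R3(2) sW by - (rule fitf_upd)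
  have fB: "fitf W ?B" using fA sW by - (rule fitf_upd)
  have fC: "fitf W ?C" using fB by - (rule fitf_upd, auto)
  have fD: "fitf W ?D" using fC nW by - (rule fitf_upd, auto)
  have fE: "fitf W ?E" using fD nW by - (rule fitf_upd, auto)
  have RV: "R3 (vreg j) = s j" for j using r3 by (simp add: rep_def)
  have init: "reach P W 5 (St ?q R3 M) (St (?q + 5) ?E M)"
  proof -
    have "reach P W 1 (St ?q R3 M) (St (?q + 1) ?A M)"
      by (rule reach_one[OF c0 R3(2) fM _ fA fM]) (simp add: RV one)
    moreover have "reach P W 1 (St (?q+1) ?A M) (St (?q + 2) ?B M)"
      by (rule reach_one[OF c1 fA fM _ fB fM]) (simp add: RV one)
    moreover have "reach P W 1 (St (?q+2) ?B M) (St (?q + 3) ?C M)"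
      by (rule reach_one[OF c2 fB fM _ fC fM]) (simp add: one)
    moreover have "reach P W 1 (St (?q+3) ?C M) (St (?q + 4) ?D M)"
      by (rule reach_one[OF c3 fC fM _ fD fM]) (use T3 R3(3) in simp)
    moreover have "reach P W 1 (St (?q+4) ?D M) (St (?q + 5) ?E M)"
      by (rule reach_one[OF c4 fD fM _ fE fM]) (use R3(3) in simp)
    ultimately have "reach P W (1+1+1+1+1) (St ?q R3 M) (St (?q + 5) ?E M)" by (meson reach_trans)
    then show ?thesis by (simp only: one_add_one numeral_plus_one semiring_norm)
  qed
  have "val 0 = eval x s i - (eval x s i - eval x s c)" by (simp add: val_def iter_0)
  then have inv0: "inv 0 ?E" unfolding inv_def
    using fE T3 r3 k3 by (auto simp: rep_def keeps_def)
  have loop: "\<exists>R'. inv j R' \<and> reach P W (\<Sum>j'<j. cost x (s(k := j', Suc k := val j')) b + 6)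
     (St (?q + 5) ?E M) (St (?q + 5) R' M)" if "j \<le> eval x s n" for j
    using that
  proof (induction j)
    case 0
    have "reach P W 0 (St (?q + 5) ?E M) (St (?q + 5) ?E M)"
      using fE fM by (intro reach_refl) (simp only: fits_St simp_thms)
    then show ?case using inv0 by (simp only: sum.lessThan_Suc lessThan_0 sum.empty) blast
  next
    case (Suc j)
    have "j \<le> eval x s n" using Suc.prems by simp
    from Suc.IH[OF this] obtain R' where R': "inv j R'" "reach P W (\<Sum>j'<j. cost x (s(k := j', Suc k := val j')) b + 6)
     (St (?q + 5) ?E M) (St (?q + 5) R' M)" by blast
    let ?s = "s(k := j, Suc k := val j)"
    let ?F = "R'(tmp (d+2) := eval x s n - j)"
    have fR': "fitf W R'" and rR': "rep x ?s R' M" using R'(1) by (auto simp: inv_def)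
    have fF: "fitf W ?F" using fR' nW by - (rule fitf_upd, auto)
    have s1: "reach P W 1 (St (?q+5) R' M) (St (?q + 6) ?F M)"
      by (rule reach_one[OF c5 fR' fM _ fF fM]) (use R'(1) in \<open>simp add: inv_def rep_def\<close>)
    have s2: "reach P W 1 (St (?q+6) ?F M) (St (?q + 7) ?F M)"
      by (rule reach_one[OF c6 fF fM _ fF fM]) (use Suc.prems in simp)
    have rF: "rep x ?s ?F M" using rR' by (rule rep_T)
    have "j < eval x s n" using Suc.prems by simp
    then have fb: "fits_expr W x ?s b" using Fold.prems(2) unfolding fits_expr.simps val_def by blast
    obtain G where G: "reach P W (cost x ?s b) (St (?q+7) ?F M) (St ?q2 G M)" "fitf W G"
      "G (tmp (d+5)) = eval x ?s b" "keeps (d+5) ?F G"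
      using Fold.IH(4)[OF c(4) fb rF fF fM] by blast
    have rG: "rep x ?s G M" using keeps_rep G(4) rF by blast
    have GT: "G (tmp d) = eval x s n" "G (tmp (d+1)) = eval x s c" "G (tmp (d+3)) = s k" "G (tmp (d+4)) = s (Suc k)"
      using R'(1) G(4) by (auto simp: inv_def keepsT)
    have G0: "G 3 = 0" "G 2 = 1" "G (vreg k) = j" using rG by (auto simp: rep_def)
    let ?v = "eval x ?s b"
    have vW: "?v \<le> W" using G(2,3) by (metis fitfD)
    let ?H = "G(tmp (d+2) := ?v - eval x s c)"
    let ?I = "?H(vreg (Suc k) := ?v - (?v - eval x s c))"
    let ?J = "?I(vreg k := Suc j)"
    have fH: "fitf W ?H" using G(2) vW by - (rule fitf_upd, auto)
    have fI: "fitf W ?I" using fH vW by - (rule fitf_upd, auto)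
    have fJ: "fitf W ?J" using fI Suc.prems nW by - (rule fitf_upd, auto)
    have "reach P W 1 (St ?q2 G M) (St (?q2 + 1) ?H M)"
      by (rule reach_one[OF e0 G(2) fM _ fH fM]) (use GT(2) in \<open>simp add: G(3)\<close>)
    moreover have "reach P W 1 (St (?q2+1) ?H M) (St (?q2 + 2) ?I M)"
      by (rule reach_one[OF e1 fH fM _ fI fM]) (simp add: G(3) GT)
    moreover have "reach P W 1 (St (?q2+2) ?I M) (St (?q2 + 3) ?J M)"
      by (rule reach_one[OF e2 fI fM _ fJ fM]) (simp add: G0)
    moreover have "reach P W 1 (St (?q2+3) ?J M) (St (?q + 5) ?J M)"
      by (rule reach_one[OF e3 fJ fM _ fJ fM]) (simp add: G0)
    ultimately have tail: "reach P W (1+1+1+1) (St ?q2 G M) (St (?q + 5) ?J M)"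
      by (meson reach_trans)
    have body: "reach P W (cost x ?s b + 6) (St (?q+5) R' M) (St (?q+5) ?J M)"
      by (rule reach_mono[OF reach_trans[OF reach_trans[OF reach_trans[OF s1 s2] G(1)] tail]]) simp
    have "val (Suc j) = ?v - (?v - eval x s c)" unfolding val_def by (simp add: iter_Suc)
    then have "inv (Suc j) ?J"
      using rG GT fJ R'(1) G(4) unfolding inv_def by (auto simp: rep_def keeps_def)
    then show ?case using reach_trans[OF R'(2) body] by (simp only: sum.lessThan_Suc) blast
  qed
  obtain L where L: "inv (eval x s n) L" "reach P W (\<Sum>j'<eval x s n. cost x (s(k := j', Suc k := val j')) b + 6)
     (St (?q + 5) ?E M) (St (?q + 5) L M)" using loop[OF order_refl] by blast
  have fL: "fitf W L" and rL: "rep x (s(k := eval x s n, Suc k := val (eval x s n))) L M"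
    using L(1) by (auto simp: inv_def)
  have LT: "L (tmp d) = eval x s n" "L (tmp (d+3)) = s k" "L (tmp (d+4)) = s (Suc k)" "L 3 = 0"
    "L (vreg k) = eval x s n" "L (vreg (Suc k)) = val (eval x s n)"
    using L(1) rL by (auto simp: inv_def rep_def)
  let ?F = "L(tmp (d+2) := 0)" let ?G = "?F(tmp d := val (eval x s n))" let ?H = "?G(vreg k := s k)"
  let ?I = "?H(vreg (Suc k) := s (Suc k))"
  have fF: "fitf W ?F" using fL by - (rule fitf_upd, auto)
  have fG: "fitf W ?G" using fF valW by - (rule fitf_upd, auto)
  have fH: "fitf W ?H" using fG sW by - (rule fitf_upd, auto)
  have fI: "fitf W ?I" using fH sW by - (rule fitf_upd, auto)
  have "reach P W 1 (St (?q+5) L M) (St (?q + 6) ?F M)"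
    by (rule reach_one[OF c5 fL fM _ fF fM]) (simp add: LT)
  moreover have "reach P W 1 (St (?q+6) ?F M) (St (?q2 + 4) ?F M)"
    by (rule reach_one[OF c6 fF fM _ fF fM]) simp
  moreover have "reach P W 1 (St (?q2+4) ?F M) (St (?q2 + 5) ?G M)"
    by (rule reach_one[OF e4 fF fM _ fG fM]) (simp add: LT)
  moreover have "reach P W 1 (St (?q2+5) ?G M) (St (?q2 + 6) ?H M)"
    by (rule reach_one[OF e5 fG fM _ fH fM]) (simp add: LT)
  moreover have "reach P W 1 (St (?q2+6) ?H M) (St (?q2 + 7) ?I M)"
    by (rule reach_one[OF e6 fH fM _ fI fM]) (simp add: LT)
  ultimately have fin: "reach P W (1+1+1+1+1) (St (?q+5) L M) (St (?q2 + 7) ?I M)"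
    by (meson reach_trans)
  have "reach P W (cost x s (Fold k n c i b)) (St p R M) (St (?q2 + 7) ?I M)"
    using reach_trans[OF reach_trans[OF reach_trans[OF reach_trans[OF reach_trans[OF R1(1) R2(1)] R3(1)] init] L(2)] fin]
    by (simp add: val_def add_ac)
  moreover have "keeps d R ?I" unfolding keeps_def
  proof (intro allI impI)
    fix r assume r: "\<forall>j\<ge>d. r \<noteq> tmp j"
    have "R (vreg j) = s j" for j using Fold.prems(3) by (simp add: rep_def)
    then show "?I r = R r" using r L(1) by (auto simp: inv_def)
  qed
  moreover have "?I (tmp d) = eval x s (Fold k n c i b)" by (simp add: val_def eval_Fold)
  ultimately show ?case using fI unfolding len by blast
qed

section \<open>Correctness of compiled statements and programs\<close>

definition keepsS :: "nat \<Rightarrow> (nat \<Rightarrow> nat) \<Rightarrow> (nat \<Rightarrow> nat) \<Rightarrow> bool" where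
  "keepsS d R R' \<longleftrightarrow> (\<forall>r. r \<noteq> 1 \<longrightarrow> (\<forall>j\<ge>d. r \<noteq> tmp j) \<longrightarrow> R' r = R r)"

lemma keepsST: "keepsS d R R' \<Longrightarrow> e < d \<Longrightarrow> R' (tmp e) = R (tmp e)"
  and keepsSV: "keepsS d R R' \<Longrightarrow> R' (vreg k) = R (vreg k)"
  and keepsS0: "keepsS d R R' \<Longrightarrow> R' 0 = R 0"
  and keepsS2: "keepsS d R R' \<Longrightarrow> R' 2 = R 2"
  and keepsS3: "keepsS d R R' \<Longrightarrow> R' 3 = R 3"
  by (auto simp: keepsS_def)

text \<open>The entire memory as a function of the output so far. Until the final copying, no other
  cell is written.\<close>

definition memo :: "bool list \<Rightarrow> bool list \<Rightarrow> nat \<Rightarrow> nat" where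
  "memo x w a = (if a < length (x @ w) then of_bool ((x @ w) ! a) else 0)"

lemma memo_fits: "1 \<le> W \<Longrightarrow> fitf W (memo x w)"
  by (auto simp: memo_def fitf_def)

lemma memo_snoc: "(memo x w)(length x + length w := of_bool b) = memo x (w @ [b])"
  by (auto simp: memo_def fun_eq_iff nth_append)

definition orep :: "bool list \<Rightarrow> env \<Rightarrow> bool list \<Rightarrow> (nat \<Rightarrow> nat) \<Rightarrow> bool" where
  "orep x s w R \<longleftrightarrow> (\<forall>k. R (vreg k) = s k) \<and> R 0 = length x \<and> R 1 = length w \<and> R 2 = 1 \<and> R 3 = 0"

lemma orep_rep: "orep x s w R \<Longrightarrow> rep x s R (memo x w)"
  by (auto simp: orep_def rep_def memo_def nth_append)

lemma keepsS_orep: "keepsS d R R' \<Longrightarrow> R' 1 = length w' \<Longrightarrow> orep x s w R \<Longrightarrow> orep x s w' R'"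
  by (simp add: orep_def keepsSV keepsS0 keepsS2 keepsS3)

lemma keeps_orep: "keeps d R R' \<Longrightarrow> orep x s w R \<Longrightarrow> orep x s w R'"
  by (simp add: orep_def keepsV keeps0 keeps1 keeps2 keeps3)

lemma cstmt_correct:
  assumes "code_at P p (cstmt a d p)" "fits_stmt W x s a" "orep x s w R" "fitf W R"
    "length x + length w + length (out x s a) \<le> W"
  shows "\<exists>R'. reach P W (scost x s a) (St p R (memo x w)) (St (p + length (cstmt a d p)) R' (memo x (w @ out x s a))) \<and>
     fitf W R' \<and> R' 1 = length (w @ out x s a) \<and> keepsS d R R'"
  using assms
proof (induction a arbitrary: d p R s w)
  case (Emit e)
  let ?M = "memo x w"
  let ?ce = "cexpr e d p" let ?q = "p + length ?ce"
  have c: "code_at P p ?ce"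
    and c0: "?q < length P" "P ! ?q = Arith Minus (tmp d) 2 (tmp d)"
    and c1: "?q + 1 < length P" "P ! (?q + 1) = Arith Minus (tmp d) 2 (tmp d)"
    and c2: "?q + 2 < length P" "P ! (?q + 2) = Arith Plus (tmp (Suc d)) 0 1"
    and c3: "?q + 3 < length P" "P ! (?q + 3) = Store (tmp (Suc d)) (tmp d)"
    and c4: "?q + 4 < length P" "P ! (?q + 4) = Arith Plus 1 1 2"
    using Emit.prems(1) by (auto simp: Let_def code_at_append code_at_Cons add.assoc numeral_eq_Suc)
  have one: "1 \<le> W" using fitfD[OF Emit.prems(4), of 2] Emit.prems(3) by (simp add: orep_def)
  have fM: "fitf W ?M" using one by (rule memo_fits)
  have fe: "fits_expr W x s e" using Emit.prems(2) by simp
  obtain R1 where R1: "reach P W (cost x s e) (St p R ?M) (St ?q R1 ?M)" "fitf W R1"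
    "R1 (tmp d) = eval x s e" "keeps d R R1"
    using cexpr_correct[OF c fe orep_rep[OF Emit.prems(3)] Emit.prems(4) fM] by blast
  have r1: "orep x s w R1" using keeps_orep[OF R1(4) Emit.prems(3)] .
  have N: "R1 0 = length x" "R1 1 = length w" "R1 2 = 1" "R1 3 = 0" using r1 by (auto simp: orep_def)
  let ?b = "eval x s e \<noteq> 0"
  let ?A = "R1(tmp d := 1 - eval x s e)" let ?B = "?A(tmp d := of_bool ?b)"
  let ?C = "?B(tmp (Suc d) := length x + length w)" let ?D = "?C(1 := Suc (length w))"
  have fA: "fitf W ?A" using R1(2) one by - (rule fitf_upd, auto)
  have fB: "fitf W ?B" using fA one by - (rule fitf_upd, auto)
  have fC: "fitf W ?C" using fB Emit.prems(5) by - (rule fitf_upd, auto)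
  have fD: "fitf W ?D" using fC Emit.prems(5) by - (rule fitf_upd, auto)
  let ?M' = "memo x (w @ [?b])"
  have fM': "fitf W ?M'" using one by (rule memo_fits)
  have "reach P W 1 (St ?q R1 ?M) (St (?q + 1) ?A ?M)"
    by (rule reach_one[OF c0 R1(2) fM _ fA fM]) (use N R1(3) in simp)
  moreover have "reach P W 1 (St (?q+1) ?A ?M) (St (?q + 2) ?B ?M)"
    by (rule reach_one[OF c1 fA fM _ fB fM]) (use N R1(3) in \<open>simp add: fun_eq_iff\<close>)
  moreover have "reach P W 1 (St (?q+2) ?B ?M) (St (?q + 3) ?C ?M)"
    by (rule reach_one[OF c2 fB fM _ fC fM]) (use N in simp)
  moreover have "reach P W 1 (St (?q+3) ?C ?M) (St (?q + 4) ?C ?M')"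
    by (rule reach_one[OF c3 fC fM _ fC fM']) (simp add: memo_snoc[symmetric])
  moreover have "reach P W 1 (St (?q+4) ?C ?M') (St (?q + 5) ?D ?M')"
    by (rule reach_one[OF c4 fC fM' _ fD fM']) (use N in simp)
  ultimately have "reach P W (1+1+1+1+1) (St ?q R1 ?M) (St (?q + 5) ?D ?M')" by (meson reach_trans)
  then have "reach P W (scost x s (Emit e)) (St p R ?M) (St (?q + 5) ?D ?M')"
    by (intro reach_mono[OF reach_trans[OF R1(1)]]) auto
  moreover have "?D 1 = length (w @ out x s (Emit e))" by simp
  moreover have "keepsS d R ?D" using R1(4) by (simp add: keepsS_def keeps_def)
  moreover have "p + length (cstmt (Emit e) d p) = ?q + 5" by simp
  moreover have "w @ [?b] = w @ out x s (Emit e)" by simp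
  ultimately show ?case using fD by (simp only:) blast
next
  case (Seq a b)
  let ?ca = "cstmt a d p" let ?q = "p + length ?ca"
  have c: "code_at P p ?ca" "code_at P ?q (cstmt b d ?q)"
    using Seq.prems(1) by (auto simp: Let_def code_at_append)
  have fa: "fits_stmt W x s a" and fb: "fits_stmt W x s b" using Seq.prems(2) by auto
  have l: "length x + length w + length (out x s a) \<le> W"
     "length x + length (w @ out x s a) + length (out x s b) \<le> W" using Seq.prems(5) by auto
  obtain R1 where R1: "reach P W (scost x s a) (St p R (memo x w)) (St ?q R1 (memo x (w @ out x s a)))" "fitf W R1"
    "R1 1 = length (w @ out x s a)" "keepsS d R R1"
    using Seq.IH(1)[OF c(1) fa Seq.prems(3,4) l(1)] by blast
  have r1: "orep x s (w @ out x s a) R1" by (rule keepsS_orep[OF R1(4,3) Seq.prems(3)])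
  obtain R2 where R2: "reach P W (scost x s b) (St ?q R1 (memo x (w @ out x s a)))
     (St (?q + length (cstmt b d ?q)) R2 (memo x ((w @ out x s a) @ out x s b)))" "fitf W R2"
    "R2 1 = length ((w @ out x s a) @ out x s b)" "keepsS d R1 R2"
    using Seq.IH(2)[OF c(2) fb r1 R1(2) l(2)] by blast
  have "keepsS d R R2" using R1(4) R2(4) by (simp add: keepsS_def)
  moreover have "p + length (cstmt (Seq a b) d p) = ?q + length (cstmt b d ?q)" by (simp add: Let_def)
  ultimately show ?case using reach_trans[OF R1(1) R2(1)] R2(2,3)
    by (simp only: scost.simps out.simps append_assoc) blast
next
  case (For k n a)
  let ?cn = "cexpr n d p" let ?q = "p + length ?cn" let ?ca = "cstmt a (d + 3) (?q + 4)"
  let ?q2 = "?q + 4 + length ?ca"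
  have len: "p + length (cstmt (For k n a) d p) = ?q2 + 3" by (simp add: Let_def)
  have c: "code_at P p ?cn" "code_at P (?q + 4) ?ca"
    and c0: "?q < length P" "P ! ?q = Arith Plus (tmp (d + 1)) (vreg k) 3"
    and c1: "?q + 1 < length P" "P ! (?q + 1) = Arith Plus (vreg k) 3 3"
    and c2: "?q + 2 < length P" "P ! (?q + 2) = Arith Minus (tmp (d + 2)) (tmp d) (vreg k)"
    and c3: "?q + 3 < length P" "P ! (?q + 3) = JumpIfZero (tmp (d + 2)) (?q2 + 2)"
    and e0: "?q2 < length P" "P ! ?q2 = Arith Plus (vreg k) (vreg k) 2"
    and e1: "?q2 + 1 < length P" "P ! (?q2 + 1) = JumpIfZero 3 (?q + 2)"
    and e2: "?q2 + 2 < length P" "P ! (?q2 + 2) = Arith Plus (vreg k) (tmp (d + 1)) 3"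
    using For.prems(1) by (auto simp: Let_def code_at_append code_at_Cons add.assoc numeral_eq_Suc)
  have one: "1 \<le> W" using fitfD[OF For.prems(4), of 2] For.prems(3) by (simp add: orep_def)
  have fM: "fitf W (memo x w)" for w using one by (rule memo_fits)
  have fn: "fits_expr W x s n" using For.prems(2) by simp
  obtain R1 where R1: "reach P W (cost x s n) (St p R (memo x w)) (St ?q R1 (memo x w))" "fitf W R1"
    "R1 (tmp d) = eval x s n" "keeps d R R1"
    using cexpr_correct[OF c(1) fn orep_rep[OF For.prems(3)] For.prems(4) fM] by blast
  have r1: "orep x s w R1" using keeps_orep[OF R1(4) For.prems(3)] .
  have N: "R1 0 = length x" "R1 1 = length w" "R1 2 = 1" "R1 3 = 0" "R1 (vreg j) = s j" for j using r1 by (auto simp: orep_def)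
  have sW: "s j \<le> W" for j using N(5) R1(2) by (metis fitfD)
  have nW: "eval x s n \<le> W" using R1(2,3) by (metis fitfD)
  let ?A = "R1(tmp (d+1) := s k)" let ?B = "?A(vreg k := 0)"
  have fA: "fitf W ?A" using R1(2) sW by - (rule fitf_upd)
  have fB: "fitf W ?B" using fA by - (rule fitf_upd, auto)
  have "reach P W 1 (St ?q R1 (memo x w)) (St (?q + 1) ?A (memo x w))"
    by (rule reach_one[OF c0 R1(2) fM _ fA fM]) (use N in simp)
  moreover have "reach P W 1 (St (?q+1) ?A (memo x w)) (St (?q + 2) ?B (memo x w))"
    by (rule reach_one[OF c1 fA fM _ fB fM]) (use N in simp)
  ultimately have init: "reach P W (1+1) (St ?q R1 (memo x w)) (St (?q + 2) ?B (memo x w))"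
    by (rule reach_trans)
  define o' where "o' j = w @ concat (map (\<lambda>i. out x (s(k := i)) a) [0..<j])" for j
  have o'Suc: "o' (Suc j) = o' j @ out x (s(k := j)) a" for j by (simp add: o'_def)
  have o'W: "length x + length (o' j) \<le> W" if "j \<le> eval x s n" for j
  proof -
    have "[0..<eval x s n] = [0..<j] @ [j..<eval x s n]" using that by (metis le0 le_add_diff_inverse upt_add_eq_append)
    then show ?thesis using For.prems(5) by (simp add: o'_def)
  qed
  define inv where "inv j R' \<longleftrightarrow> fitf W R' \<and> R' (tmp d) = eval x s n \<and> R' (tmp (d+1)) = s k \<and>
    orep x (s(k := j)) (o' j) R' \<and>
    (\<forall>r. r \<noteq> 1 \<longrightarrow> (\<forall>j\<ge>d. r \<noteq> tmp j) \<longrightarrow> r \<noteq> vreg k \<longrightarrow> R' r = R r)" for j R'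
  have inv0: "inv 0 ?B" using fB R1(3,4) N by (auto simp: inv_def orep_def o'_def keeps_def)
  have loop: "\<exists>R'. inv j R' \<and> reach P W (\<Sum>i<j. scost x (s(k := i)) a + 4)
     (St (?q + 2) ?B (memo x w)) (St (?q + 2) R' (memo x (o' j)))" if "j \<le> eval x s n" for j
    using that
  proof (induction j)
    case 0
    have "reach P W 0 (St (?q + 2) ?B (memo x w)) (St (?q + 2) ?B (memo x (o' 0)))"
      using fB fM by (simp only: o'_def upt.simps list.map concat.simps append_Nil2 if_False less_irrefl le0 if_True)
       (auto intro!: reach_refl simp only: fits_St simp_thms)
    then show ?case using inv0 by (simp only: sum.lessThan_Suc lessThan_0 sum.empty) blast
  next
    case (Suc j)
    have j: "j < eval x s n" "j \<le> eval x s n" using Suc.prems by simp_all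
    from Suc.IH[OF j(2)] obtain R' where R': "inv j R'" "reach P W (\<Sum>i<j. scost x (s(k := i)) a + 4)
     (St (?q + 2) ?B (memo x w)) (St (?q + 2) R' (memo x (o' j)))" by blast
    let ?F = "R'(tmp (d+2) := eval x s n - j)"
    have fR': "fitf W R'" and rR': "orep x (s(k := j)) (o' j) R'" using R'(1) by (auto simp: inv_def)
    have fF: "fitf W ?F" using fR' nW by - (rule fitf_upd, auto)
    have s1: "reach P W 1 (St (?q+2) R' (memo x (o' j))) (St (?q + 3) ?F (memo x (o' j)))"
      by (rule reach_one[OF c2 fR' fM _ fF fM]) (use R'(1) in \<open>simp add: inv_def orep_def\<close>)
    have s2: "reach P W 1 (St (?q+3) ?F (memo x (o' j))) (St (?q + 4) ?F (memo x (o' j)))"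
      by (rule reach_one[OF c3 fF fM _ fF fM]) (use j in simp)
    have rF: "orep x (s(k := j)) (o' j) ?F" using rR' by (simp add: orep_def)
    have fa: "fits_stmt W x (s(k := j)) a" using For.prems(2) j by simp
    have la: "length x + length (o' j) + length (out x (s(k := j)) a) \<le> W"
      using o'W[of "Suc j"] Suc.prems by (simp add: o'Suc)
    obtain G where G: "reach P W (scost x (s(k := j)) a) (St (?q+4) ?F (memo x (o' j)))
        (St ?q2 G (memo x (o' j @ out x (s(k := j)) a)))" "fitf W G"
      "G 1 = length (o' j @ out x (s(k := j)) a)" "keepsS (d+3) ?F G"
      using For.IH[OF c(2) fa rF fF la] by blast
    have rG: "orep x (s(k := j)) (o' (Suc j)) G" unfolding o'Suc by (rule keepsS_orep[OF G(4,3) rF])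
    have GT: "G (tmp d) = eval x s n" "G (tmp (d+1)) = s k"
      using R'(1) G(4) by (auto simp: inv_def keepsST)
    let ?H = "G(vreg k := Suc j)"
    have fH: "fitf W ?H" using G(2) j nW by - (rule fitf_upd, auto)
    have "reach P W 1 (St ?q2 G (memo x (o' (Suc j)))) (St (?q2 + 1) ?H (memo x (o' (Suc j))))"
      by (rule reach_one[OF e0 G(2) fM _ fH fM]) (use rG in \<open>simp add: orep_def\<close>)
    moreover have "reach P W 1 (St (?q2+1) ?H (memo x (o' (Suc j)))) (St (?q + 2) ?H (memo x (o' (Suc j))))"
      by (rule reach_one[OF e1 fH fM _ fH fM]) (use rG in \<open>simp add: orep_def\<close>)
    ultimately have tail: "reach P W (1+1) (St ?q2 G (memo x (o' (Suc j)))) (St (?q + 2) ?H (memo x (o' (Suc j))))"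
      by (rule reach_trans)
    have body: "reach P W (scost x (s(k := j)) a + 4) (St (?q+2) R' (memo x (o' j))) (St (?q+2) ?H (memo x (o' (Suc j))))"
      by (rule reach_mono[OF reach_trans[OF reach_trans[OF reach_trans[OF s1 s2] G(1)[folded o'Suc]] tail]]) simp
    have "inv (Suc j) ?H"
      using rG GT fH R'(1) G(4) unfolding inv_def by (auto simp: orep_def keepsS_def)
    then show ?case using reach_trans[OF R'(2) body] by (simp only: sum.lessThan_Suc) blast
  qed
  obtain L where L: "inv (eval x s n) L" "reach P W (\<Sum>i<eval x s n. scost x (s(k := i)) a + 4)
     (St (?q + 2) ?B (memo x w)) (St (?q + 2) L (memo x (o' (eval x s n))))" using loop[OF order_refl] by blast
  let ?o = "o' (eval x s n)"
  have fL: "fitf W L" and rL: "orep x (s(k := eval x s n)) ?o L" using L(1) by (auto simp: inv_def)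
  have LT: "L (tmp d) = eval x s n" "L (tmp (d+1)) = s k" "L 3 = 0" "L (vreg k) = eval x s n" "L 1 = length ?o"
    using L(1) rL by (auto simp: inv_def orep_def)
  let ?F = "L(tmp (d+2) := 0)" let ?G = "?F(vreg k := s k)"
  have fF: "fitf W ?F" using fL by - (rule fitf_upd, auto)
  have fG: "fitf W ?G" using fF sW by - (rule fitf_upd)
  have "reach P W 1 (St (?q+2) L (memo x ?o)) (St (?q + 3) ?F (memo x ?o))"
    by (rule reach_one[OF c2 fL fM _ fF fM]) (simp add: LT)
  moreover have "reach P W 1 (St (?q+3) ?F (memo x ?o)) (St (?q2 + 2) ?F (memo x ?o))"
    by (rule reach_one[OF c3 fF fM _ fF fM]) simp
  moreover have "reach P W 1 (St (?q2+2) ?F (memo x ?o)) (St (?q2 + 3) ?G (memo x ?o))"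
    by (rule reach_one[OF e2 fF fM _ fG fM]) (use LT in simp)
  ultimately have fin: "reach P W (1+1+1) (St (?q+2) L (memo x ?o)) (St (?q2 + 3) ?G (memo x ?o))"
    by (meson reach_trans)
  have "reach P W (scost x s (For k n a)) (St p R (memo x w)) (St (?q2 + 3) ?G (memo x ?o))"
    by (rule reach_mono[OF reach_trans[OF reach_trans[OF reach_trans[OF R1(1) init] L(2)] fin]]) simp
  moreover have "?o = w @ out x s (For k n a)" by (simp add: o'_def)
  moreover have "?G 1 = length ?o" using LT by simp
  moreover have "keepsS d R ?G" unfolding keepsS_def
  proof (intro allI impI)
    fix r assume r: "r \<noteq> 1" "\<forall>j\<ge>d. r \<noteq> tmp j"
    have "R (vreg j) = s j" for j using For.prems(3) by (simp add: orep_def)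
    then show "?G r = R r" using r L(1) by (auto simp: inv_def)
  qed
  ultimately show ?case using fG unfolding len by (simp only:) blast
next
  case (LetIn k e a)
  let ?ce = "cexpr e d p" let ?q = "p + length ?ce" let ?ca = "cstmt a (d + 2) (?q + 2)"
  let ?q2 = "?q + 2 + length ?ca"
  have len: "p + length (cstmt (LetIn k e a) d p) = ?q2 + 1" by (simp add: Let_def)
  have c: "code_at P p ?ce" "code_at P (?q + 2) ?ca"
    and c0: "?q < length P" "P ! ?q = Arith Plus (tmp (d + 1)) (vreg k) 3"
    and c1: "?q + 1 < length P" "P ! (?q + 1) = Arith Plus (vreg k) (tmp d) 3"
    and e0: "?q2 < length P" "P ! ?q2 = Arith Plus (vreg k) (tmp (d + 1)) 3"
    using LetIn.prems(1) by (auto simp: Let_def code_at_append code_at_Cons add.assoc numeral_eq_Suc)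
  have one: "1 \<le> W" using fitfD[OF LetIn.prems(4), of 2] LetIn.prems(3) by (simp add: orep_def)
  have fM: "fitf W (memo x w)" for w using one by (rule memo_fits)
  have fe: "fits_expr W x s e" and fa: "fits_stmt W x (s(k := eval x s e)) a" using LetIn.prems(2) by simp_all
  obtain R1 where R1: "reach P W (cost x s e) (St p R (memo x w)) (St ?q R1 (memo x w))" "fitf W R1"
    "R1 (tmp d) = eval x s e" "keeps d R R1"
    using cexpr_correct[OF c(1) fe orep_rep[OF LetIn.prems(3)] LetIn.prems(4) fM] by blast
  have r1: "orep x s w R1" using keeps_orep[OF R1(4) LetIn.prems(3)] .
  have N: "R1 0 = length x" "R1 1 = length w" "R1 2 = 1" "R1 3 = 0" "R1 (vreg j) = s j" for j using r1 by (auto simp: orep_def)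
  have sW: "s j \<le> W" for j using N(5) R1(2) by (metis fitfD)
  have nW: "eval x s e \<le> W" using R1(2,3) by (metis fitfD)
  let ?A = "R1(tmp (d+1) := s k)" let ?B = "?A(vreg k := eval x s e)"
  let ?s = "s(k := eval x s e)"
  have fA: "fitf W ?A" using R1(2) sW by - (rule fitf_upd)
  have fB: "fitf W ?B" using fA nW by - (rule fitf_upd, auto)
  have "reach P W 1 (St ?q R1 (memo x w)) (St (?q + 1) ?A (memo x w))"
    by (rule reach_one[OF c0 R1(2) fM _ fA fM]) (use N in simp)
  moreover have "reach P W 1 (St (?q+1) ?A (memo x w)) (St (?q + 2) ?B (memo x w))"
    by (rule reach_one[OF c1 fA fM _ fB fM]) (use N R1(3) in simp)
  ultimately have init: "reach P W (1+1) (St ?q R1 (memo x w)) (St (?q + 2) ?B (memo x w))"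
    by (rule reach_trans)
  have rB: "orep x ?s w ?B" using r1 by (simp add: orep_def)
  have la: "length x + length w + length (out x ?s a) \<le> W" using LetIn.prems(5) by simp
  obtain G where G: "reach P W (scost x ?s a) (St (?q+2) ?B (memo x w)) (St ?q2 G (memo x (w @ out x ?s a)))" "fitf W G"
      "G 1 = length (w @ out x ?s a)" "keepsS (d+2) ?B G"
    using LetIn.IH[OF c(2) fa rB fB la] by blast
  let ?o = "w @ out x ?s a"
  let ?H = "G(vreg k := s k)"
  have fH: "fitf W ?H" using G(2) sW by - (rule fitf_upd)
  have fin: "reach P W 1 (St ?q2 G (memo x ?o)) (St (?q2 + 1) ?H (memo x ?o))"
    by (rule reach_one[OF e0 G(2) fM _ fH fM]) (use G(4) N in \<open>simp add: keepsST keepsS3\<close>)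
  have "reach P W (scost x s (LetIn k e a)) (St p R (memo x w)) (St (?q2 + 1) ?H (memo x ?o))"
    by (rule reach_mono[OF reach_trans[OF reach_trans[OF reach_trans[OF R1(1) init] G(1)] fin]]) simp
  moreover have "?o = w @ out x s (LetIn k e a)" by simp
  moreover have "?H 1 = length ?o" using G(3) by simp
  moreover have "keepsS d R ?H" unfolding keepsS_def
  proof (intro allI impI)
    fix r assume r: "r \<noteq> 1" "\<forall>j\<ge>d. r \<noteq> tmp j"
    have "R (vreg j) = s j" for j using LetIn.prems(3) by (simp add: orep_def)
    then show "?H r = R r" using r G(4) R1(4) by (auto simp: keepsS_def keeps_def)
  qed
  ultimately show ?case using fH unfolding len by (simp only:) blast
qed

lemma ram_init_St: "ram_init x = St 0 (\<lambda>r. if r = 0 then length x else 0) (memo x [])"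
  by (auto simp: ram_init_def memo_def)

theorem cprog_correct:
  assumes fits: "fits_stmt W x (env0 x) a" and W: "length x + length (out x (env0 x) a) + 1 \<le> W"
  shows "ram_computes (cprog a) x (out x (env0 x) a)
     (scost x (env0 x) a + 7 * length (out x (env0 x) a) + 6) W"
proof -
  let ?P = "cprog a" let ?ca = "cstmt a 0 2" let ?q = "2 + length ?ca"
  let ?s = "env0 x" let ?y = "out x ?s a" let ?n = "length ?y"
  have "code_at ?P 0 ?P" by (simp add: code_at_def)
  then have c: "0 < length ?P" "?P ! 0 = Const 2 1" "1 < length ?P" "?P ! 1 = Arith Plus (vreg 0) 0 3"
    "code_at ?P 2 ?ca"
    and e0: "?q < length ?P" "?P ! ?q = Arith Plus (tmp 0) 3 3"
    and e1: "?q + 1 < length ?P" "?P ! (?q + 1) = Arith Minus (tmp 1) 1 (tmp 0)"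
    and e2: "?q + 2 < length ?P" "?P ! (?q + 2) = JumpIfZero (tmp 1) (?q + 8)"
    and e3: "?q + 3 < length ?P" "?P ! (?q + 3) = Arith Plus (tmp 1) 0 (tmp 0)"
    and e4: "?q + 4 < length ?P" "?P ! (?q + 4) = Load (tmp 1) (tmp 1)"
    and e5: "?q + 5 < length ?P" "?P ! (?q + 5) = Store (tmp 0) (tmp 1)"
    and e6: "?q + 6 < length ?P" "?P ! (?q + 6) = Arith Plus (tmp 0) (tmp 0) 2"
    and e7: "?q + 7 < length ?P" "?P ! (?q + 7) = JumpIfZero 3 (?q + 1)"
    and e8: "?q + 8 < length ?P" "?P ! (?q + 8) = Arith Plus 0 1 3"
    unfolding cprog_def Let_def code_at_append code_at_Cons
    by (simp_all add: numeral_eq_Suc)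
  have len: "length ?P = ?q + 9" by (simp add: cprog_def Let_def)
  have one: "1 \<le> W" using W by simp
  have fM: "fitf W (memo x w)" for w using one by (rule memo_fits)
  let ?R0 = "\<lambda>r. if r = 0 then length x else 0 :: nat"
  let ?R1 = "?R0(2 := 1)" let ?R2 = "?R1(vreg 0 := length x)"
  have f0: "fitf W ?R0" using W by (simp add: fitf_def)
  have f1: "fitf W ?R1" using f0 one by - (rule fitf_upd)
  have f2: "fitf W ?R2" using f1 W by - (rule fitf_upd, auto)
  have "reach ?P W 1 (St 0 ?R0 (memo x [])) (St 1 ?R1 (memo x []))"
    by (rule reach_one[OF c(1,2) f0 fM _ f1 fM]) simp
  moreover have "reach ?P W 1 (St 1 ?R1 (memo x [])) (St 2 ?R2 (memo x []))"
    by (rule reach_one[OF c(3,4) f1 fM _ f2 fM]) simp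
  ultimately have init: "reach ?P W (1+1) (St 0 ?R0 (memo x [])) (St 2 ?R2 (memo x []))"
    by (rule reach_trans)
  have "orep x ?s [] ?R2" by (auto simp: orep_def env0_def)
  then obtain R where R: "reach ?P W (scost x ?s a) (St 2 ?R2 (memo x [])) (St ?q R (memo x ?y))"
    "fitf W R" "R 1 = ?n" "keepsS 0 ?R2 R"
    using cstmt_correct[OF c(5) fits _ f2, of "[]"] W by auto
  have N: "R 0 = length x" "R 2 = 1" "R 3 = 0" using R(4) by (simp_all add: keepsS_def)
  \<comment> \<open>The memory after \<open>j\<close> bits have been moved down.\<close>
  define M where "M j i = (if i < j then of_bool (?y ! i) else memo x ?y i)" for j i
  have fMj: "fitf W (M j)" for j using one fM[of ?y] by (auto simp: M_def fitf_def)
  have loop: "\<exists>R'. reach ?P W (1 + 7 * j) (St ?q R (memo x ?y)) (St (?q + 1) R' (M j)) \<and>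
      fitf W R' \<and> R' (tmp 0) = j \<and> R' 0 = length x \<and> R' 1 = ?n \<and> R' 2 = 1 \<and> R' 3 = 0" if "j \<le> ?n" for j
    using that
  proof (induction j)
    case 0
    let ?R = "R(tmp 0 := 0)"
    have ff: "fitf W ?R" using R(2) by - (rule fitf_upd, auto)
    have "reach ?P W 1 (St ?q R (memo x ?y)) (St (?q + 1) ?R (memo x ?y))"
      by (rule reach_one[OF e0 R(2) fM _ ff fM]) (simp add: N)
    moreover have "M 0 = memo x ?y" by (simp add: M_def fun_eq_iff)
    moreover have "?R (tmp 0) = 0 \<and> ?R 0 = length x \<and> ?R 1 = ?n \<and> ?R 2 = 1 \<and> ?R 3 = 0" using N R(3) by simp
    ultimately show ?case using ff by (simp only: mult_0_right add_0_right) blast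
  next
    case (Suc j)
    have j: "j < ?n" "j \<le> ?n" using Suc.prems by simp_all
    obtain R' where R': "reach ?P W (1 + 7 * j) (St ?q R (memo x ?y)) (St (?q + 1) R' (M j))"
      "fitf W R'" "R' (tmp 0) = j" "R' 0 = length x" "R' 1 = ?n" "R' 2 = 1" "R' 3 = 0"
      using Suc.IH[OF j(2)] by blast
    let ?A = "R'(tmp 1 := ?n - j)" let ?B = "?A(tmp 1 := length x + j)" let ?v = "of_bool (?y ! j) :: nat"
    let ?C = "?B(tmp 1 := ?v)" let ?D = "?C(tmp 0 := Suc j)"
    have fA: "fitf W ?A" using R'(2) W by - (rule fitf_upd, auto)
    have fB: "fitf W ?B" using fA W j by - (rule fitf_upd, auto)
    have fC: "fitf W ?C" using fB one by - (rule fitf_upd, auto)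
    have fD: "fitf W ?D" using fC W j by - (rule fitf_upd, auto)
    \<comment> \<open>The source cell is at \<open>j\<close> or above and has not been overwritten
      yet.\<close>
    have v: "M j (length x + j) = ?v" using j by (auto simp: M_def memo_def nth_append)
    have "reach ?P W 1 (St (?q+1) R' (M j)) (St (?q+2) ?A (M j))"
      by (rule reach_one[OF e1 R'(2) fMj _ fA fMj]) (use R' in simp)
    moreover have "reach ?P W 1 (St (?q+2) ?A (M j)) (St (?q+3) ?A (M j))"
      by (rule reach_one[OF e2 fA fMj _ fA fMj]) (use j in simp)
    moreover have "reach ?P W 1 (St (?q+3) ?A (M j)) (St (?q+4) ?B (M j))"
      by (rule reach_one[OF e3 fA fMj _ fB fMj]) (use R' in \<open>simp add: fun_eq_iff\<close>)
    moreover have "reach ?P W 1 (St (?q+4) ?B (M j)) (St (?q+5) ?C (M j))"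
      by (rule reach_one[OF e4 fB fMj _ fC fMj]) (simp add: v fun_eq_iff)
    moreover have "reach ?P W 1 (St (?q+5) ?C (M j)) (St (?q+6) ?C (M (Suc j)))"
      by (rule reach_one[OF e5 fC fMj _ fC fMj]) (use R' in \<open>auto simp: M_def fun_eq_iff\<close>)
    moreover have "reach ?P W 1 (St (?q+6) ?C (M (Suc j))) (St (?q+7) ?D (M (Suc j)))"
      by (rule reach_one[OF e6 fC fMj _ fD fMj]) (use R' in simp)
    moreover have "reach ?P W 1 (St (?q+7) ?D (M (Suc j))) (St (?q+1) ?D (M (Suc j)))"
      by (rule reach_one[OF e7 fD fMj _ fD fMj]) (use R' in simp)
    ultimately have "reach ?P W (1+1+1+1+1+1+1) (St (?q+1) R' (M j)) (St (?q+1) ?D (M (Suc j)))"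
      by (meson reach_trans)
    then have "reach ?P W (1 + 7 * Suc j) (St ?q R (memo x ?y)) (St (?q+1) ?D (M (Suc j)))"
      by (intro reach_mono[OF reach_trans[OF R'(1)]]) auto
    moreover have "?D (tmp 0) = Suc j \<and> ?D 0 = length x \<and> ?D 1 = ?n \<and> ?D 2 = 1 \<and> ?D 3 = 0" using R' by simp
    ultimately show ?case using fD by blast
  qed
  obtain R' where R': "reach ?P W (1 + 7 * ?n) (St ?q R (memo x ?y)) (St (?q + 1) R' (M ?n))"
      "fitf W R'" "R' (tmp 0) = ?n" "R' 0 = length x" "R' 1 = ?n" "R' 2 = 1" "R' 3 = 0"
    using loop[OF order_refl] by blast
  let ?A = "R'(tmp 1 := 0)" let ?B = "?A(0 := ?n)"
  have fA: "fitf W ?A" using R'(2) by - (rule fitf_upd, auto)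
  have fB: "fitf W ?B" using fA W by - (rule fitf_upd, auto)
  have "reach ?P W 1 (St (?q+1) R' (M ?n)) (St (?q+2) ?A (M ?n))"
    by (rule reach_one[OF e1 R'(2) fMj _ fA fMj]) (use R' in simp)
  moreover have "reach ?P W 1 (St (?q+2) ?A (M ?n)) (St (?q+8) ?A (M ?n))"
    by (rule reach_one[OF e2 fA fMj _ fA fMj]) simp
  moreover have "reach ?P W 1 (St (?q+8) ?A (M ?n)) (St (?q+9) ?B (M ?n))"
    by (rule reach_one[OF e8 fA fMj _ fB fMj]) (use R' in simp)
  ultimately have fin: "reach ?P W (1+1+1) (St (?q+1) R' (M ?n)) (St (?q+9) ?B (M ?n))"
    by (meson reach_trans)
  have all: "reach ?P W (scost x ?s a + 7 * ?n + 6) (ram_init x) (St (?q+9) ?B (M ?n))"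
    unfolding ram_init_St
    by (rule reach_mono[OF reach_trans[OF reach_trans[OF reach_trans[OF init R(1)] R'(1)] fin]]) simp
  have "ram_output (St (?q+9) ?B (M ?n)) ?y"
    by (auto simp: ram_output_def M_def)
  moreover have "ram_halted ?P (St (?q+9) ?B (M ?n))" by (simp add: ram_halted_def len)
  ultimately show ?thesis using all unfolding reach_def ram_computes_def by metis
qed

subsection \<open>Polynomial bounds\<close>

text \<open>\<open>vvars\<close> and \<open>cvars\<close> contain the variables on which the size of the value and the running time
  of an expression depend; the cap of a \<^const>\<open>Fold\<close> bounds its value whatever its body does.\<close>

fun vvars :: "expr \<Rightarrow> nat set" where
  "vvars (Num a) = {}"
| "vvars (Var k) = {k}"
| "vvars (Bin Plus a b) = vvars a \<union> vvars b"
| "vvars (Bin Times a b) = vvars a \<union> vvars b"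
| "vvars (Bin Minus a b) = vvars a"
| "vvars (Bin Div a b) = vvars a"
| "vvars (Inp a) = {}"
| "vvars (Fold k n c i b) = vvars c"

fun cvars :: "expr \<Rightarrow> nat set" where
  "cvars (Num a) = {}"
| "cvars (Var k) = {}"
| "cvars (Bin f a b) = cvars a \<union> cvars b"
| "cvars (Inp a) = cvars a"
| "cvars (Fold k n c i b) = vvars n \<union> cvars n \<union> cvars c \<union> cvars i \<union> (cvars b - {k, Suc k}) \<union>
     (if Suc k \<in> cvars b then vvars c else {})"

text \<open>All polynomial bounds take the form \<open>B ^ c\<close>, where \<open>B\<close> is at
  least 2 and bounds the variables, and \<open>c\<close> depends on the program text only. Sums and
  products then add exponents, up to one, and nesting multiplies them.\<close>

lemma pow_add_bound:
  fixes B :: nat assumes "2 \<le> B" "a \<le> B ^ p" "b \<le> B ^ q" shows "a + b \<le> B ^ (p + q + 1)"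
proof -
  have "B ^ p \<le> B ^ (p + q)" "B ^ q \<le> B ^ (p + q)" using assms(1) by (intro power_increasing; simp)+
  then have "a + b \<le> 2 * B ^ (p + q)" using assms by linarith
  also have "\<dots> \<le> B * B ^ (p + q)" using assms(1) by (intro mult_right_mono) auto
  finally show ?thesis by simp
qed

lemma pow_mult_bound:
  fixes B :: nat assumes "a \<le> B ^ p" "b \<le> B ^ q" shows "a * b \<le> B ^ (p + q)"
  using mult_le_mono[OF assms] by (simp add: power_add)

lemma pow_const_bound: "2 \<le> (B :: nat) \<Longrightarrow> a \<le> B ^ a"
  using less_exp[of a] power_mono[of 2 B a] by linarith

lemma pow_le: "2 \<le> (B :: nat) \<Longrightarrow> a \<le> B ^ p \<Longrightarrow> p \<le> q \<Longrightarrow> a \<le> B ^ q"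
  by (meson le_trans one_le_numeral power_increasing)

lemma pow_self: "2 \<le> (B :: nat) \<Longrightarrow> a \<le> B \<Longrightarrow> a \<le> B ^ Suc p"
  by (rule pow_le[of B a 1]) auto

text \<open>Values grow only through sums and products, whose number is fixed by the text; an
  accumulator could grow in every round, but is held down by its cap.\<close>

lemma eval_poly:
  "\<exists>c. \<forall>x s B. 2 \<le> B \<and> (\<forall>v\<in>vvars e. s v \<le> B) \<longrightarrow> eval x s e \<le> B ^ c"
proof (induction e)
  case (Num a)
  then show ?case using pow_const_bound by (intro exI[of _ a]) auto
next
  case (Var k)
  then show ?case by (intro exI[of _ 1]) auto
next
  case (Bin f a b)
  obtain c1 where c1: "\<And>x s B. 2 \<le> B \<Longrightarrow> \<forall>v\<in>vvars a. s v \<le> B \<Longrightarrow> eval x s a \<le> B ^ c1"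
    using Bin.IH(1) by metis
  obtain c2 where c2: "\<And>x s B. 2 \<le> B \<Longrightarrow> \<forall>v\<in>vvars b. s v \<le> B \<Longrightarrow> eval x s b \<le> B ^ c2"
    using Bin.IH(2) by metis
  show ?case
  proof (intro exI[of _ "c1 + c2 + 1"] allI impI, elim conjE)
    fix x :: "bool list" and s :: env and B :: nat assume B: "2 \<le> B" and v: "\<forall>v\<in>vvars (Bin f a b). s v \<le> B"
    show "eval x s (Bin f a b) \<le> B ^ (c1 + c2 + 1)"
    proof (cases f)
      case Plus
      then show ?thesis using pow_add_bound[OF B c1[OF B] c2[OF B]] v by auto
    next
      case Times
      then have "eval x s (Bin f a b) \<le> B ^ (c1 + c2)" using pow_mult_bound[OF c1[OF B] c2[OF B]] v by auto
      then show ?thesis by (rule pow_le[OF B]) simp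
    next
      case Minus
      then have "eval x s (Bin f a b) \<le> B ^ c1" using c1[OF B, of s x] v by auto
      then show ?thesis by (rule pow_le[OF B]) simp
    next
      case Div
      then have "eval x s (Bin f a b) \<le> B ^ c1" using c1[OF B, of s x] le_trans[OF div_le_dividend] v by auto
      then show ?thesis by (rule pow_le[OF B]) simp
    qed
  qed
next
  case (Inp a)
  have "1 \<le> B ^ 0" for B :: nat by simp
  then show ?case by (intro exI[of _ 0]) auto
next
  case (Fold k n c i b)
  then obtain c' where "\<And>x s B. 2 \<le> B \<Longrightarrow> \<forall>v\<in>vvars c. s v \<le> B \<Longrightarrow> eval x s c \<le> B ^ c'" by metis
  then have "2 \<le> B \<Longrightarrow> \<forall>v\<in>vvars c. s v \<le> B \<Longrightarrow> iter x s k c i b (eval x s n) \<le> B ^ c'" for x s B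
    by (rule le_trans[OF iter_le])
  then show ?case unfolding eval_Fold vvars.simps by blast
qed

text \<open>In the body of a loop, counter and accumulator are bounded by powers of
  \<open>B\<close>, so the induction hypothesis is applied with a power of \<open>B\<close> as the
  new base. Restricting the premise to \<open>cvars e\<close> matters for the red player: the cost
  of his response is governed by the number of targets and not by the much longer input.\<close>

lemma cost_poly:
  "\<exists>c. \<forall>x s B. 2 \<le> B \<and> (\<forall>v\<in>cvars e. s v \<le> B) \<longrightarrow> cost x s e \<le> B ^ c"
proof (induction e)
  case (Num a)
  then show ?case by (intro exI[of _ 1]) auto
next
  case (Var k)
  then show ?case by (intro exI[of _ 1]) auto
next
  case (Bin f a b)
  obtain c1 where c1: "\<And>x s B. 2 \<le> B \<Longrightarrow> \<forall>v\<in>cvars a. s v \<le> B \<Longrightarrow> cost x s a \<le> B ^ c1"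
    using Bin.IH(1) by metis
  obtain c2 where c2: "\<And>x s B. 2 \<le> B \<Longrightarrow> \<forall>v\<in>cvars b. s v \<le> B \<Longrightarrow> cost x s b \<le> B ^ c2"
    using Bin.IH(2) by metis
  show ?case
  proof (intro exI[of _ "c1 + c2 + 1 + 0 + 1"] allI impI, elim conjE)
    fix x :: "bool list" and s :: env and B :: nat assume B: "2 \<le> B" and v: "\<forall>v\<in>cvars (Bin f a b). s v \<le> B"
    have 1: "cost x s a \<le> B ^ c1" "cost x s b \<le> B ^ c2" using c1[OF B, of s x] c2[OF B, of s x] v by auto
    show "cost x s (Bin f a b) \<le> B ^ (c1 + c2 + 1 + 0 + 1)"
      using pow_add_bound[OF B pow_add_bound[OF B 1], of 1 0] by simp
  qed
next
  case (Inp a)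
  then obtain c1 where c1: "\<And>x s B. 2 \<le> B \<Longrightarrow> \<forall>v\<in>cvars a. s v \<le> B \<Longrightarrow> cost x s a \<le> B ^ c1" by metis
  show ?case
  proof (intro exI[of _ "c1 + 4 + 1"] allI impI, elim conjE)
    fix x :: "bool list" and s :: env and B :: nat assume B: "2 \<le> B" and v: "\<forall>v\<in>cvars (Inp a). s v \<le> B"
    show "cost x s (Inp a) \<le> B ^ (c1 + 4 + 1)"
      using pow_add_bound[OF B c1[OF B] pow_const_bound[OF B, of 4]] v by simp
  qed
next
  case (Fold k n c i b)
  obtain c1 where c1: "\<And>x s B. 2 \<le> B \<Longrightarrow> \<forall>v\<in>cvars n. s v \<le> B \<Longrightarrow> cost x s n \<le> B ^ c1"
    using Fold.IH(1) by metis
  obtain c2 where c2: "\<And>x s B. 2 \<le> B \<Longrightarrow> \<forall>v\<in>cvars c. s v \<le> B \<Longrightarrow> cost x s c \<le> B ^ c2"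
    using Fold.IH(2) by metis
  obtain c3 where c3: "\<And>x s B. 2 \<le> B \<Longrightarrow> \<forall>v\<in>cvars i. s v \<le> B \<Longrightarrow> cost x s i \<le> B ^ c3"
    using Fold.IH(3) by metis
  obtain c4 where c4: "\<And>x s B. 2 \<le> B \<Longrightarrow> \<forall>v\<in>cvars b. s v \<le> B \<Longrightarrow> cost x s b \<le> B ^ c4"
    using Fold.IH(4) by metis
  obtain v1 where v1: "\<And>x s B. 2 \<le> B \<Longrightarrow> \<forall>v\<in>vvars n. s v \<le> B \<Longrightarrow> eval x s n \<le> B ^ v1"
    using eval_poly[of n] by metis
  obtain v2 where v2: "\<And>x s B. 2 \<le> B \<Longrightarrow> \<forall>v\<in>vvars c. s v \<le> B \<Longrightarrow> eval x s c \<le> B ^ v2"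
    using eval_poly[of c] by metis
  let ?e = "Suc (v1 + v2) * c4"
  show ?case
  proof (intro exI[of _ "c1 + c2 + 1 + c3 + 1 + 10 + 1 + (v1 + (?e + 6 + 1)) + 1"] allI impI, elim conjE)
    fix x :: "bool list" and s :: env and B :: nat assume B: "2 \<le> B" and v: "\<forall>v\<in>cvars (Fold k n c i b). s v \<le> B"
    have a: "cost x s n \<le> B ^ c1" "cost x s c \<le> B ^ c2" "cost x s i \<le> B ^ c3" "eval x s n \<le> B ^ v1"
      using c1[OF B, of s x] c2[OF B, of s x] c3[OF B, of s x] v1[OF B, of s x] v by auto
    have B2: "2 \<le> B ^ Suc (v1 + v2)" using pow_self[OF B B] .
    have body: "cost x (s(k := j, Suc k := iter x s k c i b j)) b + 6 \<le> B ^ (?e + 6 + 1)"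
      if j: "j < eval x s n" for j
    proof -
      have "\<forall>w\<in>cvars b. (s(k := j, Suc k := iter x s k c i b j)) w \<le> B ^ Suc (v1 + v2)"
      proof
        fix w assume w: "w \<in> cvars b"
        consider "w = k" | "w = Suc k" | "w \<noteq> k" "w \<noteq> Suc k" by blast
        then show "(s(k := j, Suc k := iter x s k c i b j)) w \<le> B ^ Suc (v1 + v2)"
        proof cases
          case 1
          then show ?thesis using j a(4) pow_le[OF B a(4), of "Suc (v1 + v2)"] by simp
        next
          case 2
          then have "\<forall>v\<in>vvars c. s v \<le> B" using v w by auto
          from iter_le[THEN le_trans, OF v2[OF B this]]
          have "iter x s k c i b j \<le> B ^ v2" .
          then show ?thesis using 2 pow_le[OF B, of _ v2 "Suc (v1 + v2)"] by simp
        next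
          case 3
          then have "s w \<le> B" using v w by simp
          then show ?thesis using 3 pow_self[OF B] by simp
        qed
      qed
      from c4[OF B2 this] show ?thesis
        using pow_add_bound[OF B _ pow_const_bound[OF B, of 6]] by (simp only: power_mult)
    qed
    have "(\<Sum>j<eval x s n. cost x (s(k := j, Suc k := iter x s k c i b j)) b + 6)
        \<le> eval x s n * B ^ (?e + 6 + 1)"
      using sum_bounded_above[of "{..<eval x s n}" _ "B ^ (?e + 6 + 1)"] body by auto
    also have "\<dots> \<le> B ^ (v1 + (?e + 6 + 1))" by (rule pow_mult_bound[OF a(4) order_refl])
    finally show "cost x s (Fold k n c i b) \<le> B ^ (c1 + c2 + 1 + c3 + 1 + 10 + 1 + (v1 + (?e + 6 + 1)) + 1)"
      unfolding cost.simps
      by (intro pow_add_bound[OF B] a pow_const_bound[OF B])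
  qed
qed

lemma fits_expr_mono: "fits_expr W x s e \<Longrightarrow> W \<le> W' \<Longrightarrow> fits_expr W' x s e"
  by (induction W x s e rule: fits_expr.induct) auto

lemma fits_expr_poly:
  "\<exists>c. \<forall>x s B. 2 \<le> B \<and> (\<forall>v::nat. s v \<le> B) \<longrightarrow> fits_expr (B ^ c) x s e"
proof (induction e)
  case (Num a)
  then show ?case using pow_const_bound by (intro exI[of _ a]) auto
next
  case (Var k)
  then show ?case by simp
next
  case (Bin f a b)
  obtain c1 where c1: "\<And>x s B. 2 \<le> B \<Longrightarrow> \<forall>v::nat. s v \<le> B \<Longrightarrow> fits_expr (B ^ c1) x s a"
    using Bin.IH(1) by metis
  obtain c2 where c2: "\<And>x s B. 2 \<le> B \<Longrightarrow> \<forall>v::nat. s v \<le> B \<Longrightarrow> fits_expr (B ^ c2) x s b"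
    using Bin.IH(2) by metis
  obtain c3 where c3: "\<And>x s B. 2 \<le> B \<Longrightarrow> \<forall>v::nat. s v \<le> B \<Longrightarrow> eval x s (Bin f a b) \<le> B ^ c3"
    using eval_poly[of "Bin f a b"] by metis
  show ?case
  proof (intro exI[of _ "c1 + c2 + c3"] allI impI, elim conjE)
    fix x :: "bool list" and s :: env and B :: nat assume B: "2 \<le> B" and v: "\<forall>v::nat. s v \<le> B"
    have "B ^ c1 \<le> B ^ (c1 + c2 + c3)" "B ^ c2 \<le> B ^ (c1 + c2 + c3)" "B ^ c3 \<le> B ^ (c1 + c2 + c3)"
      using B by (intro power_increasing; simp)+
    then show "fits_expr (B ^ (c1 + c2 + c3)) x s (Bin f a b)"
      unfolding fits_expr.simps eval.simps(3)[symmetric]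
      using fits_expr_mono[OF c1[OF B v]] fits_expr_mono[OF c2[OF B v]] c3[OF B v, of x]
      by (meson le_trans)
  qed
next
  case (Inp a)
  then show ?case by simp
next
  case (Fold k n c i b)
  obtain c1 where c1: "\<And>x s B. 2 \<le> B \<Longrightarrow> \<forall>v::nat. s v \<le> B \<Longrightarrow> fits_expr (B ^ c1) x s n"
    using Fold.IH(1) by metis
  obtain c2 where c2: "\<And>x s B. 2 \<le> B \<Longrightarrow> \<forall>v::nat. s v \<le> B \<Longrightarrow> fits_expr (B ^ c2) x s c"
    using Fold.IH(2) by metis
  obtain c3 where c3: "\<And>x s B. 2 \<le> B \<Longrightarrow> \<forall>v::nat. s v \<le> B \<Longrightarrow> fits_expr (B ^ c3) x s i"
    using Fold.IH(3) by metis
  obtain c4 where c4: "\<And>x s B. 2 \<le> B \<Longrightarrow> \<forall>v::nat. s v \<le> B \<Longrightarrow> fits_expr (B ^ c4) x s b"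
    using Fold.IH(4) by metis
  obtain v1 where v1: "\<And>x s B. 2 \<le> B \<Longrightarrow> \<forall>v::nat. s v \<le> B \<Longrightarrow> eval x s n \<le> B ^ v1"
    using eval_poly[of n] by metis
  obtain v2 where v2: "\<And>x s B. 2 \<le> B \<Longrightarrow> \<forall>v::nat. s v \<le> B \<Longrightarrow> eval x s c \<le> B ^ v2"
    using eval_poly[of c] by metis
  let ?e = "Suc (v1 + v2) * c4" let ?c = "c1 + c2 + c3 + ?e"
  show ?case
  proof (intro exI[of _ ?c] allI impI, elim conjE)
    fix x :: "bool list" and s :: env and B :: nat assume B: "2 \<le> B" and v: "\<forall>v::nat. s v \<le> B"
    have B2: "2 \<le> B ^ Suc (v1 + v2)" using pow_self[OF B B] .
    have le: "B ^ c1 \<le> B ^ ?c" "B ^ c2 \<le> B ^ ?c" "B ^ c3 \<le> B ^ ?c" "B ^ ?e \<le> B ^ ?c"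
      using B by (intro power_increasing; simp)+
    have "fits_expr (B ^ ?c) x (s(k := j, Suc k := iter x s k c i b j)) b" if j: "j < eval x s n" for j
    proof -
      have "\<forall>w. (s(k := j, Suc k := iter x s k c i b j)) w \<le> B ^ Suc (v1 + v2)"
      proof
        fix w
        have "j \<le> B ^ Suc (v1 + v2)"
          using j pow_le[OF B v1[OF B v, of x], of "Suc (v1 + v2)"] by simp
        moreover have "iter x s k c i b j \<le> B ^ Suc (v1 + v2)"
          using pow_le[OF B v2[OF B v, of x], of "Suc (v1 + v2)"] iter_le[of x s k c i b j] by simp
        moreover have "s w \<le> B ^ Suc (v1 + v2)" using pow_self[OF B] v by blast
        ultimately show "(s(k := j, Suc k := iter x s k c i b j)) w \<le> B ^ Suc (v1 + v2)" by simp
      qed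
      from c4[OF B2 this] have "fits_expr (B ^ ?e) x (s(k := j, Suc k := iter x s k c i b j)) b"
        by (simp only: power_mult)
      then show ?thesis using le(4) by (rule fits_expr_mono)
    qed
    then show "fits_expr (B ^ ?c) x s (Fold k n c i b)"
      unfolding fits_expr.simps using c1[OF B v] c2[OF B v] c3[OF B v] le(1-3) fits_expr_mono by blast
  qed
qed

lemma fits_stmt_mono: "fits_stmt W x s e \<Longrightarrow> W \<le> W' \<Longrightarrow> fits_stmt W' x s e"
  by (induction W x s e rule: fits_stmt.induct) (auto intro: fits_expr_mono)

lemma length_out_le_scost: "length (out x s a) \<le> scost x s a"
proof (induction a arbitrary: s)
  case (For k n a)
  have "length (out x s (For k n a)) = (\<Sum>i<eval x s n. length (out x (s(k := i)) a))"
    by (simp add: length_concat comp_def interv_sum_list_conv_sum_set_nat atLeast0LessThan)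
  also have "\<dots> \<le> (\<Sum>i<eval x s n. scost x (s(k := i)) a + 4)"
    using For.IH by (intro sum_mono trans_le_add1) (simp del: fun_upd_apply)
  finally show ?case by simp
next
  case (Seq a b)
  then show ?case using add_mono[OF Seq.IH(1)[of s] Seq.IH(2)[of s]] by simp
next
  case (LetIn k e a)
  have "length (out x (s(k := eval x s e)) a) \<le> scost x (s(k := eval x s e)) a" by (rule LetIn.IH)
  then show ?case by simp
qed simp

lemma stmt_poly:
  "\<exists>c. \<forall>x s B. 2 \<le> B \<and> (\<forall>v::nat. s v \<le> B) \<longrightarrow> scost x s a \<le> B ^ c \<and> fits_stmt (B ^ c) x s a"
proof (induction a)
  case (Emit e)
  obtain c1 where c1: "\<And>x s B. 2 \<le> B \<Longrightarrow> \<forall>v::nat. s v \<le> B \<Longrightarrow> cost x s e \<le> B ^ c1"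
    using cost_poly[of e] by metis
  obtain c2 where c2: "\<And>x s B. 2 \<le> B \<Longrightarrow> \<forall>v::nat. s v \<le> B \<Longrightarrow> fits_expr (B ^ c2) x s e"
    using fits_expr_poly[of e] by metis
  show ?case
  proof (intro exI[of _ "(c1 + 5 + 1) + c2"] allI impI conjI; elim conjE)
    fix x :: "bool list" and s :: env and B :: nat assume B: "2 \<le> B" and v: "\<forall>v::nat. s v \<le> B"
    show "scost x s (Emit e) \<le> B ^ ((c1 + 5 + 1) + c2)"
      using pow_le[OF B pow_add_bound[OF B c1[OF B v] pow_const_bound[OF B, of 5]], of "(c1 + 5 + 1) + c2" x]
      by simp
    have "B ^ c2 \<le> B ^ ((c1 + 5 + 1) + c2)" using B by (intro power_increasing; simp)
    then show "fits_stmt (B ^ ((c1 + 5 + 1) + c2)) x s (Emit e)"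
      unfolding fits_stmt.simps by (rule fits_expr_mono[OF c2[OF B v]])
  qed
next
  case (Seq a b)
  obtain c1 where c1: "\<And>x s B. 2 \<le> B \<Longrightarrow> \<forall>v::nat. s v \<le> B \<Longrightarrow> scost x s a \<le> B ^ c1 \<and> fits_stmt (B ^ c1) x s a"
    using Seq.IH(1) by metis
  obtain c2 where c2: "\<And>x s B. 2 \<le> B \<Longrightarrow> \<forall>v::nat. s v \<le> B \<Longrightarrow> scost x s b \<le> B ^ c2 \<and> fits_stmt (B ^ c2) x s b"
    using Seq.IH(2) by metis
  show ?case
  proof (intro exI[of _ "c1 + c2 + 1"] allI impI conjI; elim conjE)
    fix x :: "bool list" and s :: env and B :: nat assume B: "2 \<le> B" and v: "\<forall>v::nat. s v \<le> B"
    show "scost x s (Seq a b) \<le> B ^ (c1 + c2 + 1)"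
      using pow_add_bound[OF B, of "scost x s a" c1 "scost x s b" c2] c1[OF B v] c2[OF B v] by simp
    have "B ^ c1 \<le> B ^ (c1 + c2 + 1)" "B ^ c2 \<le> B ^ (c1 + c2 + 1)" using B by (intro power_increasing; simp)+
    then show "fits_stmt (B ^ (c1 + c2 + 1)) x s (Seq a b)"
      unfolding fits_stmt.simps using fits_stmt_mono[OF conjunct2[OF c1[OF B v]]] fits_stmt_mono[OF conjunct2[OF c2[OF B v]]] by blast
  qed
next
  case (For k n a)
  obtain c1 where c1: "\<And>x s B. 2 \<le> B \<Longrightarrow> \<forall>v::nat. s v \<le> B \<Longrightarrow> cost x s n \<le> B ^ c1"
    using cost_poly[of n] by metis
  obtain c2 where c2: "\<And>x s B. 2 \<le> B \<Longrightarrow> \<forall>v::nat. s v \<le> B \<Longrightarrow> fits_expr (B ^ c2) x s n"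
    using fits_expr_poly[of n] by metis
  obtain v1 where v1: "\<And>x s B. 2 \<le> B \<Longrightarrow> \<forall>v::nat. s v \<le> B \<Longrightarrow> eval x s n \<le> B ^ v1"
    using eval_poly[of n] by metis
  obtain c3 where
    c3: "\<And>x s B. 2 \<le> B \<Longrightarrow> \<forall>v::nat. s v \<le> B \<Longrightarrow> scost x s a \<le> B ^ c3 \<and> fits_stmt (B ^ c3) x s a"
    using For.IH by metis
  let ?e = "Suc v1 * c3" let ?c = "c1 + 5 + 1 + (v1 + (?e + 4 + 1)) + 1 + c2"
  show ?case
  proof (intro exI[of _ ?c] allI impI; elim conjE)
    fix x :: "bool list" and s :: env and B :: nat assume B: "2 \<le> B" and v: "\<forall>v::nat. s v \<le> B"
    have B2: "2 \<le> B ^ Suc v1" using pow_self[OF B B] .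
    have le: "B ^ c2 \<le> B ^ ?c" "B ^ ?e \<le> B ^ ?c" using B by (intro power_increasing; simp)+
    have body: "scost x (s(k := j)) a \<le> B ^ ?e \<and> fits_stmt (B ^ ?e) x (s(k := j)) a"
      if j: "j < eval x s n" for j
    proof -
      have "\<forall>w. (s(k := j)) w \<le> B ^ Suc v1"
        using j pow_le[OF B v1[OF B v, of x], of "Suc v1"] pow_self[OF B] v by auto
      from c3[OF B2 this] show ?thesis by (simp only: power_mult)
    qed
    have "scost x (s(k := j)) a + 4 \<le> B ^ (?e + 4 + 1)" if "j < eval x s n" for j
      using pow_add_bound[OF B _ pow_const_bound[OF B, of 4]] body[OF that] by blast
    then have "(\<Sum>j<eval x s n. scost x (s(k := j)) a + 4) \<le> eval x s n * B ^ (?e + 4 + 1)"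
      using sum_bounded_above[of "{..<eval x s n}" _ "B ^ (?e + 4 + 1)"] by auto
    also have "\<dots> \<le> B ^ (v1 + (?e + 4 + 1))" by (rule pow_mult_bound[OF v1[OF B v] order_refl])
    finally have "scost x s (For k n a) \<le> B ^ (c1 + 5 + 1 + (v1 + (?e + 4 + 1)) + 1)"
      unfolding scost.simps by (intro pow_add_bound[OF B] c1[OF B v] pow_const_bound[OF B])
    then have "scost x s (For k n a) \<le> B ^ ?c" by (rule pow_le[OF B]) simp
    moreover have "fits_stmt (B ^ ?c) x s (For k n a)"
      unfolding fits_stmt.simps using fits_expr_mono[OF c2[OF B v] le(1)] fits_stmt_mono[OF conjunct2[OF body] le(2)] by blast
    ultimately show "scost x s (For k n a) \<le> B ^ ?c \<and> fits_stmt (B ^ ?c) x s (For k n a)" by blast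
  qed
next
  case (LetIn k e a)
  obtain c1 where c1: "\<And>x s B. 2 \<le> B \<Longrightarrow> \<forall>v::nat. s v \<le> B \<Longrightarrow> cost x s e \<le> B ^ c1"
    using cost_poly[of e] by metis
  obtain c2 where c2: "\<And>x s B. 2 \<le> B \<Longrightarrow> \<forall>v::nat. s v \<le> B \<Longrightarrow> fits_expr (B ^ c2) x s e"
    using fits_expr_poly[of e] by metis
  obtain v1 where v1: "\<And>x s B. 2 \<le> B \<Longrightarrow> \<forall>v::nat. s v \<le> B \<Longrightarrow> eval x s e \<le> B ^ v1"
    using eval_poly[of e] by metis
  obtain c3 where
    c3: "\<And>x s B. 2 \<le> B \<Longrightarrow> \<forall>v::nat. s v \<le> B \<Longrightarrow> scost x s a \<le> B ^ c3 \<and> fits_stmt (B ^ c3) x s a"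
    using LetIn.IH by metis
  let ?e = "Suc v1 * c3" let ?c = "c1 + ?e + 1 + 3 + 1 + c2"
  show ?case
  proof (intro exI[of _ ?c] allI impI; elim conjE)
    fix x :: "bool list" and s :: env and B :: nat assume B: "2 \<le> B" and v: "\<forall>v::nat. s v \<le> B"
    have B2: "2 \<le> B ^ Suc v1" using pow_self[OF B B] .
    have le: "B ^ c2 \<le> B ^ ?c" "B ^ ?e \<le> B ^ ?c" using B by (intro power_increasing; simp)+
    have "\<forall>w. (s(k := eval x s e)) w \<le> B ^ Suc v1"
      using pow_le[OF B v1[OF B v, of x], of "Suc v1"] pow_self[OF B] v by auto
    from c3[OF B2 this] have body: "scost x (s(k := eval x s e)) a \<le> B ^ ?e"
      "fits_stmt (B ^ ?e) x (s(k := eval x s e)) a" by (simp_all only: power_mult)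
    have "scost x s (LetIn k e a) \<le> B ^ (c1 + ?e + 1 + 3 + 1)"
      unfolding scost.simps by (intro pow_add_bound[OF B] c1[OF B v] pow_const_bound[OF B] body)
    then have "scost x s (LetIn k e a) \<le> B ^ ?c" by (rule pow_le[OF B]) simp
    moreover have "fits_stmt (B ^ ?c) x s (LetIn k e a)"
      unfolding fits_stmt.simps using fits_expr_mono[OF c2[OF B v] le(1)] fits_stmt_mono[OF body(2) le(2)] by blast
    ultimately show "scost x s (LetIn k e a) \<le> B ^ ?c \<and> fits_stmt (B ^ ?c) x s (LetIn k e a)" by blast
  qed
qed

lemma poly_bound_mono: "m \<le> n \<Longrightarrow> poly_bound c m \<le> poly_bound c n"
  by (simp add: poly_bound_def power_mono)

text \<open>Below 2 the additive constant takes over, with \<open>n + 2\<close> at most 3; from 2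
  on, \<open>n + 2\<close> is at most \<open>n ^ 2\<close>.\<close>

lemma power_le_poly_bound: "(n + 2) ^ a \<le> poly_bound (2 * a + 3 ^ a) n"
proof (cases "n < 2")
  case True
  then have "(n + 2) ^ a \<le> 3 ^ a" by (intro power_mono) auto
  then show ?thesis by (simp add: poly_bound_def)
next
  case False
  then have "2 * n \<le> n * n" by simp
  then have "n + 2 \<le> n ^ 2" using False unfolding power2_eq_square by linarith
  then have "(n + 2) ^ a \<le> (n ^ 2) ^ a" by (intro power_mono) auto
  also have "\<dots> = n ^ (2 * a)" by (simp add: power_mult)
  also have "\<dots> \<le> n ^ (2 * a + 3 ^ a)" using False by (intro power_increasing) auto
  finally show ?thesis by (simp add: poly_bound_def)
qed

lemma env0_le: "env0 x v \<le> length x + 2"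
  by (simp add: env0_def)

lemma fits_words_mono: "fits_words W s \<Longrightarrow> W \<le> W' \<Longrightarrow> fits_words W' s"
  unfolding fits_words_def by (auto intro: le_trans)

lemma ram_computes_mono:
  assumes "ram_computes P x y t W" "t \<le> t'" "W \<le> W'"
  shows "ram_computes P x y t' W'"
proof -
  obtain u where u: "u \<le> t" "ram_halted P ((ram_step P ^^ u) (ram_init x))"
    "ram_output ((ram_step P ^^ u) (ram_init x)) y"
    "\<forall>t'\<le>u. fits_words W ((ram_step P ^^ t') (ram_init x))"
    using assms(1) unfolding ram_computes_def by auto
  show ?thesis unfolding ram_computes_def
    using u assms(2,3) by (intro exI[of _ u]) (auto intro: fits_words_mono)
qed

lemma pow_slack:
  fixes B :: nat assumes B: "2 \<le> B"
  shows "8 * B ^ c + 7 \<le> B ^ (c + 16)" "B + B ^ c \<le> B ^ (c + 16)" "B ^ c \<le> B ^ (c + 16)"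
proof -
  have "8 * B ^ c \<le> B ^ (8 + c)" by (rule pow_mult_bound[OF pow_const_bound[OF B, of 8] order_refl])
  from pow_add_bound[OF B this pow_const_bound[OF B, of 7]]
  have "8 * B ^ c + 7 \<le> B ^ (8 + c + 7 + 1)" .
  moreover have "8 + c + 7 + 1 = c + 16" by simp
  ultimately show "8 * B ^ c + 7 \<le> B ^ (c + 16)" by (simp only:)
  have "B + B ^ c \<le> B ^ (1 + c + 1)" by (rule pow_add_bound[OF B]) simp_all
  then show "B + B ^ c \<le> B ^ (c + 16)" by (rule pow_le[OF B]) simp
  show "B ^ c \<le> B ^ (c + 16)" using B by (intro power_increasing) auto
qed

theorem stmt_poly_word:
  "\<exists>c. \<forall>x. fits_stmt (poly_bound c (length x)) x (env0 x) a \<and>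
     length x + length (out x (env0 x) a) + 1 \<le> poly_bound c (length x) \<and>
     scost x (env0 x) a + 7 * length (out x (env0 x) a) + 6 \<le> poly_bound c (length x)"
proof -
  obtain c1 where c1: "\<And>x s B. 2 \<le> B \<Longrightarrow> \<forall>v::nat. s v \<le> B \<Longrightarrow> scost x s a \<le> B ^ c1 \<and> fits_stmt (B ^ c1) x s a"
    using stmt_poly[of a] by metis
  define e where "e = c1 + 16"
  define d where "d = 2 * e + 3 ^ e"
  have "fits_stmt (poly_bound d (length x)) x (env0 x) a \<and>
     length x + length (out x (env0 x) a) + 1 \<le> poly_bound d (length x) \<and>
     scost x (env0 x) a + 7 * length (out x (env0 x) a) + 6 \<le> poly_bound d (length x)" for x
  proof -
    define B where "B = length x + 2"
    have B: "2 \<le> B" by (simp add: B_def)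
    have "\<forall>v. env0 x v \<le> B" using env0_le by (simp add: B_def)
    from c1[OF B this, of x] have c: "scost x (env0 x) a \<le> B ^ c1" "fits_stmt (B ^ c1) x (env0 x) a" by auto
    have l: "length (out x (env0 x) a) \<le> B ^ c1" by (rule le_trans[OF length_out_le_scost c(1)])
    note m = pow_slack[OF B, of c1, folded e_def]
    have p: "B ^ e \<le> poly_bound d (length x)" using power_le_poly_bound by (simp only: d_def B_def)
    have "fits_stmt (poly_bound d (length x)) x (env0 x) a"
      by (rule fits_stmt_mono[OF c(2) le_trans[OF m(3) p]])
    moreover have "length x + length (out x (env0 x) a) + 1 \<le> poly_bound d (length x)"
      using l m(2) p B_def by linarith
    moreover have "scost x (env0 x) a + 7 * length (out x (env0 x) a) + 6 \<le> poly_bound d (length x)"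
      using l m(1) p c(1) by linarith
    ultimately show ?thesis by blast
  qed
  then show ?thesis by blast
qed

text \<open>This holds for every statement of the language: termination and polynomial time are
  consequences of the syntax, so the reduction later needs no analysis of its running time.\<close>

theorem out_poly_time: "poly_time_computable (\<lambda>x. out x (env0 x) a)"
proof -
  obtain c where "\<And>x. fits_stmt (poly_bound c (length x)) x (env0 x) a \<and>
     length x + length (out x (env0 x) a) + 1 \<le> poly_bound c (length x) \<and>
     scost x (env0 x) a + 7 * length (out x (env0 x) a) + 6 \<le> poly_bound c (length x)"
    using stmt_poly_word[of a] by metis
  then show ?thesis unfolding poly_time_computable_def
    using ram_computes_mono[OF cprog_correct] by blast
qed

section \<open>Guarded games\<close>

text \<open>Targets below \<open>g\<close> are guards, the others lights; guard \<open>j\<close> and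
  its only sensor carry the same number, and sensors from \<open>g\<close> on sense nothing. Guards
  below \<open>p\<close> belong to at most one light, those from \<open>p\<close> on may be shared.
  Since private guards have the smaller numbers, choosing the least index prefers them.\<close>

locale guarded_game =
  fixes G :: esg and g p :: nat
  assumes g_le: "g \<le> targets G" and targets_le: "targets G \<le> sensors G"
    and recharge_3: "recharge G = 3"
    and guard_sense: "i < g \<Longrightarrow> j < sensors G \<Longrightarrow> can_sense G i j \<longleftrightarrow> i = j"
    and light_sense: "g \<le> i \<Longrightarrow> i < targets G \<Longrightarrow> j < sensors G \<Longrightarrow> can_sense G i j \<Longrightarrow> j < g"
    and light_card: "g \<le> i \<Longrightarrow> i < targets G \<Longrightarrow> card {j. j < sensors G \<and> can_sense G i j} \<ge> 6"
    and light_shared: "g \<le> i \<Longrightarrow> i < targets G \<Longrightarrow> card {j. p \<le> j \<and> j < sensors G \<and> can_sense G i j} \<le> 3"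
    and lights_share_1: "g \<le> i \<Longrightarrow> i < targets G \<Longrightarrow> g \<le> i' \<Longrightarrow> i' < targets G \<Longrightarrow> i \<noteq> i' \<Longrightarrow>
      j < sensors G \<Longrightarrow> j' < sensors G \<Longrightarrow> can_sense G i j \<Longrightarrow> can_sense G i' j \<Longrightarrow>
      can_sense G i j' \<Longrightarrow> can_sense G i' j' \<Longrightarrow> j = j'"
    and unshared: "g \<le> i \<Longrightarrow> i < targets G \<Longrightarrow> g \<le> i' \<Longrightarrow> i' < targets G \<Longrightarrow> i \<noteq> i' \<Longrightarrow>
      j < sensors G \<Longrightarrow> can_sense G i j \<Longrightarrow> can_sense G i' j \<Longrightarrow> p \<le> j"
    and values_pos: "i < targets G \<Longrightarrow> target_value G i > 0"
    and guard_value: "i < g \<Longrightarrow> (\<Sum>e\<in>{g..<targets G}. target_value G e) \<le> target_value G i"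
begin

text \<open>As guards and their sensors have equal numbers, for a light this is also the set of its
  guards.\<close>

definition own :: "nat \<Rightarrow> nat set" where
  "own i = {j. j < sensors G \<and> can_sense G i j}"

abbreviation light :: "nat \<Rightarrow> bool" where "light e \<equiv> g \<le> e \<and> e < targets G"

lemma finite_own [simp]: "finite (own i)" by (simp add: own_def)

lemma own_guard: "i < g \<Longrightarrow> own i = {i}"
  using guard_sense g_le targets_le by (auto simp: own_def)

lemma own_light: "light e \<Longrightarrow> j \<in> own e \<Longrightarrow> j < g"
  using light_sense by (auto simp: own_def)

lemma own_card: "light e \<Longrightarrow> 6 \<le> card (own e)"
  using light_card by (simp add: own_def)

lemma own_share: "light e \<Longrightarrow> light f \<Longrightarrow> e \<noteq> f \<Longrightarrow> j \<in> own e \<Longrightarrow> j \<in> own f \<Longrightarrow> j' \<in> own e \<Longrightarrow> j' \<in> own f \<Longrightarrow> j = j'"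
  using lights_share_1 by (auto simp: own_def)

end

section \<open>Positions and neighbourhoods under a fixed ordering\<close>

locale ordered_game = guarded_game +
  fixes \<sigma> :: "nat \<Rightarrow> nat"
  assumes ordering: "target_ordering G \<sigma>"
begin

definition near :: "nat \<Rightarrow> nat \<Rightarrow> bool" where
  "near a b \<longleftrightarrow> \<sigma> a \<le> \<sigma> b + 3 \<and> \<sigma> b \<le> \<sigma> a + 3"

text \<open>The sensors that can take \<open>e\<close> in addition to their own guards. A light
  without any escapes as long as all guards are sensed.\<close>

definition far :: "nat \<Rightarrow> nat set" where
  "far e = {j \<in> own e. \<not> near e j}"

lemma near_sym: "near a b \<longleftrightarrow> near b a" by (auto simp: near_def)

lemma recharged_iff: "enat (nat \<bar>int (\<sigma> a) - int (\<sigma> b)\<bar>) > recharge G \<longleftrightarrow> \<not> near a b"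
proof -
  have "(3 :: enat) = enat 3" by (simp add: numeral_eq_enat)
  then show ?thesis by (auto simp: recharge_3 near_def)
qed

lemma finite_far [simp]: "finite (far e)" by (simp add: far_def)

lemma far_guard: "i < g \<Longrightarrow> far i = {}"
  by (simp add: far_def own_guard near_def)

lemma inj: "a < targets G \<Longrightarrow> b < targets G \<Longrightarrow> \<sigma> a = \<sigma> b \<Longrightarrow> a = b"
  using ordering by (auto simp: target_ordering_def bij_betw_def inj_on_def)

lemma own_lt: "light e \<Longrightarrow> j \<in> own e \<Longrightarrow> j < targets G"
  using own_light g_le by fastforce

definition nbh :: "nat \<Rightarrow> nat set" where
  "nbh e = {i. i < targets G \<and> i \<noteq> e \<and> near e i}"

lemma finite_nbh [simp]: "finite (nbh e)" by (simp add: nbh_def)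

abbreviation window :: "nat \<Rightarrow> int set" where
  "window e \<equiv> {int (\<sigma> e) - 3 .. int (\<sigma> e) + 3} - {int (\<sigma> e)}"

lemma card_window: "card (window e) = 6" by simp

lemma nbh_window:
  assumes "e < targets G"
  shows "inj_on (\<lambda>i. int (\<sigma> i)) (nbh e)" "(\<lambda>i. int (\<sigma> i)) ` nbh e \<subseteq> window e"
proof -
  show "inj_on (\<lambda>i. int (\<sigma> i)) (nbh e)" using inj by (auto simp: inj_on_def nbh_def)
  show "(\<lambda>i. int (\<sigma> i)) ` nbh e \<subseteq> window e"
    using inj[OF _ assms] by (auto simp: nbh_def near_def)
qed

lemma card_nbh_le: "e < targets G \<Longrightarrow> card (nbh e) \<le> 6"
  using nbh_window[of e] card_window[of e] by (metis card_image card_mono finite_Diff finite_atLeastAtMost_int)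

text \<open>Neighbours occupy different positions of a window of size six, so six of them leave no
  gap.\<close>

lemma nbh_full:
  assumes "e < targets G" "6 \<le> card (nbh e)" "q \<in> window e"
  shows "\<exists>i\<in>nbh e. int (\<sigma> i) = q"
proof -
  have "(\<lambda>i. int (\<sigma> i)) ` nbh e = window e"
    using nbh_window[OF assms(1)] assms(2) card_window[of e] card_nbh_le[OF assms(1)]
    by (intro card_subset_eq) (auto simp: card_image simp del: card_Diff_insert)
  then show ?thesis using assms(3) by (metis imageE)
qed

section \<open>The local rule of the red player and the absence of conflicts\<close>

definition blocked :: "nat \<Rightarrow> nat \<Rightarrow> bool" where
  "blocked e j \<longleftrightarrow> (\<exists>f<targets G. f \<noteq> e \<and> near e f \<and> card (far f) \<le> 3 \<and> j \<in> far f)"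

definition good :: "nat \<Rightarrow> nat set" where
  "good e = {j \<in> far e. \<not> blocked e j}"

text \<open>Unblocked sensors come first, then small indices, hence private guards. Only lights with
  at most three far guards block, because any other light has a private far guard, which nobody
  contests. The rule refers to neither \<open>g\<close> nor \<open>p\<close>, which do not occur in
  the input, and a guard never blocks anything since its \<open>far\<close> set is empty.\<close>

definition pick :: "nat \<Rightarrow> nat" where
  "pick e = (if good e = {} then LEAST j. j \<in> far e else LEAST j. j \<in> good e)"

lemma pick_far: "far e \<noteq> {} \<Longrightarrow> pick e \<in> far e"
  unfolding pick_def using LeastI_ex[of "\<lambda>j. j \<in> far e"] LeastI_ex[of "\<lambda>j. j \<in> good e"]
  by (auto simp: good_def)

lemma pick_good: "good e \<noteq> {} \<Longrightarrow> pick e \<in> good e \<and> (\<forall>j\<in>good e. pick e \<le> j)"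
  unfolding pick_def using LeastI_ex[of "\<lambda>j. j \<in> good e"] Least_le[of "\<lambda>j. j \<in> good e"] by auto

text \<open>Lights share at most one guard, so the far guards of \<open>e\<close> are blocked by distinct lights; together
  with the near guards these already fill the six positions around \<open>e\<close>.\<close>

lemma no_good_nbh:
  assumes e: "light e" and ng: "good e = {}"
  obtains K where "card K = card (far e)" "\<And>k. k \<in> K \<Longrightarrow> light k \<and> card (far k) \<le> 3"
    "nbh e = (own e - far e) \<union> K" "card (nbh e) = 6"
proof -
  have "\<forall>j\<in>far e. \<exists>f. f < targets G \<and> f \<noteq> e \<and> near e f \<and> card (far f) \<le> 3 \<and> j \<in> far f"
    using ng by (auto simp: good_def blocked_def)
  then obtain k where k: "\<And>j. j \<in> far e \<Longrightarrow> k j < targets G \<and> k j \<noteq> e \<and> near e (k j) \<and> card (far (k j)) \<le> 3 \<and> j \<in> far (k j)"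
    by metis
  have kl: "light (k j)" if "j \<in> far e" for j using k[OF that] far_guard[of "k j"] by force
  have inj: "inj_on k (far e)"
  proof (rule inj_onI)
    fix a b assume ab: "a \<in> far e" "b \<in> far e" "k a = k b"
    then have "a \<in> own e" "b \<in> own e" "a \<in> own (k a)" "b \<in> own (k a)"
      using k[OF ab(1)] k[OF ab(2)] by (auto simp: far_def)
    then show "a = b" using own_share[OF e kl[OF ab(1)]] k[OF ab(1)] by metis
  qed
  let ?K = "k ` far e"
  have cK: "card ?K = card (far e)" by (rule card_image[OF inj])
  have sub: "(own e - far e) \<union> ?K \<subseteq> nbh e"
    using own_light[OF e] own_lt[OF e] k e by (fastforce simp: nbh_def far_def)
  have "(own e - far e) \<inter> ?K = {}" using own_light[OF e] kl by fastforce
  then have "card ((own e - far e) \<union> ?K) = card (own e - far e) + card (far e)"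
    by (subst card_Un_disjoint) (auto simp: cK)
  also have "\<dots> = card (own e)"
    by (subst card_Diff_subset) (auto simp: far_def card_mono)
  finally have ge: "6 \<le> card ((own e - far e) \<union> ?K)" using own_card[OF e] by simp
  have le: "card (nbh e) \<le> 6" using card_nbh_le e by simp
  have c6: "card (nbh e) = 6" using ge le card_mono[OF finite_nbh sub] by simp
  have "nbh e = (own e - far e) \<union> ?K"
    using card_subset_eq[OF finite_nbh sub] ge le card_mono[OF finite_nbh sub] by simp
  then show ?thesis using that cK kl k c6 by (metis (no_types, lifting) imageE)
qed

text \<open>A guard near both lights would belong to both and thus be \<open>z\<close>, which is
  far. So the overlap of the two windows, apart from \<open>e\<close>, is filled by lights blocking
  sensors of \<open>e\<close>. These are at most three, which forces distance exactly 3 and puts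
  blockers on the three positions right of \<open>e\<close>. The first of them, \<open>h\<close>,
  has at least three near guards, and only three places remain for these, two of which are directly
  to the left of \<open>e\<close>. Guards at these two places belong to \<open>e\<close> as well, so
  \<open>h\<close> and \<open>e\<close> share two guards.\<close>

lemma no_conflict_aux:
  assumes e: "light e" and f: "light f" and lt: "\<sigma> e < \<sigma> f" and nr: "near e f"
    and ng: "good e = {}" "good f = {}" and c: "card (far e) \<le> 3" and z: "z \<in> far e" "z \<in> far f"
  shows False
proof -
  obtain K where K: "card K = card (far e)" "\<And>k. k \<in> K \<Longrightarrow> light k \<and> card (far k) \<le> 3"
    "nbh e = (own e - far e) \<union> K" "card (nbh e) = 6" using no_good_nbh[OF e ng(1)] by blast
  obtain K' where K': "\<And>k. k \<in> K' \<Longrightarrow> light k" "nbh f = (own f - far f) \<union> K'"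
    by (rule no_good_nbh[OF f ng(2)]) metis
  have ef: "e \<noteq> f" using lt by auto
  have share: "j = z" if "j \<in> own e" "j \<in> own f" for j
    using own_share[OF e f ef, of j z] that z by (auto simp: far_def)
  have fin: "finite K" using K(3) finite_nbh[of e] by (metis finite_Un)
  have both: "i \<in> K" if "i \<in> nbh e" "i \<in> nbh f" for i
  proof (rule ccontr)
    assume "i \<notin> K"
    then have i: "i \<in> own e - far e" using that K(3) by auto
    then have "i < g" using own_light e by auto
    then have "i \<in> own f - far f" using that K'(2) K'(1) by force
    then show False using share[of i] i z by auto
  qed
  have fK: "f \<in> K"
  proof (rule ccontr)
    assume "f \<notin> K"
    moreover have "f \<in> nbh e" using f nr ef by (simp add: nbh_def)
    ultimately have "f \<in> own e" using K(3) by auto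
    then show False using own_light e f by force
  qed
  have pos: "\<exists>i\<in>nbh e. int (\<sigma> i) = q" if "q \<in> window e" for q
    using nbh_full[OF _ _ that] e K(4) by auto
  have mid: "\<exists>i\<in>K. int (\<sigma> i) = q" if q: "int (\<sigma> f) - 3 \<le> q" "q \<le> int (\<sigma> e) + 3" "q \<noteq> int (\<sigma> e)" for q
  proof (cases "q = int (\<sigma> f)")
    case False
    have "q \<in> window e" using q lt by auto
    then obtain i where i: "i \<in> nbh e" "int (\<sigma> i) = q" using pos by blast
    then have "i \<in> nbh f" using q lt False by (auto simp: nbh_def near_def)
    then show ?thesis using both i by blast
  qed (use fK in auto)
  have "{int (\<sigma> f) - 3 .. int (\<sigma> e) + 3} - {int (\<sigma> e)} \<subseteq> (\<lambda>i. int (\<sigma> i)) ` K"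
  proof
    fix q assume "q \<in> {int (\<sigma> f) - 3 .. int (\<sigma> e) + 3} - {int (\<sigma> e)}"
    then show "q \<in> (\<lambda>i. int (\<sigma> i)) ` K" using mid[of q] by auto
  qed
  then have "card ({int (\<sigma> f) - 3 .. int (\<sigma> e) + 3} - {int (\<sigma> e)}) \<le> card K"
    using card_mono[of "(\<lambda>i. int (\<sigma> i)) ` K"] card_image_le[OF fin, of "\<lambda>i. int (\<sigma> i)"] fin
    by (meson finite_imageI le_trans)
  also have "\<dots> \<le> 3" using K(1) c by simp
  \<comment> \<open>Without \<open>e\<close>, the overlap has
    \<open>6 - (\<sigma> f - \<sigma> e)\<close> positions; being near bounds the distance by 3 from
    above.\<close>
  finally have d: "\<sigma> f = \<sigma> e + 3"
    using lt nr by (subst (asm) card_Diff_singleton) (auto simp: near_def)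
  have right: "{int (\<sigma> e) + 1 .. int (\<sigma> e) + 3} \<subseteq> (\<lambda>i. int (\<sigma> i)) ` K"
  proof
    fix q assume "q \<in> {int (\<sigma> e) + 1 .. int (\<sigma> e) + 3}"
    then show "q \<in> (\<lambda>i. int (\<sigma> i)) ` K" using mid[of q] d by auto
  qed
  have Kpos: "(\<lambda>i. int (\<sigma> i)) ` K = {int (\<sigma> e) + 1 .. int (\<sigma> e) + 3}"
    using right card_image_le[OF fin, of "\<lambda>i. int (\<sigma> i)"] K(1) c fin
    by (intro card_subset_eq[symmetric]) (auto intro!: le_antisym card_mono[OF _ right, simplified])
  obtain h where h: "h \<in> K" "int (\<sigma> h) = int (\<sigma> e) + 1" using mid[of "int (\<sigma> e) + 1"] d by auto
  have hl: "light h" "card (far h) \<le> 3" using K(2) h(1) by auto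
  have "6 \<le> card (own h)" by (rule own_card[OF hl(1)])
  also have "\<dots> = card (far h) + card (own h - far h)"
    by (subst card_Diff_subset) (auto simp: far_def card_mono)
  finally have h3: "3 \<le> card (own h - far h)" using hl(2) by simp
  \<comment> \<open>The window of \<open>h\<close> extends from two places left of \<open>e\<close>
    to one place right of \<open>f\<close>; \<open>e\<close> and the three blockers, among them
    \<open>h\<close> itself and \<open>f\<close>, take the other places.\<close>
  have sub: "(\<lambda>i. int (\<sigma> i)) ` (own h - far h) \<subseteq> {int (\<sigma> e) - 2, int (\<sigma> e) - 1, int (\<sigma> e) + 4}"
  proof
    fix q assume "q \<in> (\<lambda>i. int (\<sigma> i)) ` (own h - far h)"
    then obtain i where i: "i \<in> own h" "near h i" "q = int (\<sigma> i)" by (auto simp: far_def)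
    have ig: "i < g" "i < targets G" using own_light[OF hl(1) i(1)] own_lt[OF hl(1) i(1)] by auto
    have ne: "\<sigma> i \<noteq> \<sigma> e" using inj[of i e] ig e by auto
    have "q \<notin> (\<lambda>i. int (\<sigma> i)) ` K"
    proof
      assume "q \<in> (\<lambda>i. int (\<sigma> i)) ` K"
      then obtain k where "k \<in> K" "\<sigma> i = \<sigma> k" using i(3) by auto
      then show False using inj[of i k] ig K(2)[of k] by auto
    qed
    then show "q \<in> {int (\<sigma> e) - 2, int (\<sigma> e) - 1, int (\<sigma> e) + 4}"
      using i(2,3) ne h(2) unfolding Kpos near_def by auto
  qed
  have injh: "inj_on (\<lambda>i. int (\<sigma> i)) (own h - far h)"
    using inj own_lt[OF hl(1)] by (auto simp: inj_on_def)
  have "card ((\<lambda>i. int (\<sigma> i)) ` (own h - far h)) = card (own h - far h)" by (rule card_image[OF injh])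
  then have eq: "(\<lambda>i. int (\<sigma> i)) ` (own h - far h) = {int (\<sigma> e) - 2, int (\<sigma> e) - 1, int (\<sigma> e) + 4}"
    using h3 sub card_mono[OF _ sub] by (intro card_subset_eq) auto
  have "\<exists>j. int (\<sigma> j) = q \<and> j \<in> own h \<and> j \<in> own e" if q: "q \<in> {int (\<sigma> e) - 2, int (\<sigma> e) - 1}" for q
  proof -
    obtain j where j: "j \<in> own h" "int (\<sigma> j) = q" using eq q by (metis (no_types, lifting) DiffE imageE insertCI insertE singletonD)
    have "j < targets G" using own_lt[OF hl(1) j(1)] .
    then have "j \<in> nbh e" using j(2) q by (auto simp: nbh_def near_def)
    moreover have "j \<notin> K" using Kpos q j(2) by force
    ultimately show ?thesis using K(3) j by auto
  qed
  from this[of "int (\<sigma> e) - 2"] this[of "int (\<sigma> e) - 1"]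
  obtain a b where ab: "int (\<sigma> a) = int (\<sigma> e) - 2" "a \<in> own h" "a \<in> own e"
    "int (\<sigma> b) = int (\<sigma> e) - 1" "b \<in> own h" "b \<in> own e" by auto
  have "h \<noteq> e" using h(2) by auto
  then have "a = b" using own_share[OF hl(1) e _ ab(2,3,5,6)] by simp
  then show False using ab by simp
qed

text \<open>If both lights pick \<open>z\<close>, then \<open>z\<close> is shared, and neither light
  has a private far guard: that one would be good and precede \<open>z\<close>. Hence both have at
  most three far guards and each blocks \<open>z\<close> for the other, so \<open>z\<close> was
  picked only for lack of good sensors.\<close>

lemma no_conflict:
  assumes e: "light e" and f: "light f" and ef: "e \<noteq> f" and nr: "near e f"
    and "far e \<noteq> {}" "far f \<noteq> {}"
  shows "pick e \<noteq> pick f"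
proof
  assume eq: "pick e = pick f"
  define z where "z = pick e"
  have z: "z \<in> far e" "z \<in> far f" using pick_far[of e] pick_far[of f] assms(5,6) eq by (auto simp: z_def)
  have *: "card (far e) \<le> 3" if e: "light e" and f: "light f" and ef: "e \<noteq> f" and z: "pick e = z" "z \<in> far e" "z \<in> far f" for e f
  proof -
    have "p \<le> z" using unshared[OF conjunct1[OF e] conjunct2[OF e] conjunct1[OF f] conjunct2[OF f] ef] z(2,3)
      by (auto simp: far_def own_def)
    have "far e \<subseteq> {j. p \<le> j \<and> j < sensors G \<and> can_sense G e j}"
    proof
      fix j assume j: "j \<in> far e"
      have "p \<le> j"
      proof (rule ccontr)
        assume "\<not> p \<le> j"
        then have "\<not> blocked e j"
          using unshared[of e _ j] e j far_guard unfolding blocked_def far_def own_def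
          by (smt (verit) empty_iff far_def mem_Collect_eq not_less own_def)
        then have "j \<in> good e" using j by (simp add: good_def)
        then have "pick e \<le> j" using pick_good by blast
        then show False using \<open>p \<le> z\<close> z(1) \<open>\<not> p \<le> j\<close> by simp
      qed
      then show "j \<in> {j. p \<le> j \<and> j < sensors G \<and> can_sense G e j}" using j by (auto simp: far_def own_def)
    qed
    then have "card (far e) \<le> card {j. p \<le> j \<and> j < sensors G \<and> can_sense G e j}" by (intro card_mono) auto
    then show ?thesis using light_shared[of e] e by simp
  qed
  have ce: "card (far e) \<le> 3" using *[OF e f ef] z z_def by auto
  have cf: "card (far f) \<le> 3" using *[OF f e] ef z z_def eq by auto
  have nge: "good e = {}"
  proof (rule ccontr)
    assume "good e \<noteq> {}"
    then have "z \<in> good e" using pick_good z_def by blast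
    moreover have "blocked e z" unfolding blocked_def using f ef nr cf z(2) by (intro exI[of _ f]) auto
    ultimately show False by (simp add: good_def)
  qed
  have ngf: "good f = {}"
  proof (rule ccontr)
    assume "good f \<noteq> {}"
    then have "z \<in> good f" using pick_good z_def eq by metis
    moreover have "blocked f z" unfolding blocked_def
      using e ef nr ce z(1) near_sym by (intro exI[of _ e]) auto
    ultimately show False by (simp add: good_def)
  qed
  have "\<sigma> e \<noteq> \<sigma> f" using inj e f ef by blast
  then consider "\<sigma> e < \<sigma> f" | "\<sigma> f < \<sigma> e" by linarith
  then show False
  proof cases
    case 1
    then show ?thesis using no_conflict_aux[OF e f _ nr nge ngf ce z] by simp
  next
    case 2
    then show ?thesis using no_conflict_aux[OF f e _ _ ngf nge cf z(2,1)] nr near_sym by simp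
  qed
qed

section \<open>Validity and optimality of the response\<close>

definition plan :: "nat \<Rightarrow> nat set" where
  "plan j = (if j < g then insert j {e. light e \<and> far e \<noteq> {} \<and> pick e = j} else {})"

definition saved :: "nat set" where "saved = {e. light e \<and> far e = {}}"

lemma plan_valid: "valid_plan G \<sigma> plan"
proof -
  have "sensing_plan G plan"
    using g_le pick_far own_light unfolding sensing_plan_def disjoint_family_on_def plan_def
    by (auto split: if_splits)
  moreover have "can_sense G i j" if "j < sensors G" "i \<in> plan j" for i j
    using that guard_sense pick_far[of i] by (auto simp: plan_def far_def own_def split: if_splits)
  moreover have "\<not> near t t'" if "j < sensors G" "t \<in> plan j" "t' \<in> plan j" "t \<noteq> t'" for j t t'
  proof -
    have *: "\<not> near t j \<and> \<not> near j t" if "far t \<noteq> {}" "pick t = j" for t j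
      using pick_far[of t] that near_sym[of t j] by (auto simp: far_def)
    show ?thesis
      using that no_conflict[of t t'] *[of t j] *[of t' j] by (auto simp: plan_def split: if_splits)
  qed
  ultimately show ?thesis by (auto simp: valid_plan_def recharged_iff)
qed

lemma plan_value: "not_sensed_value G plan = sum (target_value G) saved"
proof -
  have "{..<targets G} - (\<Union>j<sensors G. plan j) = saved"
  proof (intro equalityI subsetI)
    fix t assume t: "t \<in> {..<targets G} - (\<Union>j<sensors G. plan j)"
    then have "g \<le> t" using g_le targets_le by (force simp: plan_def)
    moreover have "far t = {}"
    proof (rule ccontr)
      assume f: "far t \<noteq> {}"
      have l: "light t" using \<open>g \<le> t\<close> t by simp
      have "pick t < g" using pick_far[OF f] own_light[OF l] by (auto simp: far_def)
      then have "t \<in> plan (pick t)" "pick t < sensors G" using l f g_le targets_le by (auto simp: plan_def)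
      then show False using t by auto
    qed
    ultimately show "t \<in> saved" using t by (simp add: saved_def)
  qed (auto simp: saved_def plan_def split: if_splits)
  then show ?thesis by (simp add: not_sensed_value_def)
qed

lemma saved_lights: "saved \<subseteq> {g..<targets G}" "finite saved"
  by (auto simp: saved_def intro: finite_subset[of _ "{g..<targets G}"])

text \<open>Leaving out one guard costs at least as much as all lights together. If every guard is
  sensed, then each by its only sensor, and this sensor cannot take a light near that guard; so
  lights without far guards escape.\<close>

lemma plan_optimal:
  assumes v: "valid_plan G \<sigma> \<psi>" shows "sum (target_value G) saved \<le> not_sensed_value G \<psi>"
proof -
  let ?U = "{..<targets G} - (\<Union>j<sensors G. \<psi> j)"
  have pos: "0 \<le> target_value G i" if "i < targets G" for i using values_pos[OF that] by simp
  show ?thesis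
  proof (cases "\<exists>i<g. i \<in> ?U")
    case True
    then obtain i where i: "i < g" "i \<in> ?U" by blast
    have "sum (target_value G) saved \<le> sum (target_value G) {g..<targets G}"
      using saved_lights pos by (intro sum_mono2) auto
    also have "\<dots> \<le> target_value G i" using guard_value i by simp
    also have "\<dots> \<le> sum (target_value G) ?U" using i pos by (intro member_le_sum) auto
    finally show ?thesis by (simp add: not_sensed_value_def)
  next
    case False
    have "saved \<subseteq> ?U"
    proof
      fix e assume e: "e \<in> saved"
      then have l: "light e" "far e = {}" by (auto simp: saved_def)
      have "e \<notin> \<psi> j" if j: "j < sensors G" for j
      proof
        assume ej: "e \<in> \<psi> j"
        have "can_sense G e j" using v j ej by (simp add: valid_plan_def)
        then have o: "j \<in> own e" using j by (simp add: own_def)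
        then have jg: "j < g" using own_light l by blast
        then obtain j' where j': "j' < sensors G" "j \<in> \<psi> j'" using False g_le by fastforce
        then have "can_sense G j j'" using v by (simp add: valid_plan_def)
        then have "j = j'" using guard_sense jg j' by simp
        then have "\<not> near e j" using v j' ej jg l unfolding valid_plan_def recharged_iff by force
        then show False using l o by (auto simp: far_def)
      qed
      then show "e \<in> ?U" using l by auto
    qed
    then show ?thesis using pos unfolding not_sensed_value_def by (intro sum_mono2) auto
  qed
qed

theorem plan_best: "best_red_response G \<sigma> plan"
  unfolding best_red_response_def plan_value using plan_valid plan_optimal by blast

text \<open>The window of an escaping light is exactly filled by its six guards. Hence a position in
  both windows holds a common guard, which is \<open>v\<close>, and neither light lies in the window
  of the other. The positions \<open>\<sigma> f - 3\<close> and \<open>\<sigma> e + 3\<close> are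
  both in the overlap and thus both equal to that of \<open>v\<close>.\<close>

lemma saved_common_guard:
  assumes e: "e \<in> saved" and f: "f \<in> saved" and lt: "\<sigma> e < \<sigma> f" and v: "v \<in> own e" "v \<in> own f"
  shows "\<sigma> v = \<sigma> e + 3 \<and> \<sigma> f = \<sigma> v + 3"
proof -
  have full: "\<exists>i\<in>own e. int (\<sigma> i) = q" if e: "e \<in> saved" and q: "q \<in> window e" for e q
  proof -
    have l: "light e" "far e = {}" using e by (auto simp: saved_def)
    have sub: "own e \<subseteq> nbh e" using l own_light[OF l(1)] own_lt[OF l(1)] by (force simp: nbh_def far_def)
    have c: "card (own e) \<le> card (nbh e)" by (rule card_mono[OF finite_nbh sub])
    have "own e = nbh e" using own_card[OF l(1)] card_nbh_le[of e] l c
      by (intro card_subset_eq[OF finite_nbh sub]) auto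
    moreover have "6 \<le> card (nbh e)" using own_card[OF l(1)] c by simp
    ultimately show ?thesis using nbh_full[of e q] q l by simp
  qed
  have l: "light e" "far e = {}" "light f" "far f = {}" using e f by (auto simp: saved_def)
  have gv: "v < g" "v < targets G" using own_light[OF l(1) v(1)] g_le by auto
  have nv: "near e v" "near f v" using v l by (auto simp: far_def)
  have ef: "e \<noteq> f" using lt by auto
  have both: "q = int (\<sigma> v)" if q: "q \<in> window e" "q \<in> window f" for q
  proof -
    obtain i where i: "i \<in> own e" "int (\<sigma> i) = q" using full[OF e q(1)] by blast
    obtain j where j: "j \<in> own f" "int (\<sigma> j) = q" using full[OF f q(2)] by blast
    have "i = j" using inj[of i j] i j own_lt[OF l(1) i(1)] own_lt[OF l(3) j(1)] by auto
    then show ?thesis using own_share[OF l(1,3) ef, of i v] i j v by auto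
  qed
  \<comment> \<open>Otherwise the light \<open>f\<close> would be one of the guards that fill the
    window of \<open>e\<close>.\<close>
  have d3: "\<not> near e f"
  proof
    assume "near e f"
    then have "int (\<sigma> f) \<in> window e" using lt by (auto simp: near_def)
    then obtain i where "i \<in> own e" "\<sigma> i = \<sigma> f" using full[OF e] by force
    then show False using inj[of i f] l own_light[OF l(1)] own_lt[OF l(1)] by force
  qed
  have vv: "int (\<sigma> v) \<le> int (\<sigma> e) + 3" "int (\<sigma> f) \<le> int (\<sigma> v) + 3" using nv by (auto simp: near_def)
  have "int (\<sigma> f) - 3 = int (\<sigma> v)" using vv d3 lt by (intro both) (auto simp: near_def)
  moreover have "int (\<sigma> e) + 3 = int (\<sigma> v)" using vv d3 lt by (intro both) (auto simp: near_def)
  ultimately show ?thesis by linarith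
qed

end

text \<open>The inner minimum is replaced by the value of the explicit response: what remains for
  the blue player is to maximise the weight of the surrounded lights.\<close>

theorem (in guarded_game) blue_leader_value_iff:
  "blue_leader_value G \<ge> l \<longleftrightarrow>
     (\<exists>\<sigma>. target_ordering G \<sigma> \<and> l \<le> sum (target_value G) (ordered_game.saved G g \<sigma>))"
proof -
  have "(\<forall>\<psi>. valid_plan G \<sigma> \<psi> \<longrightarrow> not_sensed_value G \<psi> \<ge> l) \<longleftrightarrow>
      l \<le> sum (target_value G) (ordered_game.saved G g \<sigma>)" if "target_ordering G \<sigma>" for \<sigma>
  proof -
    interpret ordered_game G g p \<sigma> by unfold_locales (rule that)
    show ?thesis using plan_valid plan_value plan_optimal order_trans by metis
  qed
  then show ?thesis unfolding blue_leader_value_ge_iff by blast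
qed

section \<open>Packing triples\<close>

text \<open>Elements of the two anchored coordinates of a triple share one index space; \<open>ok t\<close> tells
  whether triple \<open>t\<close> may be used.\<close>

datatype piece = Priv nat nat | Anch_priv nat nat | Elem nat | Free nat | Trip nat | Anch nat

locale triples =
  fixes m nA nZ K :: nat and ax ay az :: "nat \<Rightarrow> nat" and ok :: "nat \<Rightarrow> bool"
  assumes ax_lt: "t < m \<Longrightarrow> ax t < nA" and ay_lt: "t < m \<Longrightarrow> ay t < nA" and az_lt: "t < m \<Longrightarrow> az t < nZ"
    and ax_ay: "t < m \<Longrightarrow> t' < m \<Longrightarrow> ax t \<noteq> ay t'"
    and share: "t < m \<Longrightarrow> t' < m \<Longrightarrow> t \<noteq> t' \<Longrightarrow>
      \<not> (ax t = ax t' \<and> ay t = ay t') \<and> \<not> (ax t = ax t' \<and> az t = az t') \<and> \<not> (ay t = ay t' \<and> az t = az t')"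
    and K_ge: "5 * m + 7 * nA + nZ \<le> K"
begin

abbreviation g :: nat where "g \<equiv> 4 * m + 6 * nA + nZ"
abbreviation n :: nat where "n \<equiv> g + m + nA"

text \<open>Private guards get the smallest numbers, so that \<open>4 * m + 5 * nA\<close> can serve
  as the bound between private and shared guards. The numbering is arithmetic because a program has
  to print the game.\<close>

fun code :: "piece \<Rightarrow> nat" where
  "code (Priv t i) = 4 * t + i"
| "code (Anch_priv a i) = 4 * m + 5 * a + i"
| "code (Elem a) = 4 * m + 5 * nA + a"
| "code (Free z) = 4 * m + 6 * nA + z"
| "code (Trip t) = g + t"
| "code (Anch a) = g + m + a"

fun valid :: "piece \<Rightarrow> bool" where
  "valid (Priv t i) \<longleftrightarrow> t < m \<and> i < 4"
| "valid (Anch_priv a i) \<longleftrightarrow> a < nA \<and> i < 5"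
| "valid (Elem a) \<longleftrightarrow> a < nA"
| "valid (Free z) \<longleftrightarrow> z < nZ"
| "valid (Trip t) \<longleftrightarrow> t < m"
| "valid (Anch a) \<longleftrightarrow> a < nA"

definition decode :: "nat \<Rightarrow> piece" where
  "decode j = (if j < 4 * m then Priv (j div 4) (j mod 4)
     else if j < 4 * m + 5 * nA then Anch_priv ((j - 4 * m) div 5) ((j - 4 * m) mod 5)
     else if j < 4 * m + 6 * nA then Elem (j - (4 * m + 5 * nA))
     else if j < g then Free (j - (4 * m + 6 * nA))
     else if j < g + m then Trip (j - g) else Anch (j - (g + m)))"

lemma decode_code: "valid x \<Longrightarrow> decode (code x) = x"
  by (cases x) (simp_all add: decode_def)

lemma code_inj: "valid x \<Longrightarrow> valid y \<Longrightarrow> code x = code y \<longleftrightarrow> x = y"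
  by (metis decode_code)

lemma code_lt: "valid x \<Longrightarrow> code x < n"
  by (cases x) auto

text \<open>Written with index arithmetic for the program that prints the matrix;
  \<open>tset\<close> and \<open>aset\<close> are the readable form. The fourth private guard of a
  triple is attached to it only if the triple is forbidden, and then is its seventh guard, one more
  than fits around it.\<close>

definition sense :: "nat \<Rightarrow> nat \<Rightarrow> bool" where
  "sense i j \<longleftrightarrow>
    (if i < g then i = j
     else if i < g + m then
       4 * (i - g) \<le> j \<and> j < 4 * (i - g) + 3 \<or> j = 4 * (i - g) + 3 \<and> \<not> ok (i - g) \<or>
       j = 4 * m + 5 * nA + ax (i - g) \<or> j = 4 * m + 5 * nA + ay (i - g) \<or> j = 4 * m + 6 * nA + az (i - g)
     else i < n \<and> (4 * m + 5 * (i - (g + m)) \<le> j \<and> j < 4 * m + 5 * (i - (g + m)) + 5 \<or>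
       j = 4 * m + 5 * nA + (i - (g + m))))"

text \<open>The value \<open>m + 1\<close> of an anchor exceeds that of all triples together, and
  the value of a guard exceeds that of all lights.\<close>

definition val :: "nat \<Rightarrow> nat" where
  "val i = (if i < g then m + (m + 1) * nA + 1 else if i < g + m then 1 else m + 1)"

definition game :: esg where
  "game = \<lparr>targets = n, sensors = K, target_value = (\<lambda>i. of_nat (val i)), recharge = 3, can_sense = sense\<rparr>"

definition tset :: "nat \<Rightarrow> piece set" where
  "tset t = {Priv t 0, Priv t 1, Priv t 2, Elem (ax t), Elem (ay t), Free (az t)} \<union> (if ok t then {} else {Priv t 3})"

definition aset :: "nat \<Rightarrow> piece set" where
  "aset a = {Anch_priv a 0, Anch_priv a 1, Anch_priv a 2, Anch_priv a 3, Anch_priv a 4, Elem a}"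

lemma valid_tset: "t < m \<Longrightarrow> x \<in> tset t \<Longrightarrow> valid x"
  and valid_aset: "a < nA \<Longrightarrow> x \<in> aset a \<Longrightarrow> valid x"
  using ax_lt ay_lt az_lt by (auto simp: tset_def aset_def split: if_splits)

lemma tset_guard: "t < m \<Longrightarrow> x \<in> tset t \<Longrightarrow> code x < g"
  and aset_guard: "a < nA \<Longrightarrow> x \<in> aset a \<Longrightarrow> code x < g"
  using ax_lt[of t] ay_lt[of t] az_lt[of t] by (auto simp: tset_def aset_def split: if_splits)

lemma sense_trip:
  assumes t: "t < m" shows "sense (g + t) j \<longleftrightarrow> j \<in> code ` tset t"
proof -
  have "sense (g + t) j \<longleftrightarrow> 4 * t \<le> j \<and> j < 4 * t + 3 \<or> j = 4 * t + 3 \<and> \<not> ok t \<or>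
       j = 4 * m + 5 * nA + ax t \<or> j = 4 * m + 5 * nA + ay t \<or> j = 4 * m + 6 * nA + az t"
    using t by (simp add: sense_def)
  moreover have "4 * t \<le> j \<and> j < 4 * t + 3 \<longleftrightarrow> j = 4 * t \<or> j = 4 * t + 1 \<or> j = 4 * t + 2" by linarith
  ultimately show ?thesis by (cases "ok t") (simp_all add: tset_def disj_assoc, blast+)
qed

lemma sense_anch:
  assumes a: "a < nA" shows "sense (g + m + a) j \<longleftrightarrow> j \<in> code ` aset a"
proof -
  have "sense (g + m + a) j \<longleftrightarrow> 4 * m + 5 * a \<le> j \<and> j < 4 * m + 5 * a + 5 \<or> j = 4 * m + 5 * nA + a"
    using a by (simp add: sense_def)
  moreover have "4 * m + 5 * a \<le> j \<and> j < 4 * m + 5 * a + 5 \<longleftrightarrow> j = 4 * m + 5 * a \<or> j = 4 * m + 5 * a + 1 \<or>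
     j = 4 * m + 5 * a + 2 \<or> j = 4 * m + 5 * a + 3 \<or> j = 4 * m + 5 * a + 4" by linarith
  ultimately show ?thesis by (simp add: aset_def) 
qed

definition lset :: "nat \<Rightarrow> piece set" where
  "lset i = (if i < g + m then tset (i - g) else aset (i - (g + m)))"

lemma lset_trip: "t < m \<Longrightarrow> lset (g + t) = tset t" and lset_anch: "lset (g + m + a) = aset a"
  by (simp_all add: lset_def)

lemma light_cases:
  assumes "g \<le> i" "i < n"
  obtains (trip) t where "t < m" "i = g + t" "lset i = tset t"
    | (anch) a where "a < nA" "i = g + m + a" "lset i = aset a"
proof (cases "i < g + m")
  case True
  then show ?thesis using assms trip[of "i - g"] by (auto simp: lset_def)
next
  case False
  then show ?thesis using assms anch[of "i - (g + m)"] by (auto simp: lset_def)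
qed

lemma card_code: "(\<And>x. x \<in> X \<Longrightarrow> valid x) \<Longrightarrow> card (code ` X) = card X"
  using code_inj by (intro card_image inj_onI) blast

lemma card_tset: "t < m \<Longrightarrow> card (tset t) = (if ok t then 6 else 7)"
  using ax_ay[of t t] by (auto simp: tset_def)

lemma card_aset: "card (aset a) = 6"
  by (simp add: aset_def)

lemma game_simps [simp]: "targets game = n" "sensors game = K" "recharge game = 3"
  "can_sense game = sense" "target_value game = (\<lambda>i. of_nat (val i))"
  by (simp_all add: game_def)

lemma sense_light:
  assumes "g \<le> i" "i < n" shows "sense i j \<longleftrightarrow> j \<in> code ` lset i" "x \<in> lset i \<Longrightarrow> valid x" "x \<in> lset i \<Longrightarrow> code x < g"
  using assms light_cases[OF assms] sense_trip sense_anch valid_tset valid_aset tset_guard aset_guard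
  by metis+

lemma tset_tset:
  assumes "t < m" "t' < m" "t \<noteq> t'" "x \<in> tset t" "x \<in> tset t'"
  shows "x = Elem (ax t) \<and> ax t = ax t' \<or> x = Elem (ay t) \<and> ay t = ay t' \<or> x = Free (az t) \<and> az t = az t'"
proof -
  have "ax t \<noteq> ay t'" "ay t \<noteq> ax t'" using ax_ay assms(1,2) by metis+
  moreover have "x \<notin> {Priv t 0, Priv t 1, Priv t 2, Priv t 3}"
    using assms(3,5) by (auto simp: tset_def split: if_splits)
  then have "x \<in> {Elem (ax t), Elem (ay t), Free (az t)}"
    using assms(4) by (auto simp: tset_def split: if_splits)
  ultimately show ?thesis using assms(5) by (auto simp: tset_def split: if_splits)
qed

lemma tset_aset: "x \<in> tset t \<Longrightarrow> x \<in> aset a \<Longrightarrow> x = Elem a"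
  by (auto simp: tset_def aset_def split: if_splits)

lemma aset_aset: "x \<in> aset a \<Longrightarrow> x \<in> aset a' \<Longrightarrow> a = a'"
  by (auto simp: aset_def)

lemma lights_in_range: "t < m \<Longrightarrow> g \<le> g + t \<and> g + t < n" "a < nA \<Longrightarrow> g \<le> g + m + a \<and> g + m + a < n"
  by auto

text \<open>Two triples agree in at most one coordinate, a triple and an anchor have at most the
  anchored element in common, and different anchors have disjoint sets of guards.\<close>

lemma lset_share:
  assumes i: "g \<le> i" "i < n" "g \<le> i'" "i' < n" "i \<noteq> i'" and x: "x \<in> lset i" "x \<in> lset i'"
  shows "(\<exists>a. x = Elem a) \<or> (\<exists>z. x = Free z)" "y \<in> lset i \<Longrightarrow> y \<in> lset i' \<Longrightarrow> x = y"
proof -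
  have "((\<exists>a. x = Elem a) \<or> (\<exists>z. x = Free z)) \<and> (y \<in> lset i \<longrightarrow> y \<in> lset i' \<longrightarrow> x = y)"
    using i(1,2)
  proof (cases rule: light_cases)
    case (trip t)
    note t = trip
    show ?thesis using i(3,4)
    proof (cases rule: light_cases)
      case (trip t')
      then have tt: "t < m" "t' < m" "t \<noteq> t'" using t i(5) by auto
      show ?thesis using tset_tset[OF tt, of x] tset_tset[OF tt, of y] x share[OF tt] t(3) trip(3) by metis
    next
      case (anch a)
      show ?thesis using tset_aset[of x t a] tset_aset[of y t a] x t(3) anch(3) by metis
    qed
  next
    case (anch a)
    note a = anch
    show ?thesis using i(3,4)
    proof (cases rule: light_cases)
      case (trip t')
      show ?thesis using tset_aset[of x t' a] tset_aset[of y t' a] x a(3) trip(3) by metis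
    next
      case (anch a')
      then show ?thesis using aset_aset[of x a a'] x i(5) a by metis
    qed
  qed
  then show "(\<exists>a. x = Elem a) \<or> (\<exists>z. x = Free z)" "y \<in> lset i \<Longrightarrow> y \<in> lset i' \<Longrightarrow> x = y"
    by blast+
qed

lemma light_own_card: "g \<le> i \<Longrightarrow> i < n \<Longrightarrow> 6 \<le> card (lset i)"
  by (erule (1) light_cases) (simp_all add: card_tset card_aset)

lemma own_eq:
  assumes "g \<le> i" "i < n" shows "{j. j < K \<and> sense i j} = code ` lset i"
  using sense_light[OF assms] code_lt K_ge by fastforce

lemma light_value: "(\<Sum>e\<in>{g..<n}. val e) = m + (m + 1) * nA"
proof -
  have "{g..<n} = {g..<g + m} \<union> {g + m..<n}" by auto
  then have "(\<Sum>e\<in>{g..<n}. val e) = (\<Sum>e\<in>{g..<g + m}. val e) + (\<Sum>e\<in>{g + m..<n}. val e)"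
    by (simp add: sum.union_disjoint)
  also have "(\<Sum>e\<in>{g..<g + m}. val e) = (\<Sum>e\<in>{g..<g + m}. 1)" by (intro sum.cong) (auto simp: val_def)
  also have "(\<Sum>e\<in>{g + m..<n}. val e) = (\<Sum>e\<in>{g + m..<n}. m + 1)" by (intro sum.cong) (auto simp: val_def)
  finally show ?thesis by simp
qed

lemma guarded: "guarded_game game g (4 * m + 5 * nA)"
proof (unfold_locales, unfold game_simps)
  show "g \<le> n" by simp
  show "n \<le> K" using K_ge by simp
  show "sense i j \<longleftrightarrow> i = j" if "i < g" for i j using that by (simp add: sense_def)
  show "j < g" if "g \<le> i" "i < n" "j < K" "sense i j" for i j
  proof -
    have "j \<in> code ` lset i" using that(4) unfolding sense_light(1)[OF that(1,2)] .
    then show ?thesis using sense_light(3)[OF that(1,2)] by (elim imageE) simp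
  qed
  show "6 \<le> card {j. j < K \<and> sense i j}" if i: "g \<le> i" "i < n" for i
  proof -
    have "card (code ` lset i) = card (lset i)" by (rule card_code) (rule sense_light(2)[OF i])
    then show ?thesis unfolding own_eq[OF i] using light_own_card[OF i] by simp
  qed
  show "card {j. 4 * m + 5 * nA \<le> j \<and> j < K \<and> sense i j} \<le> 3" if i: "g \<le> i" "i < n" for i
  proof -
    have "{j. 4 * m + 5 * nA \<le> j \<and> j < K \<and> sense i j} = {j \<in> {j. j < K \<and> sense i j}. 4 * m + 5 * nA \<le> j}"
      by auto
    also have "\<dots> = {j \<in> code ` lset i. 4 * m + 5 * nA \<le> j}" unfolding own_eq[OF i] ..
    also have "card \<dots> \<le> 3" using i
    proof (cases rule: light_cases)
      case (trip t)
      have "{j \<in> code ` lset i. 4 * m + 5 * nA \<le> j} \<subseteq> code ` {Elem (ax t), Elem (ay t), Free (az t)}"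
      proof
        fix j assume "j \<in> {j \<in> code ` lset i. 4 * m + 5 * nA \<le> j}"
        then obtain x where x: "x \<in> tset t" "j = code x" "4 * m + 5 * nA \<le> code x" unfolding trip(3) by blast
        have "4 * t + 3 < 4 * m" using trip(1) by simp
        then have "x \<notin> {Priv t 0, Priv t 1, Priv t 2, Priv t 3}" using x(3) by auto
        then have "x \<in> {Elem (ax t), Elem (ay t), Free (az t)}" using x(1) unfolding tset_def by (simp split: if_splits)
        then show "j \<in> code ` {Elem (ax t), Elem (ay t), Free (az t)}" using x(2) by blast
      qed
      moreover have "finite (code ` {Elem (ax t), Elem (ay t), Free (az t)})" by simp
      moreover have "card (code ` {Elem (ax t), Elem (ay t), Free (az t)}) \<le> card {Elem (ax t), Elem (ay t), Free (az t)}"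
        by (rule card_image_le) simp
      moreover have "card {Elem (ax t), Elem (ay t), Free (az t)} \<le> 3" by (simp add: card_insert_if)
      ultimately show ?thesis using card_mono le_trans by meson
    next
      case (anch a)
      have "{j \<in> code ` lset i. 4 * m + 5 * nA \<le> j} \<subseteq> {code (Elem a)}"
        unfolding anch(3) using anch(1) by (auto simp: aset_def)
      from card_mono[OF _ this] show ?thesis by simp
    qed
    finally show ?thesis .
  qed
  have common: "\<exists>x. x \<in> lset i \<and> x \<in> lset i' \<and> j = code x" if i: "g \<le> i" "i < n" "g \<le> i'" "i' < n"
    "sense i j" "sense i' j" for i i' j
  proof -
    have "j \<in> code ` lset i" "j \<in> code ` lset i'"
      using i(5,6) unfolding sense_light(1)[OF i(1,2)] sense_light(1)[OF i(3,4)] .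
    then obtain x x' where x: "x \<in> lset i" "x' \<in> lset i'" "j = code x" "j = code x'" by (elim imageE)
    have "x = x'" using code_inj[OF sense_light(2)[OF i(1,2) x(1)] sense_light(2)[OF i(3,4) x(2)]] x(3,4) by simp
    then show ?thesis using x by blast
  qed
  show "j = j'" if i: "g \<le> i" "i < n" "g \<le> i'" "i' < n" "i \<noteq> i'" "j < K" "j' < K"
    "sense i j" "sense i' j" "sense i j'" "sense i' j'" for i i' j j'
  proof -
    obtain x where x: "x \<in> lset i" "x \<in> lset i'" "j = code x" using common[OF i(1-4) i(8,9)] by (elim exE conjE)
    obtain y where y: "y \<in> lset i" "y \<in> lset i'" "j' = code y" using common[OF i(1-4) i(10,11)] by (elim exE conjE)
    show ?thesis using lset_share(2)[OF i(1-5) x(1,2) y(1,2)] x y by simp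
  qed
  show "4 * m + 5 * nA \<le> j" if i: "g \<le> i" "i < n" "g \<le> i'" "i' < n" "i \<noteq> i'" "j < K"
    "sense i j" "sense i' j" for i i' j
  proof -
    obtain x where x: "x \<in> lset i" "x \<in> lset i'" "j = code x" using common[OF i(1-4) i(7,8)] by (elim exE conjE)
    show ?thesis using lset_share(1)[OF i(1-5) x(1,2)] x(3) by auto
  qed
  show "0 < (of_nat (val i) :: rat)" if "i < n" for i
    using that by (auto simp: val_def)
  show "(\<Sum>e\<in>{g..<n}. of_nat (val e)) \<le> (of_nat (val i) :: rat)" if "i < g" for i
  proof -
    have "(\<Sum>e\<in>{g..<n}. val e) \<le> val i" unfolding light_value using that by (simp add: val_def)
    then show ?thesis unfolding of_nat_sum[symmetric] of_nat_le_iff .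
  qed
qed simp

section \<open>From orderings to packings\<close>

definition packing :: "nat set \<Rightarrow> bool" where
  "packing C \<longleftrightarrow> (\<forall>t\<in>C. t < m \<and> ok t) \<and>
     (\<forall>t\<in>C. \<forall>t'\<in>C. t \<noteq> t' \<longrightarrow> ax t \<noteq> ax t' \<and> ay t \<noteq> ay t' \<and> az t \<noteq> az t')"

text \<open>A lost anchor cannot be compensated by triples, so all anchors escape. As a common guard
  is the exact midpoint of two escaping lights, no three of them share a guard; the anchor being
  one, an anchored element serves a single escaping triple. Both places at distance 3 from an
  escaping triple are taken by its anchored elements, so there is none for a free element shared
  with another one.\<close>

lemma packing_of_ordering:
  assumes ord: "target_ordering game \<sigma>" and q: "1 \<le> q"
    and val: "of_nat ((m + 1) * nA + q) \<le> sum (target_value game) (ordered_game.saved game g \<sigma>)"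
  shows "\<exists>C. packing C \<and> q \<le> card C"
proof -
  interpret guarded_game game g "4 * m + 5 * nA" by (rule guarded)
  interpret ordered_game game g "4 * m + 5 * nA" \<sigma> by unfold_locales (rule ord)
  define C where "C = {t. t < m \<and> g + t \<in> saved}"
  define A where "A = {a. a < nA \<and> g + m + a \<in> saved}"
  have fin: "finite C" "finite A" by (auto simp: C_def A_def)
  have sv: "saved = (\<lambda>t. g + t) ` C \<union> (\<lambda>a. g + m + a) ` A"
  proof (intro equalityI subsetI)
    fix e assume e: "e \<in> saved"
    then have "g \<le> e" "e < n" by (auto simp: saved_def)
    then show "e \<in> (\<lambda>t. g + t) ` C \<union> (\<lambda>a. g + m + a) ` A"
      by (cases rule: light_cases) (use e in \<open>auto simp: C_def A_def\<close>)
  qed (auto simp: C_def A_def)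
  have "sum val saved = sum val ((\<lambda>t. g + t) ` C) + sum val ((\<lambda>a. g + m + a) ` A)"
    unfolding sv by (intro sum.union_disjoint) (use fin in \<open>auto simp: C_def\<close>)
  also have "sum val ((\<lambda>t. g + t) ` C) = (\<Sum>t\<in>C. 1)"
    by (subst sum.reindex) (auto simp: val_def C_def inj_on_def intro: sum.cong)
  also have "sum val ((\<lambda>a. g + m + a) ` A) = (\<Sum>t\<in>A. m + 1)"
    by (subst sum.reindex) (auto simp: val_def A_def inj_on_def intro: sum.cong)
  finally have sumv: "sum val saved = card C + card A * (m + 1)" by simp
  have "(of_nat ((m + 1) * nA + q) :: rat) \<le> of_nat (sum val saved)"
    using val by (simp only: game_simps of_nat_sum)
  then have ge: "(m + 1) * nA + q \<le> card C + card A * (m + 1)" unfolding sumv of_nat_le_iff .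
  have cC: "card C \<le> m" using card_mono[of "{..<m}" C] by (auto simp: C_def)
  have cA: "card A \<le> nA" using card_mono[of "{..<nA}" A] by (auto simp: A_def)
  have "card A = nA"
  proof (rule ccontr)
    assume "card A \<noteq> nA"
    then have "(card A + 1) * (m + 1) \<le> nA * (m + 1)" using cA by (intro mult_right_mono) auto
    then show False using ge cC q by (simp add: algebra_simps)
  qed
  then have "A = {..<nA}" by (intro card_subset_eq) (auto simp: A_def)
  then have anch: "g + m + a \<in> saved" if "a < nA" for a using that by (auto simp: A_def)
  have qC: "q \<le> card C" using ge \<open>card A = nA\<close> by (simp add: mult.commute)
  have ownl: "own i = code ` lset i" if "g \<le> i" "i < n" for i
    using own_eq[OF that] by (simp add: own_def)
  have opp: "\<sigma> e + 3 = \<sigma> v \<and> \<sigma> v + 3 = \<sigma> f \<or> \<sigma> f + 3 = \<sigma> v \<and> \<sigma> v + 3 = \<sigma> e"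
    if "e \<in> saved" "f \<in> saved" "e \<noteq> f" "v \<in> own e" "v \<in> own f" for e f v
  proof -
    have "\<sigma> e \<noteq> \<sigma> f" using inj[of e f] that by (auto simp: saved_def)
    then show ?thesis using saved_common_guard[of e f v] saved_common_guard[of f e v] that by linarith
  qed
  have three: False
    if "e \<in> saved" "f \<in> saved" "h \<in> saved" "e \<noteq> f" "e \<noteq> h" "f \<noteq> h" "v \<in> own e" "v \<in> own f" "v \<in> own h" for e f h v
    using opp[of e f v] opp[of e h v] opp[of f h v] that by linarith
  have own: "code x \<in> own (g + t)" if "x \<in> tset t" "t < m" for x t
    using that ownl[of "g + t"] lights_in_range(1)[of t] unfolding lset_trip[OF that(2)] by blast
  have owna: "code (Elem a) \<in> own (g + m + a)" if "a < nA" for a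
    using ownl[of "g + m + a"] lights_in_range(2)[OF that] unfolding lset_anch by (simp add: aset_def del: code.simps)
  have anchored: "a \<noteq> a'" if t: "t \<in> C" "t' \<in> C" "t \<noteq> t'" and a: "a < nA" "Elem a \<in> tset t" "Elem a' \<in> tset t'" for t t' a a'
    using three[of "g + t" "g + t'" "g + m + a" "code (Elem a)"] t a anch own[of "Elem a"] owna by (auto simp: C_def)
  have "packing C" unfolding packing_def
  proof (intro conjI ballI impI)
    fix t assume t: "t \<in> C"
    then have tm: "t < m" and s: "light (g + t)" "far (g + t) = {}" by (auto simp: C_def saved_def)
    show "t < m" by (rule tm)
    show "ok t"
    proof (rule ccontr)
      assume "\<not> ok t"
      then have "card (own (g + t)) = 7" using tm card_code[OF valid_tset] ownl[of "g + t"] lights_in_range(1)[OF tm]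
        unfolding lset_trip[OF tm] by (simp add: card_tset)
      moreover have "own (g + t) \<subseteq> nbh (g + t)"
        using s own_light[OF s(1)] own_lt[OF s(1)] by (force simp: nbh_def far_def)
      ultimately show False using card_mono[OF finite_nbh, of "own (g + t)" "g + t"] card_nbh_le[of "g + t"] s by simp
    qed
    fix t' assume t': "t' \<in> C" "t \<noteq> t'"
    then have t'm: "t' < m" by (auto simp: C_def)
    show "ax t \<noteq> ax t'" using anchored[OF t t', of "ax t" "ax t'"] ax_lt[OF tm] by (simp add: tset_def)
    show "ay t \<noteq> ay t'" using anchored[OF t t', of "ay t" "ay t'"] ay_lt[OF tm] by (simp add: tset_def)
    show "az t \<noteq> az t'"
    proof
      assume z: "az t = az t'"
      have s: "g + t \<in> saved" "g + t' \<in> saved" using t t' by (auto simp: C_def)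
      let ?x = "code (Elem (ax t))" let ?y = "code (Elem (ay t))" let ?z = "code (Free (az t))"
      have "?x \<in> own (g + t)" "?y \<in> own (g + t)" "?z \<in> own (g + t)" "?z \<in> own (g + t')"
        using own tm t'm z by (simp_all add: tset_def del: code.simps)
      moreover have "?x \<in> own (g + m + ax t)" "?y \<in> own (g + m + ay t)" using owna ax_lt ay_lt tm by blast+
      ultimately have "\<sigma> ?x = \<sigma> (g + t) + 3 \<or> \<sigma> (g + t) = \<sigma> ?x + 3"
        "\<sigma> ?y = \<sigma> (g + t) + 3 \<or> \<sigma> (g + t) = \<sigma> ?y + 3" "\<sigma> ?z = \<sigma> (g + t) + 3 \<or> \<sigma> (g + t) = \<sigma> ?z + 3"
        using opp[OF s(1) anch[OF ax_lt[OF tm]], of ?x] opp[OF s(1) anch[OF ay_lt[OF tm]], of ?y]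
          opp[OF s, of ?z] tm t'(2) by (simp_all del: code.simps) linarith+
      \<comment> \<open>Three guards would have to occupy the two positions at distance 3.\<close>
      then have "\<sigma> ?x = \<sigma> ?y \<or> \<sigma> ?x = \<sigma> ?z \<or> \<sigma> ?y = \<sigma> ?z" by linarith
      moreover have "?x < n" "?y < n" "?z < n" using ax_lt[OF tm] ay_lt[OF tm] az_lt[OF tm] by auto
      ultimately have "?x = ?y \<or> ?x = ?z \<or> ?y = ?z" using inj[unfolded game_simps] by blast
      then show False using ax_ay[OF tm tm] ax_lt[OF tm] ay_lt[OF tm] by auto
    qed
  qed
  then show ?thesis using qC by blast
qed

end

section \<open>From packings to orderings\<close>

lemma ordering_with_blocks:
  assumes d: "distinct (concat bs)" and s: "set (concat bs) \<subseteq> {..<targets G}"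
  shows "\<exists>\<sigma>. target_ordering G \<sigma> \<and> (\<forall>b\<in>set bs. \<exists>k. \<forall>i<length b. \<sigma> (b ! i) = k + i)"
proof -
  let ?n = "targets G"
  define l where "l = concat bs @ sorted_list_of_set ({..<?n} - set (concat bs))"
  have dl: "distinct l" using d by (simp add: l_def)
  have sl: "set l = {..<?n}" using s by (auto simp: l_def)
  have len: "length l = ?n" using distinct_card[OF dl] sl by simp
  have bij: "bij_betw (\<lambda>i. l ! i) {..<?n} {..<?n}"
    using bij_betw_nth[OF dl, of "{..<length l}" "set l"] len sl by simp
  define \<sigma> where "\<sigma> x = Suc (the_inv_into {..<?n} (\<lambda>i. l ! i) x)" for x
  have "bij_betw (the_inv_into {..<?n} (\<lambda>i. l ! i)) {..<?n} {..<?n}" by (rule bij_betw_the_inv_into[OF bij])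
  moreover have "bij_betw Suc {..<?n} {1..?n}" using target_ordering_exists[of G] by (simp add: target_ordering_def)
  ultimately have "bij_betw (Suc \<circ> the_inv_into {..<?n} (\<lambda>i. l ! i)) {..<?n} {1..?n}" by (rule bij_betw_trans)
  moreover have "Suc \<circ> the_inv_into {..<?n} (\<lambda>i. l ! i) = \<sigma>" by (simp add: fun_eq_iff \<sigma>_def)
  ultimately have ord: "target_ordering G \<sigma>" by (simp only: target_ordering_def)
  have \<sigma>: "\<sigma> (l ! i) = Suc i" if "i < ?n" for i
    unfolding \<sigma>_def using bij that by (simp add: bij_betw_def the_inv_into_f_f)
  have "\<exists>k. \<forall>i<length b. \<sigma> (b ! i) = k + i" if b: "b \<in> set bs" for b
  proof -
    obtain u v where "bs = u @ b # v" using split_list[OF b] by blast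
    then obtain w where l: "l = concat u @ b @ w" by (simp add: l_def)
    have "\<sigma> (b ! i) = Suc (length (concat u)) + i" if i: "i < length b" for i
    proof -
      have "b ! i = l ! (length (concat u) + i)" using i unfolding l by (simp only: nth_append_length_plus) (simp add: nth_append)
      moreover have "length (concat u) + i < ?n" using len i l by (metis add_less_cancel_left length_append trans_less_add1 less_le_trans le_add1)
      ultimately show ?thesis using \<sigma> by simp
    qed
    then show ?thesis by blast
  qed
  then show ?thesis using ord by blast
qed

context triples begin

definition ablock :: "nat \<Rightarrow> piece list" where
  "ablock a = [Anch_priv a 0, Anch_priv a 1, Anch_priv a 2, Anch a, Anch_priv a 3, Anch_priv a 4, Elem a]"

text \<open>Of the nineteen offsets, the triple has 9, its anchors 3 and 15. The anchored elements
  are at 6 and 12 and thus within distance 3 of both lights that they guard.\<close>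

definition tblock :: "nat \<Rightarrow> piece list" where
  "tblock t = ablock (ax t) @ [Priv t 0, Priv t 1, Trip t, Priv t 2, Free (az t)] @ rev (ablock (ay t))"

text \<open>A tag for showing blocks disjoint: pieces with an anchor differ in it, the remaining
  ones are told apart by their triple or free element.\<close>

fun anchor_of :: "piece \<Rightarrow> nat option" where
  "anchor_of (Anch_priv a i) = Some a"
| "anchor_of (Elem a) = Some a"
| "anchor_of (Anch a) = Some a"
| "anchor_of _ = None"

lemma anchor_ablock: "x \<in> set (ablock a) \<Longrightarrow> anchor_of x = Some a"
  by (auto simp: ablock_def)

definition mid :: "nat \<Rightarrow> piece list" where
  "mid t = [Priv t 0, Priv t 1, Trip t, Priv t 2, Free (az t)]"

lemma anchor_mid: "x \<in> set (mid t) \<Longrightarrow> anchor_of x = None"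
  by (auto simp: mid_def)

lemma mid_mid: "x \<in> set (mid t) \<Longrightarrow> x \<in> set (mid t') \<Longrightarrow> t = t' \<or> az t = az t'"
  by (auto simp: mid_def)

lemma set_tblock: "set (tblock t) = set (ablock (ax t)) \<union> set (mid t) \<union> set (ablock (ay t))"
  by (auto simp: tblock_def mid_def)

lemma anchor_tblock: "x \<in> set (tblock t) \<Longrightarrow> anchor_of x = None \<and> x \<in> set (mid t) \<or> anchor_of x = Some (ax t) \<or> anchor_of x = Some (ay t)"
  unfolding set_tblock using anchor_mid anchor_ablock by blast

lemma ordering_of_packing:
  assumes C: "packing C" and q: "q \<le> card C"
  shows "\<exists>\<sigma>. target_ordering game \<sigma> \<and> of_nat ((m + 1) * nA + q) \<le> sum (target_value game) (ordered_game.saved game g \<sigma>)"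
proof -
  have Cm: "t < m" "ok t" if "t \<in> C" for t using C that by (auto simp: packing_def)
  have finC: "finite C" using Cm by (intro finite_subset[of C "{..<m}"]) auto
  \<comment> \<open>Anchors outside of the chosen triples have to escape as well and receive blocks
    of their own.\<close>
  define U where "U = {a. a < nA \<and> (\<forall>t\<in>C. a \<noteq> ax t \<and> a \<noteq> ay t)}"
  have finU: "finite U" by (simp add: U_def)
  define ps where "ps = map tblock (sorted_list_of_set C) @ map ablock (sorted_list_of_set U)"
  have ps: "set ps = tblock ` C \<union> ablock ` U" using finC finU by (simp add: ps_def)
  have inja: "inj ablock" by (auto simp: ablock_def inj_def)
  have injt: "inj tblock" by (auto simp: tblock_def ablock_def inj_def)
  have ta: "tblock t \<noteq> ablock a" for t a by (auto simp: tblock_def ablock_def)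
  have dps: "distinct ps"
    using inja injt ta finC finU by (auto simp: ps_def distinct_map intro: inj_on_subset)
  have da: "distinct (ablock a)" for a by (simp add: ablock_def)
  have dt: "distinct (tblock t)" if "t \<in> C" for t
    using Cm[OF that] ax_ay[of t t] by (auto simp: tblock_def ablock_def)
  have disj: "set u \<inter> set v = {}" if "u \<in> set ps" "v \<in> set ps" "u \<noteq> v" for u v
  proof -
    have aa: "set (ablock a) \<inter> set (ablock a') = {}" if "a \<noteq> a'" for a a'
    proof -
      have False if "x \<in> set (ablock a)" "x \<in> set (ablock a')" for x
        using anchor_ablock[OF that(1)] anchor_ablock[OF that(2)] \<open>a \<noteq> a'\<close> by simp
      then show ?thesis by blast
    qed
    have tt: "set (tblock t) \<inter> set (tblock t') = {}" if t: "t \<in> C" "t' \<in> C" "t \<noteq> t'" for t t'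
    proof -
      have ne: "ax t \<noteq> ax t'" "ay t \<noteq> ay t'" "az t \<noteq> az t'" using C t by (auto simp: packing_def)
      have ne2: "ax t \<noteq> ay t'" "ay t \<noteq> ax t'" using ax_ay Cm t by metis+
      have False if "x \<in> set (tblock t)" "x \<in> set (tblock t')" for x
        using anchor_tblock[OF that(1)] anchor_tblock[OF that(2)] mid_mid[of x t t'] ne ne2 t(3) by auto
      then show ?thesis by blast
    qed
    have tu: "set (tblock t) \<inter> set (ablock a) = {}" if t: "t \<in> C" and a: "a \<in> U" for t a
    proof -
      have "a \<noteq> ax t" "a \<noteq> ay t" using t a by (auto simp: U_def)
      then have False if "x \<in> set (tblock t)" "x \<in> set (ablock a)" for x
        using anchor_tblock[OF that(1)] anchor_ablock[OF that(2)] by auto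
      then show ?thesis by blast
    qed
    from that(1) consider t where "t \<in> C" "u = tblock t" | a where "a \<in> U" "u = ablock a" unfolding ps by blast
    then show ?thesis
    proof cases
      case 1
      from that(2) consider t' where "t' \<in> C" "v = tblock t'" | a where "a \<in> U" "v = ablock a" unfolding ps by blast
      then show ?thesis using 1 that(3) tt tu by cases metis+
    next
      case 2
      from that(2) consider t' where "t' \<in> C" "v = tblock t'" | a where "a \<in> U" "v = ablock a" unfolding ps by blast
      then show ?thesis using 2 that(3) aa tu by cases (metis Int_commute)+
    qed
  qed
  have dc: "distinct (concat ps)"
    using disj da dt by (intro distinct_concat[OF dps]) (auto simp: ps)
  have va: "\<forall>x\<in>set (ablock a). valid x" if "a < nA" for a using that by (simp add: ablock_def)
  have vt: "\<forall>x\<in>set (tblock t). valid x" if "t \<in> C" for t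
    using Cm[OF that] ax_lt ay_lt az_lt by (simp add: tblock_def ablock_def)
  have vps: "valid x" if "x \<in> set (concat ps)" for x
    using that va vt by (auto simp: ps U_def)
  have conc: "concat (map (map code) ps) = map code (concat ps)" by (simp add: map_concat)
  have "distinct (map code (concat ps))"
    unfolding distinct_map using dc vps code_inj by (auto intro!: inj_onI simp del: set_concat)
  moreover have "set (map code (concat ps)) \<subseteq> {..<targets game}"
    using vps code_lt by (auto simp del: set_concat)
  ultimately obtain \<sigma> where ord: "target_ordering game \<sigma>"
    and bl: "\<And>b. b \<in> set ps \<Longrightarrow> \<exists>k. \<forall>i<length b. \<sigma> (code (b ! i)) = k + i"
    using ordering_with_blocks[of "map (map code) ps" game] unfolding conc by auto
  interpret guarded_game game g "4 * m + 5 * nA" by (rule guarded)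
  interpret ordered_game game g "4 * m + 5 * nA" \<sigma> by unfold_locales (rule ord)
  have ownl: "own i = code ` lset i" if "g \<le> i" "i < n" for i
    using own_eq[OF that] by (simp add: own_def)
  have fe: "far e = {}" if "own e = code ` X" "\<forall>x\<in>X. near e (code x)" for e X
    using that by (auto simp: far_def)
  have tri: "g + t \<in> saved \<and> g + m + ax t \<in> saved \<and> g + m + ay t \<in> saved" if t: "t \<in> C" for t
  proof -
    obtain k where k: "\<And>i. i < 19 \<Longrightarrow> \<sigma> (code (tblock t ! i)) = k + i"
      using bl[of "tblock t"] t by (auto simp: ps tblock_def ablock_def simp del: code.simps)
    have pos: "\<sigma> (code (Anch_priv (ax t) 0)) = k" "\<sigma> (code (Anch_priv (ax t) 1)) = k + 1"
      "\<sigma> (code (Anch_priv (ax t) 2)) = k + 2" "\<sigma> (code (Anch (ax t))) = k + 3"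
      "\<sigma> (code (Anch_priv (ax t) 3)) = k + 4" "\<sigma> (code (Anch_priv (ax t) 4)) = k + 5"
      "\<sigma> (code (Elem (ax t))) = k + 6" "\<sigma> (code (Priv t 0)) = k + 7" "\<sigma> (code (Priv t 1)) = k + 8"
      "\<sigma> (code (Trip t)) = k + 9" "\<sigma> (code (Priv t 2)) = k + 10" "\<sigma> (code (Free (az t))) = k + 11"
      "\<sigma> (code (Elem (ay t))) = k + 12" "\<sigma> (code (Anch_priv (ay t) 4)) = k + 13"
      "\<sigma> (code (Anch_priv (ay t) 3)) = k + 14" "\<sigma> (code (Anch (ay t))) = k + 15"
      "\<sigma> (code (Anch_priv (ay t) 2)) = k + 16" "\<sigma> (code (Anch_priv (ay t) 1)) = k + 17"
      "\<sigma> (code (Anch_priv (ay t) 0)) = k + 18"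
      using k[of 0] k[of 1] k[of 2] k[of 3] k[of 4] k[of 5] k[of 6] k[of 7] k[of 8] k[of 9] k[of 10]
        k[of 11] k[of 12] k[of 13] k[of 14] k[of 15] k[of 16] k[of 17] k[of 18]
      by (simp_all add: tblock_def ablock_def del: code.simps)
    have tm: "t < m" "ok t" "ax t < nA" "ay t < nA" using Cm[OF t] ax_lt ay_lt by auto
    have own: "own (code (Trip t)) = code ` tset t" "own (code (Anch (ax t))) = code ` aset (ax t)"
       "own (code (Anch (ay t))) = code ` aset (ay t)"
      using ownl lights_in_range tm lset_trip lset_anch unfolding code.simps by metis+
    have "far (code (Trip t)) = {}"
      by (rule fe[OF own(1)]) (simp add: near_def tset_def pos[unfolded One_nat_def] tm(2) del: code.simps)
    moreover have "far (code (Anch (ax t))) = {}"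
      by (rule fe[OF own(2)]) (simp add: near_def aset_def pos[unfolded One_nat_def] del: code.simps)
    moreover have "far (code (Anch (ay t))) = {}"
      by (rule fe[OF own(3)]) (simp add: near_def aset_def pos[unfolded One_nat_def] del: code.simps)
    ultimately show ?thesis using tm by (simp add: saved_def)
  qed
  have anch: "g + m + a \<in> saved" if a: "a < nA" for a
  proof (cases "a \<in> U")
    case True
    obtain k where k: "\<And>i. i < 7 \<Longrightarrow> \<sigma> (code (ablock a ! i)) = k + i"
      using bl[of "ablock a"] True by (auto simp: ps ablock_def simp del: code.simps)
    have pos: "\<sigma> (code (Anch_priv a 0)) = k" "\<sigma> (code (Anch_priv a 1)) = k + 1"
      "\<sigma> (code (Anch_priv a 2)) = k + 2" "\<sigma> (code (Anch a)) = k + 3"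
      "\<sigma> (code (Anch_priv a 3)) = k + 4" "\<sigma> (code (Anch_priv a 4)) = k + 5"
      "\<sigma> (code (Elem a)) = k + 6"
      using k[of 0] k[of 1] k[of 2] k[of 3] k[of 4] k[of 5] k[of 6] by (simp_all add: ablock_def del: code.simps)
    have own: "own (code (Anch a)) = code ` aset a"
      using ownl lights_in_range a lset_anch unfolding code.simps by metis
    have "far (code (Anch a)) = {}"
      by (rule fe[OF own]) (simp add: near_def aset_def pos[unfolded One_nat_def] del: code.simps)
    then show ?thesis using a by (simp add: saved_def)
  next
    case False
    then show ?thesis using a tri by (auto simp: U_def)
  qed
  let ?S = "(\<lambda>t. g + t) ` C \<union> (\<lambda>a. g + m + a) ` {..<nA}"
  have "sum val ?S = sum val ((\<lambda>t. g + t) ` C) + sum val ((\<lambda>a. g + m + a) ` {..<nA})"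
    by (intro sum.union_disjoint) (use finC Cm in fastforce)+
  also have "sum val ((\<lambda>t. g + t) ` C) = (\<Sum>t\<in>C. 1)"
    by (subst sum.reindex) (auto simp: val_def Cm inj_on_def intro!: sum.cong)
  also have "sum val ((\<lambda>a. g + m + a) ` {..<nA}) = (\<Sum>t\<in>{..<nA}. m + 1)"
    by (subst sum.reindex) (auto simp: val_def inj_on_def intro!: sum.cong)
  finally have "(m + 1) * nA + q \<le> sum val ?S" using q by (simp add: mult.commute)
  also have "\<dots> \<le> sum val saved" using tri anch saved_lights by (intro sum_mono2) auto
  finally have "(m + 1) * nA + q \<le> sum val saved" .
  then have "(of_nat ((m + 1) * nA + q) :: rat) \<le> of_nat (sum val saved)" unfolding of_nat_le_iff .
  then have "of_nat ((m + 1) * nA + q) \<le> sum (target_value game) saved" by (simp only: game_simps of_nat_sum)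
  then show ?thesis using ord by blast
qed

theorem game_value:
  assumes "1 \<le> q"
  shows "blue_leader_value game \<ge> of_nat ((m + 1) * nA + q) \<longleftrightarrow> (\<exists>C. packing C \<and> q \<le> card C)"
  unfolding guarded_game.blue_leader_value_iff[OF guarded]
  using packing_of_ordering[OF _ assms] ordering_of_packing by blast

end

section \<open>Satisfiability as a packing problem\<close>

text \<open>A slot \<open>i = v * nc + c\<close> stands for the pair of variable \<open>v\<close> and clause \<open>c\<close>. Below
  \<open>2 * slots\<close> there are the triples of the truth-setting wheels, two per slot; choosing \<open>2 * i + b\<close> means that
  \<open>v\<close> gets value \<open>b\<close> and leaves the free element \<open>2 * i + b\<close> to the clause triple \<open>2 * slots + 2 * i + b\<close>.\<close>

locale cnf =
  fixes nv nc :: nat and lit :: "nat \<Rightarrow> nat \<Rightarrow> nat \<Rightarrow> bool" and K :: nat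
  assumes nc2: "2 \<le> nc"
begin

definition slots :: nat where "slots = nv * nc"

text \<open>The cyclic successor among the slots of one variable: its wheel has one spoke for each
  clause.\<close>

definition succ :: "nat \<Rightarrow> nat" where
  "succ i = (if i mod nc + 1 = nc then i + 1 - nc else i + 1)"

text \<open>The anchored elements fall into four ranges: below \<open>slots\<close> the one common
  to both triples of a slot, then up to \<open>2 * slots\<close> the links between cyclically
  adjacent slots, up to \<open>4 * slots\<close> a filler of its own for every clause triple, and at
  the end one element per clause.\<close>

definition cx :: "nat \<Rightarrow> nat" where
  "cx t = (if t < 2 * slots then t div 2 else 4 * slots + ((t - 2 * slots) div 2) mod nc)"

definition cy :: "nat \<Rightarrow> nat" where
  "cy t = (if t < 2 * slots then slots + (if t mod 2 = 1 then t div 2 else succ (t div 2)) else t)"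

definition cz :: "nat \<Rightarrow> nat" where
  "cz t = (if t < 2 * slots then (if t mod 2 = 1 then t - 1 else t + 1) else t - 2 * slots)"

text \<open>A pair of variable and value that does not satisfy the clause keeps its triple, which is
  merely forbidden; so the indices of triples stay arithmetic.\<close>

definition cok :: "nat \<Rightarrow> bool" where
  "cok t \<longleftrightarrow> t < 2 * slots \<or> lit ((t - 2 * slots) div 2 mod nc) ((t - 2 * slots) div 2 div nc) (t mod 2)"

definition sat :: "(nat \<Rightarrow> bool) \<Rightarrow> bool" where
  "sat \<alpha> \<longleftrightarrow> (\<forall>c<nc. \<exists>v<nv. lit c v (of_bool (\<alpha> v)))"

lemma nc0: "0 < nc" using nc2 by simp

lemma succ_div: "succ i div nc = i div nc"
  and succ_mod: "succ i mod nc = (i mod nc + 1) mod nc"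
proof -
  let ?c = "i mod nc"
  have i: "i = nc * (i div nc) + ?c" by simp
  have c: "?c < nc" using nc0 by simp
  have s: "succ i = nc * (i div nc) + (?c + 1) mod nc"
  proof (cases "?c + 1 = nc")
    case True
    then have "succ i = i + 1 - nc" by (simp add: succ_def)
    also have "i + 1 - nc = nc * (i div nc)" using True i by linarith
    finally show ?thesis using True by simp
  next
    case False
    then have "?c + 1 < nc" using c by simp
    moreover have "succ i = i + 1" using False by (simp add: succ_def)
    ultimately show ?thesis using i by (simp only: mod_less)
  qed
  have lt: "(?c + 1) mod nc < nc" using nc0 by simp
  show "succ i div nc = i div nc" unfolding s using lt by (simp add: div_mult2_eq[symmetric])
  show "succ i mod nc = (?c + 1) mod nc" unfolding s by simp
qed

lemma slot_div: "i < slots \<Longrightarrow> i div nc < nv"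
  by (simp add: slots_def less_mult_imp_div_less)

lemma slot_lt: "v < nv \<Longrightarrow> c < nc \<Longrightarrow> v * nc + c < slots"
  using mult_le_mono1[of "Suc v" nv nc] by (simp add: slots_def)

lemma succ_lt: "i < slots \<Longrightarrow> succ i < slots"
proof -
  assume "i < slots"
  then have "succ i div nc < nv" using slot_div by (simp add: succ_div)
  then show ?thesis unfolding slots_def by (metis div_less_iff_less_mult nc0)
qed

lemma succ_ne: "succ i \<noteq> i"
  using nc2 by (auto simp: succ_def)

lemma succ_inj: "succ i = succ j \<Longrightarrow> i = j"
proof -
  assume e: "succ i = succ j"
  have "i div nc = j div nc" using succ_div[of i] succ_div[of j] e by simp
  moreover have "i mod nc = j mod nc"
  proof -
    have "(i mod nc + 1) mod nc = (j mod nc + 1) mod nc" using succ_mod[of i] succ_mod[of j] e by simp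
    moreover have "i mod nc < nc" "j mod nc < nc" using nc0 by simp_all
    ultimately show ?thesis by (metis Suc_eq_plus1 mod_Suc mod_mod_trivial nat.inject nat.simps(3))
  qed
  ultimately show ?thesis by (metis div_mult_mod_eq)
qed

lemma even_odd_cases: "t < 2 * s \<Longrightarrow> (\<And>i. i < s \<Longrightarrow> t = 2 * i \<Longrightarrow> P) \<Longrightarrow> (\<And>i. i < s \<Longrightarrow> t = 2 * i + 1 \<Longrightarrow> P) \<Longrightarrow> P"
  for t s :: nat
  by (metis Suc_eq_plus1 even_two_times_div_two mult_less_cancel1 odd_two_times_div_two_succ
      Suc_lessD)

lemma wheel_simps:
  assumes "i < slots"
  shows "cx (2 * i) = i" "cx (2 * i + 1) = i" "cy (2 * i) = slots + succ i" "cy (2 * i + 1) = slots + i"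
    "cz (2 * i) = 2 * i + 1" "cz (2 * i + 1) = 2 * i"
  using assms by (auto simp: cx_def cy_def cz_def)

lemma clause_simps:
  assumes "\<not> t < 2 * slots"
  shows "cx t = 4 * slots + ((t - 2 * slots) div 2) mod nc" "cy t = t" "cz t = t - 2 * slots"
  using assms by (auto simp: cx_def cy_def cz_def)

lemma cx_wheel: "t < 2 * slots \<Longrightarrow> cx t < slots"
  by (erule even_odd_cases) (auto simp: wheel_simps[simplified])
lemma cy_wheel: "t < 2 * slots \<Longrightarrow> slots \<le> cy t \<and> cy t < 2 * slots"
  by (erule even_odd_cases) (auto simp: wheel_simps[simplified] succ_lt)
lemma cz_wheel: "t < 2 * slots \<Longrightarrow> cz t < 2 * slots"
  by (erule even_odd_cases) (auto simp: wheel_simps[simplified])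

text \<open>The two triples of a slot use different links because a wheel has at least two spokes,
  and different free elements.\<close>

lemma cx_wheel_eq:
  assumes "t < 2 * slots" "t' < 2 * slots" "t \<noteq> t'" "cx t = cx t'"
  shows "cy t \<noteq> cy t' \<and> cz t \<noteq> cz t'"
  using assms(1)
proof (rule even_odd_cases)
  fix i assume i: "i < slots" "t = 2 * i"
  show ?thesis using assms(2)
  proof (rule even_odd_cases)
    fix j assume "j < slots" "t' = 2 * j + 1"
    then show ?thesis using i assms(4) succ_ne[of i] by (simp add: wheel_simps[simplified])
  qed (use i assms(3,4) in \<open>auto simp: wheel_simps\<close>)
next
  fix i assume i: "i < slots" "t = 2 * i + 1"
  show ?thesis using assms(2)
  proof (rule even_odd_cases)
    fix j assume "j < slots" "t' = 2 * j"
    then show ?thesis using i assms(4) succ_ne[of i] by (simp add: wheel_simps[simplified])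
  qed (use i assms(3,4) in \<open>auto simp: wheel_simps[simplified]\<close>)
qed

lemma cz_wheel_inj:
  assumes "t < 2 * slots" "t' < 2 * slots" "cz t = cz t'" shows "t = t'"
  using assms(1)
proof (rule even_odd_cases)
  fix i assume i: "i < slots" "t = 2 * i"
  show ?thesis using assms(2)
    by (rule even_odd_cases) (use i assms(3) in \<open>auto simp: wheel_simps[simplified]; presburger\<close>)+
next
  fix i assume i: "i < slots" "t = 2 * i + 1"
  show ?thesis using assms(2)
    by (rule even_odd_cases) (use i assms(3) in \<open>auto simp: wheel_simps[simplified]; presburger\<close>)+
qed

lemma triples:
  assumes "5 * (4 * slots) + 7 * (4 * slots + nc) + 2 * slots \<le> K"
  shows "triples (4 * slots) (4 * slots + nc) (2 * slots) K cx cy cz"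
proof
  fix t assume t: "t < 4 * slots"
  show "cx t < 4 * slots + nc"
  proof (cases "t < 2 * slots")
    case True then show ?thesis using cx_wheel[of t] by simp
  next
    case False then show ?thesis using nc0 by (simp add: clause_simps)
  qed
  show "cy t < 4 * slots + nc"
  proof (cases "t < 2 * slots")
    case True then show ?thesis using cy_wheel[of t] by simp
  next
    case False then show ?thesis using nc0 t by (simp add: clause_simps)
  qed
  show "cz t < 2 * slots"
  proof (cases "t < 2 * slots")
    case True then show ?thesis using cz_wheel[of t] by simp
  next
    case False then show ?thesis using t by (simp add: clause_simps)
  qed
  fix t' assume t': "t' < 4 * slots"
  show "cx t \<noteq> cy t'"
  proof (cases "t < 2 * slots"; cases "t' < 2 * slots")
    assume "t < 2 * slots" "t' < 2 * slots" then show ?thesis using cx_wheel[of t] cy_wheel[of t'] by linarith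
  next
    assume "t < 2 * slots" "\<not> t' < 2 * slots" then show ?thesis using cx_wheel[of t] by (simp add: clause_simps)
  next
    assume "\<not> t < 2 * slots" "t' < 2 * slots" then show ?thesis using cy_wheel[of t'] by (simp add: clause_simps)
  next
    assume "\<not> t < 2 * slots" "\<not> t' < 2 * slots" then show ?thesis using t' by (simp add: clause_simps)
  qed
  assume ne: "t \<noteq> t'"
  show "\<not> (cx t = cx t' \<and> cy t = cy t') \<and> \<not> (cx t = cx t' \<and> cz t = cz t') \<and> \<not> (cy t = cy t' \<and> cz t = cz t')"
  proof (cases "t < 2 * slots"; cases "t' < 2 * slots")
    assume "t < 2 * slots" "t' < 2 * slots"
    then show ?thesis using cx_wheel_eq[of t t'] cz_wheel_inj[of t t'] ne by blast
  next
    assume "t < 2 * slots" "\<not> t' < 2 * slots"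
    then show ?thesis using cx_wheel[of t] cy_wheel[of t] by (auto simp: clause_simps)
  next
    assume "\<not> t < 2 * slots" "t' < 2 * slots"
    then show ?thesis using cx_wheel[of t'] cy_wheel[of t'] by (auto simp: clause_simps)
  next
    assume "\<not> t < 2 * slots" "\<not> t' < 2 * slots"
    then show ?thesis using ne by (auto simp: clause_simps)
  qed
qed (use assms in simp)

end

locale cnf_packing = cnf +
  assumes K: "5 * (4 * slots) + 7 * (4 * slots + nc) + 2 * slots \<le> K"
begin

sublocale triples "4 * slots" "4 * slots + nc" "2 * slots" K cx cy cz cok
  by (rule triples[OF K])

lemma sat_of_packing:
  assumes C: "packing C" and q: "slots + nc \<le> card C"
  shows "\<exists>\<alpha>. sat \<alpha>"
proof -
  have C1: "t < 4 * slots" "cok t" if "t \<in> C" for t using C that by (auto simp: packing_def)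
  have C2: "cx t \<noteq> cx t'" "cy t \<noteq> cy t'" "cz t \<noteq> cz t'" if "t \<in> C" "t' \<in> C" "t \<noteq> t'" for t t'
    using C that by (auto simp: packing_def)
  have finC: "finite C" using C1 by (intro finite_subset[of C "{..<4 * slots}"]) auto
  let ?X = "{..<slots} \<union> {4 * slots..<4 * slots + nc}"
  have "inj_on cx C" using C2 by (auto simp: inj_on_def)
  then have "card (cx ` C) = card C" by (rule card_image)
  moreover have "cx ` C \<subseteq> ?X"
  proof
    fix y assume "y \<in> cx ` C"
    then obtain t where t: "t \<in> C" "y = cx t" by blast
    show "y \<in> ?X"
    proof (cases "t < 2 * slots")
      case True then show ?thesis using t cx_wheel[of t] by simp
    next
      case False then show ?thesis using t nc0 by (simp add: clause_simps)
    qed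
  qed
  moreover have "card ?X = slots + nc" by (subst card_Un_disjoint) auto
  ultimately have X: "cx ` C = ?X" using q card_mono[of ?X "cx ` C"] by (intro card_subset_eq) auto
  have wheel: "2 * i \<in> C \<or> 2 * i + 1 \<in> C" if i: "i < slots" for i
  proof -
    have "i \<in> cx ` C" using X i by auto
    then obtain t where t: "t \<in> C" "cx t = i" by auto
    have "t < 2 * slots"
    proof (rule ccontr)
      assume "\<not> t < 2 * slots" then show False using t i by (simp add: clause_simps)
    qed
    then show ?thesis by (rule even_odd_cases) (use t in \<open>auto simp: wheel_simps[simplified]\<close>)
  qed
  define f where "f v c \<longleftrightarrow> 2 * (v * nc + c) \<in> C" for v c
  have step: "f v ((c + 1) mod nc)" if "f v c" "v < nv" "c < nc" for v c
  proof -
    let ?i = "v * nc + c"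
    have i: "?i < slots" using slot_lt that by simp
    have "succ ?i div nc = v" "succ ?i mod nc = (c + 1) mod nc" using that by (simp_all add: succ_div succ_mod)
    then have s: "succ ?i = v * nc + (c + 1) mod nc" by (metis div_mult_mod_eq)
    have "2 * succ ?i + 1 \<notin> C"
    proof
      assume a: "2 * succ ?i + 1 \<in> C"
      have b: "2 * ?i \<in> C" using that by (simp add: f_def)
      have "2 * ?i \<noteq> 2 * succ ?i + 1" by presburger
      from C2(2)[OF b a this] show False unfolding wheel_simps(3)[OF i] wheel_simps(4)[OF succ_lt[OF i]] by simp
    qed
    then show ?thesis using wheel[OF succ_lt[OF i]] by (simp add: f_def s)
  qed
  have iter: "f v ((c + k) mod nc)" if "f v c" "v < nv" "c < nc" for v c k
  proof (induction k)
    case 0 then show ?case using that by simp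
  next
    case (Suc k)
    then show ?case using step[OF Suc, of] that nc0 by (simp add: mod_Suc_eq)
  qed
  \<comment> \<open>Around the wheel from \<open>c\<close> back to 0, and from 0 on to
    \<open>c\<close>.\<close>
  have same: "f v c \<longleftrightarrow> f v 0" if "v < nv" "c < nc" for v c
    using iter[of v c "nc - c"] iter[of v 0 c] that nc0 by auto
  define \<alpha> where "\<alpha> v \<longleftrightarrow> \<not> f v 0" for v
  have "\<exists>v<nv. lit c v (of_bool (\<alpha> v))" if c: "c < nc" for c
  proof -
    have "4 * slots + c \<in> cx ` C" using X c by auto
    then obtain t where t: "t \<in> C" "cx t = 4 * slots + c" by force
    have nt: "\<not> t < 2 * slots" using t cx_wheel[of t] by auto
    define i where "i = (t - 2 * slots) div 2"
    have i: "i < slots" using C1(1)[OF t(1)] nt by (auto simp: i_def)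
    have ic: "i mod nc = c" using t(2) nt by (simp add: clause_simps i_def)
    define v where "v = i div nc"
    have v: "v < nv" using slot_div[OF i] by (simp add: v_def)
    have vi: "v * nc + c = i" using ic by (metis div_mult_mod_eq v_def)
    have l: "lit c v (t mod 2)" using C1(2)[OF t(1)] nt ic by (simp add: cok_def v_def i_def)
    have z: "cz t = 2 * i + t mod 2"
    proof -
      have "(t - 2 * slots) mod 2 = t mod 2" using nt by presburger
      then show ?thesis using nt by (simp add: clause_simps i_def) presburger
    qed
    have "t mod 2 = of_bool (\<alpha> v)"
    proof (cases "2 * i \<in> C")
      case True
      then have "\<not> \<alpha> v" using same[OF v c] by (simp add: \<alpha>_def f_def vi)
      moreover have "cz (2 * i) \<noteq> cz t" using C2(3)[OF True t(1)] nt i by auto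
      then have "t mod 2 \<noteq> 1" using z i by (simp add: wheel_simps)
      ultimately show ?thesis by simp
    next
      case False
      then have a: "2 * i + 1 \<in> C" using wheel[OF i] by simp
      have "\<alpha> v" using False same[OF v c] by (simp add: \<alpha>_def f_def vi)
      moreover have "cz (2 * i + 1) \<noteq> cz t" using C2(3)[OF a t(1)] nt i by auto
      then have "t mod 2 \<noteq> 0" using z i by (simp add: wheel_simps[simplified])
      ultimately show ?thesis by simp
    qed
    then show ?thesis using l v by auto
  qed
  then show ?thesis unfolding sat_def by blast
qed

lemma packing_of_sat:
  assumes s: "sat \<alpha>" shows "\<exists>C. packing C \<and> slots + nc \<le> card C"
proof -
  obtain w where w: "\<And>c. c < nc \<Longrightarrow> w c < nv \<and> lit c (w c) (of_bool (\<alpha> (w c)))"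
    using s unfolding sat_def by metis
  \<comment> \<open>\<open>W i\<close> is the wheel triple chosen in slot \<open>i\<close>, and
    \<open>Q c\<close> is the clause triple of the witness \<open>w c\<close>, whose slot is
    \<open>s c\<close>.\<close>
  define W where "W i = 2 * i + of_bool (\<alpha> (i div nc))" for i
  define s where "s c = w c * nc + c" for c
  define Q where "Q c = 2 * slots + (2 * s c + of_bool (\<alpha> (w c)))" for c
  have s: "s c < slots" "s c div nc = w c" "s c mod nc = c" if "c < nc" for c
    using slot_lt w[OF that] that by (auto simp: s_def)
  have Wlt: "W i < 2 * slots" if "i < slots" for i using that by (auto simp: W_def)
  have Wx: "cx (W i) = i" if "i < slots" for i using that by (auto simp: W_def wheel_simps[simplified])
  have Wy: "cy (W i) = slots + (if \<alpha> (i div nc) then i else succ i)" if "i < slots" for i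
    using that by (auto simp: W_def wheel_simps[simplified])
  have Wz: "cz (W i) = 2 * i + of_bool (\<not> \<alpha> (i div nc))" if "i < slots" for i
    using that by (auto simp: W_def wheel_simps[simplified])
  have Qn: "\<not> Q c < 2 * slots" for c by (simp add: Q_def)
  have Q2: "(Q c - 2 * slots) div 2 = s c" "Q c mod 2 = of_bool (\<alpha> (w c))" for c by (auto simp: Q_def)
  have Qx: "cx (Q c) = 4 * slots + c" if "c < nc" for c using Qn s[OF that] by (simp add: clause_simps Q2)
  have Qz: "cz (Q c) = 2 * s c + of_bool (\<alpha> (w c))" for c using Qn by (simp add: clause_simps) (simp add: Q_def)
  have WQ: "cz (W i) \<noteq> cz (Q c)" if "i < slots" "c < nc" for i c
  proof
    assume "cz (W i) = cz (Q c)"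
    then have e: "2 * i + of_bool (\<not> \<alpha> (i div nc)) = 2 * s c + of_bool (\<alpha> (w c))" using Wz Qz that by simp
    then have "i = s c" by (cases "\<alpha> (i div nc)"; cases "\<alpha> (w c)"; simp; presburger)
    then show False using e s[OF that(2)] by (cases "\<alpha> (w c)") auto
  qed
  have s_inj: "c = c'" if "c < nc" "c' < nc" "2 * s c + of_bool (\<alpha> (w c)) = 2 * s c' + (of_bool (\<alpha> (w c')) :: nat)" for c c'
  proof -
    have "s c = s c'" using that(3) by (cases "\<alpha> (w c)"; cases "\<alpha> (w c')"; simp; presburger)
    then show ?thesis using s that by metis
  qed
  let ?C = "W ` {..<slots} \<union> Q ` {..<nc}"
  have iW: "inj_on W {..<slots}" using Wx by (intro inj_on_inverseI[of _ cx]) simp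
  have iQ: "inj_on Q {..<nc}" using Qx by (intro inj_on_inverseI[of _ "\<lambda>t. cx t - 4 * slots"]) simp
  have dis: "W ` {..<slots} \<inter> Q ` {..<nc} = {}"
  proof -
    have "W i \<noteq> Q c" if "i < slots" for i c using Wlt[OF that] Qn[of c] by metis
    then show ?thesis by blast
  qed
  have card: "card ?C = slots + nc"
    by (subst card_Un_disjoint[OF _ _ dis]) (simp_all add: card_image iW iQ)
  have "packing ?C" unfolding packing_def
  proof (intro conjI ballI impI)
    fix t assume t: "t \<in> ?C"
    show "t < 4 * slots"
    proof -
      have "Q c < 4 * slots" if "c < nc" for c using s(1)[OF that] by (simp add: Q_def)
      moreover have "W i < 4 * slots" if "i < slots" for i using Wlt[OF that] by simp
      ultimately show ?thesis using t by blast
    qed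
    show "cok t" using t
    proof
      assume "t \<in> Q ` {..<nc}"
      then obtain c where "c < nc" "t = Q c" by auto
      then show ?thesis using Q2[of c] s[of c] w[of c] by (simp add: cok_def)
    qed (auto simp: cok_def Wlt)
    fix t' assume t': "t' \<in> ?C" "t \<noteq> t'"
    have WW: "cx (W i) \<noteq> cx (W j) \<and> cy (W i) \<noteq> cy (W j) \<and> cz (W i) \<noteq> cz (W j)" if "i < slots" "j < slots" "i \<noteq> j" for i j
    proof -
      have "(if \<alpha> (i div nc) then i else succ i) \<noteq> (if \<alpha> (j div nc) then j else succ j)"
        using that(3) succ_inj[of i j] succ_div[of i] succ_div[of j] by metis
      moreover have "2 * i + of_bool (\<not> \<alpha> (i div nc)) \<noteq> 2 * j + (of_bool (\<not> \<alpha> (j div nc)) :: nat)"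
        using that(3) by (cases "\<alpha> (i div nc)"; cases "\<alpha> (j div nc)"; simp; presburger)
      ultimately show ?thesis using that Wx Wy Wz by simp
    qed
    have QQ: "cx (Q c) \<noteq> cx (Q d) \<and> cy (Q c) \<noteq> cy (Q d) \<and> cz (Q c) \<noteq> cz (Q d)" if "c < nc" "d < nc" "c \<noteq> d" for c d
      using that s_inj[of c d] Qx Qz Qn by (auto simp: clause_simps(2) Q_def)
    have WQ': "cx (W i) \<noteq> cx (Q d) \<and> cy (W i) \<noteq> cy (Q d) \<and> cz (W i) \<noteq> cz (Q d)" if "i < slots" "d < nc" for i d
      using that WQ[OF that] Wx Qx cy_wheel[OF Wlt[OF that(1)]] Qn[of d] by (auto simp: clause_simps(2))
    have all: "cx t \<noteq> cx t' \<and> cy t \<noteq> cy t' \<and> cz t \<noteq> cz t'"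
    proof -
      from t consider i where "i < slots" "t = W i" | c where "c < nc" "t = Q c" by blast
      then show ?thesis
      proof cases
        case 1
        from t'(1) consider i where "i < slots" "t' = W i" | c where "c < nc" "t' = Q c" by blast
        then show ?thesis using 1 t'(2) WW WQ' by cases metis+
      next
        case 2
        from t'(1) consider i where "i < slots" "t' = W i" | c where "c < nc" "t' = Q c" by blast
        then show ?thesis using 2 t'(2) QQ WQ' by cases metis+
      qed
    qed
    then show "cx t \<noteq> cx t'" "cy t \<noteq> cy t'" "cz t \<noteq> cz t'" by blast+
  qed
  then show ?thesis using card by (metis order_refl)
qed

theorem cnf_game_value:
  "blue_leader_value game \<ge> of_nat ((4 * slots + 1) * (4 * slots + nc) + (slots + nc)) \<longleftrightarrow> (\<exists>\<alpha>. sat \<alpha>)"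
  using game_value[of "slots + nc"] nc0 sat_of_packing packing_of_sat by auto

end

section \<open>Computations as satisfiability problems\<close>

text \<open>The components of a machine state are numbered: \<open>0\<close> is the program counter, \<open>1 + r\<close> is register
  \<open>r < R\<close>, and \<open>1 + R + a\<close> is memory cell \<open>a\<close>.  The next value of component \<open>q\<close> depends on the program
  counter \<open>l\<close>, the value \<open>u\<close> of component \<open>srcA l q\<close> and the value of component \<open>srcB l q u\<close>.\<close>

definition component :: "nat \<Rightarrow> ram_state \<Rightarrow> nat \<Rightarrow> nat" where
  "component R s q = (if q = 0 then pc s else if q \<le> R then reg s (q - 1) else mem s (q - 1 - R))"

fun srcA_instr :: "instr \<Rightarrow> nat \<Rightarrow> nat" where
  "srcA_instr (Const r a) q = q"
| "srcA_instr (Arith f r a b) q = 1 + a"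
| "srcA_instr (Load r a) q = 1 + a"
| "srcA_instr (Store a r) q = 1 + a"
| "srcA_instr (JumpIfZero r l) q = 1 + r"

fun srcB_instr :: "nat \<Rightarrow> instr \<Rightarrow> nat \<Rightarrow> nat \<Rightarrow> nat" where
  "srcB_instr R (Const r a) q u = q"
| "srcB_instr R (Arith f r a b) q u = (if q = 1 + r then 1 + b else q)"
| "srcB_instr R (Load r a) q u = (if q = 1 + r then 1 + R + u else q)"
| "srcB_instr R (Store a r) q u = (if q = 1 + R + u then 1 + r else q)"
| "srcB_instr R (JumpIfZero r l) q u = q"

fun res_instr :: "instr \<Rightarrow> nat \<Rightarrow> nat \<Rightarrow> nat \<Rightarrow> nat \<Rightarrow> nat" where
  "res_instr (Const r a) l q u w = (if q = 0 then l + 1 else if q = 1 + r then a else w)"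
| "res_instr (Arith f r a b) l q u w = (if q = 0 then l + 1 else if q = 1 + r then binop_fun f u w else w)"
| "res_instr (Load r a) l q u w = (if q = 0 then l + 1 else w)"
| "res_instr (Store a r) l q u w = (if q = 0 then l + 1 else w)"
| "res_instr (JumpIfZero r l') l q u w = (if q = 0 then if u = 0 then l' else l + 1 else w)"

fun regs_instr :: "instr \<Rightarrow> nat" where
  "regs_instr (Const r a) = r"
| "regs_instr (Arith f r a b) = r + a + b"
| "regs_instr (Load r a) = r + a"
| "regs_instr (Store a r) = r + a"
| "regs_instr (JumpIfZero r l) = r"

fun target_instr :: "instr \<Rightarrow> nat" where
  "target_instr (JumpIfZero r l) = l"
| "target_instr _ = 0"

definition srcA :: "instr list \<Rightarrow> nat \<Rightarrow> nat \<Rightarrow> nat" where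
  "srcA P l q = (if l < length P then srcA_instr (P ! l) q else q)"
definition srcB :: "instr list \<Rightarrow> nat \<Rightarrow> nat \<Rightarrow> nat \<Rightarrow> nat \<Rightarrow> nat" where
  "srcB P R l q u = (if l < length P then srcB_instr R (P ! l) q u else q)"
definition res :: "instr list \<Rightarrow> nat \<Rightarrow> nat \<Rightarrow> nat \<Rightarrow> nat \<Rightarrow> nat" where
  "res P l q u w = (if l < length P then res_instr (P ! l) l q u w else w)"

lemma comp_step:
  assumes "\<forall>i\<in>set P. regs_instr i < R"
  shows "component R (ram_step P s) q = res P (pc s) q (component R s (srcA P (pc s) q))
     (component R s (srcB P R (pc s) q (component R s (srcA P (pc s) q))))"
proof (cases "pc s < length P")
  case True
  then have "regs_instr (P ! pc s) < R" using assms nth_mem by blast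
  then show ?thesis using True
    by (cases "P ! pc s") (auto simp: ram_step_def ram_halted_def srcA_def srcB_def res_def component_def)
next
  case False
  then show ?thesis by (simp add: ram_step_def ram_halted_def srcA_def srcB_def res_def component_def)
qed

text \<open>A crude bound on the program counter: only a jump can lead beyond the end of the
  program, and each jump target is a summand.\<close>

definition max_target :: "instr list \<Rightarrow> nat" where
  "max_target P = length P + sum_list (map target_instr P)"

lemma pc_run_le: "pc s \<le> max_target P \<Longrightarrow> pc (ram_step P s) \<le> max_target P"
proof (cases "pc s < length P")
  case True
  then have "target_instr (P ! pc s) \<le> sum_list (map target_instr P)"
    by (intro member_le_sum_list) auto
  then show ?thesis using True
    by (cases "P ! pc s") (auto simp: ram_step_def ram_halted_def max_target_def)
qed (simp add: ram_step_def ram_halted_def)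

text \<open>Component 1 is register 0, the input length. It may have any value that leaves room for
  the code of \<open>x\<close> and is at most \<open>L\<close>, and the cells behind this code may
  hold arbitrary bits: in this way the certificate is guessed. Clearing the cells behind the guessed
  end is left to other clauses.\<close>

definition ini :: "bool list \<Rightarrow> nat \<Rightarrow> nat \<Rightarrow> nat \<Rightarrow> nat \<Rightarrow> bool" where
  "ini x R L q w \<longleftrightarrow>
    (if q = 1 then 2 * length x + 1 \<le> w \<and> w \<le> L
     else if q \<le> R then w = 0
     else if q - 1 - R < 2 * length x + 1 then w = of_bool (self_delimiting x ! (q - 1 - R))
     else if q - 1 - R < L then w \<le> 1 else w = 0)"

text \<open>Whether giving the variable \<open>(t, q, w)\<close> the value \<open>b\<close>
  satisfies the clause with the remaining indices; the variable means that component
  \<open>q\<close> has value \<open>w\<close> at time \<open>t\<close>. Kind 0 is an implication: if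
  \<open>cl\<close>, \<open>cu\<close> and \<open>cw\<close> are the program counter and the two
  sources of \<open>cq\<close> at time \<open>ct\<close>, the next value of \<open>cq\<close>
  follows. Kind 1 demands an initial value, kind 2 clears the cells behind an input of length
  \<open>cl\<close>, and kind 3 excludes the final output \<open>cw\<close> if it is not 1. Other
  index combinations yield clauses satisfied by every literal, so that the indices can range over a
  full box.\<close>

definition clit :: "instr list \<Rightarrow> bool list \<Rightarrow> nat \<Rightarrow> nat \<Rightarrow> nat \<Rightarrow>
    nat \<Rightarrow> nat \<Rightarrow> nat \<Rightarrow> nat \<Rightarrow> nat \<Rightarrow> nat \<Rightarrow> nat \<Rightarrow> nat \<Rightarrow> nat \<Rightarrow> nat \<Rightarrow> bool" where
  "clit P x R L D kd ct cq cl cu cw t q w b \<longleftrightarrow>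
    (if kd = 0 \<and> ct + 1 < D then
       b = 0 \<and> t = ct \<and> (q = 0 \<and> w = cl \<or> q = srcA P cl cq \<and> w = cu \<or> q = srcB P R cl cq cu \<and> w = cw) \<or>
       b = 1 \<and> t = ct + 1 \<and> q = cq \<and> w = res P cl cq cu cw
     else if kd = 1 then b = 1 \<and> t = 0 \<and> q = cq \<and> ini x R L cq w
     else if kd = 2 \<and> 1 + R + cl \<le> cq then b = 0 \<and> t = 0 \<and> q = 1 \<and> w = cl \<or> b = 1 \<and> t = 0 \<and> q = cq \<and> w = 0
     else if kd = 3 \<and> cw \<noteq> 1 then b = 0 \<and> t = D - 1 \<and> q = 1 + R \<and> w = cw
     else True)"

lemma of_bool_eq_Suc_0 [simp]: "of_bool b = Suc 0 \<longleftrightarrow> b"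
  by (cases b) auto

lemma length_self_delimiting: "length (self_delimiting x) = 2 * length x + 1"
  by (induction x) (auto simp: self_delimiting_def)

text \<open>A single bound \<open>D\<close> serves for times, components and values, so that clauses
  and variables are strings of digits in base \<open>D\<close>. Time \<open>D - 1\<close> is the
  last one, and all accepted lengths of certificates must have halted by then.\<close>

locale machine =
  fixes P :: "instr list" and x :: "bool list" and R L W D :: nat and acc :: "bool list \<Rightarrow> bool"
  assumes regs: "\<forall>i\<in>set P. regs_instr i < R" and R1: "1 \<le> R"
    and L: "2 * length x + 1 \<le> L" and LW: "L \<le> W" and D: "W + R + 2 + max_target P + 3 \<le> D"
    and run: "\<And>y. 2 * length x + 1 + length y \<le> L \<Longrightarrow>
      ram_computes P (self_delimiting x @ y) [acc y] (D - 1) W"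
begin

abbreviation state :: "bool list \<Rightarrow> nat \<Rightarrow> ram_state" where
  "state y t \<equiv> (ram_step P ^^ t) (ram_init (self_delimiting x @ y))"

lemma halted_stays: "ram_halted P s \<Longrightarrow> (ram_step P ^^ k) s = s"
  by (induction k) (auto simp: ram_step_def)

text \<open>A halted machine does not change any more, so the output can be read at a time fixed in
  advance.\<close>

lemma run_facts:
  assumes "2 * length x + 1 + length y \<le> L"
  shows "fits_words W (state y t)" "mem (state y (D - 1)) 0 = of_bool (acc y)"
proof -
  obtain t0 where t0: "t0 \<le> D - 1" "ram_halted P (state y t0)" "ram_output (state y t0) [acc y]"
     "\<forall>t'\<le>t0. fits_words W (state y t')"
    using run[OF assms] unfolding ram_computes_def by blast
  have later: "state y t = state y t0" if "t0 \<le> t" for t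
  proof -
    have "state y ((t - t0) + t0) = state y t0"
      unfolding funpow_add comp_apply using halted_stays[OF t0(2)] .
    then show ?thesis using that by simp
  qed
  show "fits_words W (state y t)" using t0(4) later[of t] by (cases "t \<le> t0") auto
  show "mem (state y (D - 1)) 0 = of_bool (acc y)"
    using later[OF t0(1)] t0(3) by (simp add: ram_output_def)
qed

lemma pc_le: "pc (state y t) \<le> max_target P"
  by (induction t) (auto simp: pc_run_le ram_init_def)

lemma comp_lt:
  assumes "2 * length x + 1 + length y \<le> L" shows "component R (state y t) q < D"
proof -
  have "reg (state y t) r \<le> W" "mem (state y t) a \<le> W" for r a
    using run_facts(1)[OF assms, of t] by (auto simp: fits_words_def)
  then have "reg (state y t) r < D" "mem (state y t) a < D" "pc (state y t) < D" for r a
    using D pc_le[of t y] by (smt (verit) add_leD1 le_less_trans less_add_same_cancel1 less_le_trans zero_less_numeral trans_less_add2 trans_le_add2 le_add1 le_add2 le_trans not_less_eq_eq numeral_eq_Suc add_Suc_right)+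
  then show ?thesis by (simp add: component_def)
qed

definition nsat :: "(nat \<Rightarrow> nat \<Rightarrow> nat \<Rightarrow> bool) \<Rightarrow> bool" where
  "nsat A \<longleftrightarrow> (\<forall>kd<D. \<forall>ct<D. \<forall>cq<D. \<forall>cl<D. \<forall>cu<D. \<forall>cw<D.
     \<exists>t<D. \<exists>q<D. \<exists>w<D. clit P x R L D kd ct cq cl cu cw t q w (of_bool (A t q w)))"

lemma srcA_lt: "q < D \<Longrightarrow> srcA P l q < D"
proof (cases "l < length P")
  case True
  then have "regs_instr (P ! l) < R" using regs nth_mem by blast
  then show "q < D \<Longrightarrow> srcA P l q < D" using True D by (cases "P ! l") (auto simp: srcA_def)
qed (simp add: srcA_def)

text \<open>Restricted to states of the run: with an arbitrary number as address, the source could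
  lie outside of the components below \<open>D\<close>.\<close>

lemma srcB_range:
  assumes y: "2 * length x + 1 + length y \<le> L" and q: "q < D"
  shows "srcB P R (pc (state y t)) q (component R (state y t) (srcA P (pc (state y t)) q)) < D"
proof (cases "pc (state y t) < length P")
  case True
  let ?s = "state y t"
  have rg: "regs_instr (P ! pc ?s) < R" using True regs nth_mem by blast
  have "reg ?s r \<le> W" for r using run_facts(1)[OF y, of t] by (auto simp: fits_words_def)
  then have "component R ?s (1 + r) \<le> W" if "r < R" for r using that by (simp add: component_def)
  then have cW: "Suc (R + component R ?s (Suc r)) < D" if "r < R" for r using that D by fastforce
  show ?thesis using rg True q D R1
    by (cases "P ! pc ?s") (auto simp: srcA_def srcB_def intro: cW)
qed (use q in \<open>simp add: srcB_def\<close>)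

text \<open>A component may have several values under \<open>A\<close>. From \<open>A\<close> a
  certificate is extracted, and by induction on time the values of the run on it are among the
  assigned ones. So the actual output is assigned, and it cannot be 0 because this value is excluded
  at the end.\<close>

lemma accepting_of_sat:
  assumes A: "nsat A"
  shows "\<exists>y. 2 * length x + 1 + length y \<le> L \<and> acc y"
proof -
  let ?n = "2 * length x + 1"
  have cl: "\<exists>t<D. \<exists>q<D. \<exists>w<D. clit P x R L D kd ct cq cl cu cw t q w (of_bool (A t q w))"
    if "kd < D" "ct < D" "cq < D" "cl < D" "cu < D" "cw < D" for kd ct cq cl cu cw
    by (rule A[unfolded nsat_def, rule_format, OF that])
  have D4: "4 \<le> D" "L < D" "R + 1 < D" using D LW by linarith+
  have ini1: "\<exists>w<D. ini x R L q w \<and> A 0 q w" if "q < D" for q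
  proof -
    have "\<exists>t<D. \<exists>q'<D. \<exists>w<D. clit P x R L D 1 0 q 0 0 0 t q' w (of_bool (A t q' w))"
      by (rule cl) (use that D4 in simp_all)
    then obtain t q' w where w: "w < D" "clit P x R L D 1 0 q 0 0 0 t q' w (of_bool (A t q' w))" by blast
    then have "(of_bool (A t q' w) :: nat) = 1 \<and> t = 0 \<and> q' = q \<and> ini x R L q w" unfolding clit_def by auto
    then have "A 0 q w" "ini x R L q w" by (elim conjE, simp)+
    then show ?thesis using w(1) by blast
  qed
  obtain n0 where n0: "?n \<le> n0" "n0 \<le> L" "A 0 1 n0" using ini1[of 1] D4 by (auto simp: ini_def)
  define y where "y = map (\<lambda>i. A 0 (1 + R + ?n + i) 1) [0..<n0 - ?n]"
  have ly: "?n + length y = n0" using n0 by (simp add: y_def)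
  then have y: "?n + length y \<le> L" using n0 by simp
  have init: "A 0 q (component R (state y 0) q)" if q: "q < D" for q
  proof -
    obtain w where w: "ini x R L q w" "A 0 q w" using ini1[OF q] by blast
    let ?z = "self_delimiting x @ y"
    have lz: "length ?z = n0" using ly by (simp add: length_self_delimiting)
    consider "q = 1" | "q \<noteq> 1" "q \<le> R" | "R < q" "q - 1 - R < ?n" | "R < q" "?n \<le> q - 1 - R" "q - 1 - R < n0"
      | "R < q" "n0 \<le> q - 1 - R" using n0 by linarith
    then show ?thesis
    proof cases
      case 1
      then show ?thesis using n0(3) R1 lz by (simp add: component_def ram_init_def)
    next
      case 2
      then have "w = 0" using w by (simp add: ini_def)
      moreover have "component R (state y 0) q = 0" using 2 by (auto simp: component_def ram_init_def)
      ultimately show ?thesis using w by simp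
    next
      case 3
      have "w = of_bool (self_delimiting x ! (q - 1 - R))" using 3 w R1 by (simp add: ini_def)
      moreover have "component R (state y 0) q = of_bool (self_delimiting x ! (q - 1 - R))"
        using 3 R1 n0(1) lz by (simp add: component_def ram_init_def nth_append length_self_delimiting)
      ultimately show ?thesis using w by simp
    next
      case 4
      let ?i = "q - 1 - R - ?n"
      have i: "?i < length y" "q = 1 + R + ?n + ?i" using 4 ly by auto
      have yi: "y ! ?i = A 0 q 1"
      proof -
        have "y ! j = A 0 (1 + R + ?n + j) 1" if "j < length y" for j using that by (simp add: y_def)
        from this[OF i(1)] show ?thesis unfolding i(2)[symmetric] .
      qed
      have "component R (state y 0) q = of_bool (y ! ?i)"
        using 4 R1 lz by (simp add: component_def ram_init_def nth_append length_self_delimiting)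
      moreover have "w \<le> 1" using w(1) 4 R1 n0 by (auto simp: ini_def)
      then have "A 0 q (of_bool (A 0 q 1))" using w(2) by (cases "A 0 q 1") (auto simp: le_Suc_eq)
      ultimately show ?thesis using yi by simp
    next
      case 5
      have n0D: "n0 < D" using n0 D4 by simp
      have le: "1 + R + n0 \<le> q" using 5 by simp
      have "\<exists>t<D. \<exists>q'<D. \<exists>w<D. clit P x R L D 2 0 q n0 0 0 t q' w (of_bool (A t q' w))"
        by (rule cl) (use q n0D D4 in simp_all)
      then obtain t q' w where "clit P x R L D 2 0 q n0 0 0 t q' w (of_bool (A t q' w))" by blast
      then have "(of_bool (A t q' w) :: nat) = 0 \<and> t = 0 \<and> q' = 1 \<and> w = n0 \<or>
          (of_bool (A t q' w) :: nat) = 1 \<and> t = 0 \<and> q' = q \<and> w = 0" using le by (simp add: clit_def)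
      then have "A 0 q 0" using n0(3) by (cases "A t q' w") auto
      moreover have "component R (state y 0) q = 0"
        using 5 R1 lz by (simp add: component_def ram_init_def)
      ultimately show ?thesis by simp
    qed
  qed
  have all: "\<forall>q<D. A t q (component R (state y t) q)" if "t < D" for t using that
  proof (induction t)
    case 0 then show ?case using init by blast
  next
    case (Suc t)
    show ?case
    proof (intro allI impI)
      fix q assume q: "q < D"
      let ?s = "state y t"
      let ?a = "srcA P (pc ?s) q" let ?u = "component R ?s ?a" let ?b = "srcB P R (pc ?s) q ?u" let ?w = "component R ?s ?b"
      have IH: "A t q (component R ?s q)" if "q < D" for q using Suc that by simp
      have pcc: "pc ?s = component R ?s 0" by (simp add: component_def)
      have l: "pc ?s < D" "?u < D" "?w < D" using comp_lt[OF y] unfolding pcc by blast+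
      have ab: "?a < D" "?b < D" using srcA_lt[OF q] srcB_range[OF y q] by auto
      have "\<exists>t'<D. \<exists>q'<D. \<exists>w'<D. clit P x R L D 0 t q (pc ?s) ?u ?w t' q' w' (of_bool (A t' q' w'))"
        by (rule cl) (use q l Suc.prems in simp_all)
      then obtain t' q' w' where "clit P x R L D 0 t q (pc ?s) ?u ?w t' q' w' (of_bool (A t' q' w'))" by blast
      then have c: "(of_bool (A t' q' w') :: nat) = 0 \<and> t' = t \<and>
            (q' = 0 \<and> w' = pc ?s \<or> q' = ?a \<and> w' = ?u \<or> q' = ?b \<and> w' = ?w) \<or>
          (of_bool (A t' q' w') :: nat) = 1 \<and> t' = Suc t \<and> q' = q \<and> w' = res P (pc ?s) q ?u ?w"
        using Suc.prems by (simp add: clit_def)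
      have "A t 0 (pc ?s)" "A t ?a ?u" "A t ?b ?w" using IH[of 0] IH[OF ab(1)] IH[OF ab(2)] D4 pcc by simp_all
      then have "A (Suc t) q (res P (pc ?s) q ?u ?w)" using c by (cases "A t' q' w'") auto
      then show "A (Suc t) q (component R (state y (Suc t)) q)" using comp_step[OF regs, of ?s q] by simp
    qed
  qed
  have "A (D - 1) (1 + R) (of_bool (acc y))"
  proof -
    have "A (D - 1) (1 + R) (component R (state y (D - 1)) (1 + R))" using all[of "D - 1"] D4 by simp
    then show ?thesis using run_facts(2)[OF y] by (simp add: component_def)
  qed
  moreover have "\<not> A (D - 1) (1 + R) 0"
  proof -
    have "\<exists>t<D. \<exists>q'<D. \<exists>w<D. clit P x R L D 3 0 0 0 0 0 t q' w (of_bool (A t q' w))"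
      by (rule cl) (use D4 in simp_all)
    then obtain t q' w where "clit P x R L D 3 0 0 0 0 0 t q' w (of_bool (A t q' w))" by blast
    then have "(of_bool (A t q' w) :: nat) = 0 \<and> t = D - 1 \<and> q' = 1 + R \<and> w = 0" unfolding clit_def by auto
    then show ?thesis by (elim conjE) simp
  qed
  ultimately have "acc y" by (cases "acc y") auto
  then show ?thesis using y by blast
qed

text \<open>The assignment consists of exactly the values in the accepting run. A transition clause
  with a wrong guess is satisfied by a negative literal; with right guesses its sources lie in range
  and the next value is the one computed.\<close>

lemma sat_of_accepting:
  assumes y: "2 * length x + 1 + length y \<le> L" and acc: "acc y"
  shows "nsat (\<lambda>t q w. component R (state y t) q = w)"
  unfolding nsat_def
proof (intro allI impI)
  fix kd ct cq cl cu cw assume lt: "kd < D" "ct < D" "cq < D" "cl < D" "cu < D" "cw < D"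
  let ?A = "\<lambda>t q w. component R (state y t) q = w"
  let ?n = "2 * length x + 1"
  have D4: "4 \<le> D" "L < D" "R + 1 < D" using D LW by linarith+
  have lz: "length (self_delimiting x @ y) = ?n + length y" by (simp add: length_self_delimiting)
  have wit: "\<exists>t<D. \<exists>q<D. \<exists>w<D. clit P x R L D kd ct cq cl cu cw t q w (of_bool (?A t q w))"
    if "t < D" "q < D" "w < D" "clit P x R L D kd ct cq cl cu cw t q w (of_bool (?A t q w))" for t q w
    using that by blast
  consider "kd = 0" "ct + 1 < D" | "kd = 1" | "kd = 2" "1 + R + cl \<le> cq" | "kd = 3" "cw \<noteq> 1"
    | "\<And>t q w b. clit P x R L D kd ct cq cl cu cw t q w b"
  proof (cases "kd = 0 \<and> ct + 1 < D \<or> kd = 1 \<or> kd = 2 \<and> 1 + R + cl \<le> cq \<or> kd = 3 \<and> cw \<noteq> 1")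
    case False
    then have "clit P x R L D kd ct cq cl cu cw t q w b" for t q w b unfolding clit_def by presburger
    then show ?thesis using that by blast
  qed (use that in blast)
  then show "\<exists>t<D. \<exists>q<D. \<exists>w<D. clit P x R L D kd ct cq cl cu cw t q w (of_bool (?A t q w))"
  proof cases
    case 1
    let ?s = "state y ct"
    let ?a = "srcA P cl cq" let ?b = "srcB P R cl cq cu"
    have ct: "ct < D" "ct + 1 < D" "0 < D" using 1 by simp_all
    consider "pc ?s \<noteq> cl" | "component R ?s ?a \<noteq> cu" | "?b < D" "component R ?s ?b \<noteq> cw"
      | "pc ?s = cl" "component R ?s ?a = cu" "component R ?s ?b = cw"
      | "pc ?s = cl" "component R ?s ?a = cu" "D \<le> ?b" by linarith
    then show ?thesis
    proof cases
      case c1: 1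
      then have "component R ?s 0 \<noteq> cl" by (simp add: component_def)
      then show ?thesis by (intro wit[OF ct(1) ct(3) lt(4)]) (simp add: clit_def 1)
    next
      case c2: 2
      then show ?thesis by (intro wit[OF ct(1) srcA_lt[OF lt(3), of cl] lt(5)]) (simp add: clit_def 1)
    next
      case c3: 3
      then show ?thesis by (intro wit[OF ct(1) c3(1) lt(6)]) (simp add: clit_def 1)
    next
      case c4: 4
      have e: "component R (state y (ct + 1)) cq = res P cl cq cu cw"
        using comp_step[OF regs, of ?s cq] c4 by simp
      have "res P cl cq cu cw < D" using comp_lt[OF y, of "ct + 1" cq] e by simp
      then show ?thesis using e ct(2)
        by (intro wit[OF ct(2) lt(3)]) (simp_all add: clit_def 1 del: funpow.simps)
    next
      case c5: 5
      then show ?thesis using srcB_range[OF y lt(3), of ct] by simp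
    qed
  next
    case 2
    have "ini x R L cq (component R (state y 0) cq)"
    proof -
      consider "cq = 1" | "cq \<noteq> 1" "cq \<le> R" | "R < cq" "cq - 1 - R < ?n" | "R < cq" "?n \<le> cq - 1 - R" "cq - 1 - R < L"
        | "R < cq" "L \<le> cq - 1 - R" by linarith
      then show ?thesis
        using R1 y lz
        by cases (auto simp: ini_def component_def ram_init_def nth_append length_self_delimiting)
    qed
    then show ?thesis
      using comp_lt[OF y, of 0 cq] lt(3) D4 by (intro wit[of 0 cq "component R (state y 0) cq"]) (simp_all add: clit_def 2)
  next
    case 3
    show ?thesis
    proof (cases "cl = length (self_delimiting x @ y)")
      case True
      then have "component R (state y 0) cq = 0" using 3 by (auto simp: component_def ram_init_def)
      then show ?thesis using lt(3) D4 by (intro wit[of 0 cq 0]) (simp_all add: clit_def 3)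
    next
      case False
      then have "component R (state y 0) 1 \<noteq> cl" using R1 by (auto simp: component_def ram_init_def)
      then show ?thesis using lt(4) D4 by (intro wit[of 0 1 cl]) (simp_all add: clit_def 3)
    qed
  next
    case 4
    have "component R (state y (D - 1)) (1 + R) = 1" using run_facts(2)[OF y] acc by (simp add: component_def)
    then show ?thesis using 4 lt(6) D4 by (intro wit[of "D - 1" "1 + R" cw]) (simp_all add: clit_def)
  next
    case 5
    then show ?thesis using D4 by (intro wit[of 0 0 0]) simp_all
  qed
qed

section \<open>Numbering clauses and variables in base \<open>D\<close>\<close>

definition mlit :: "nat \<Rightarrow> nat \<Rightarrow> nat \<Rightarrow> bool" where
  "mlit c v b = clit P x R L D (c div D ^ 5) (c div D ^ 4 mod D) (c div D ^ 3 mod D) (c div D ^ 2 mod D)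
     (c div D mod D) (c mod D) (v div D ^ 2) (v div D mod D) (v mod D) b"

lemma digits6:
  assumes "a < D" "b < D" "c < D" "d < D" "e < D" "f < D"
  defines "n \<equiv> ((((a * D + b) * D + c) * D + d) * D + e) * D + f"
  shows "n < D ^ 6" "n div D ^ 5 = a" "n div D ^ 4 mod D = b" "n div D ^ 3 mod D = c" "n div D ^ 2 mod D = d"
    "n div D mod D = e" "n mod D = f"
proof -
  have step: "(m * D + r) div D = m" "(m * D + r) mod D = r" if "r < D" for m r
    using that by auto
  have p: "D ^ 2 = D * D" "D ^ 3 = D * D * D" "D ^ 4 = D * D * D * D" "D ^ 5 = D * D * D * D * D" "D ^ 6 = D * D * D * D * D * D"
    by (simp_all add: power_numeral_reduce mult.assoc)
  show *: "n div D ^ 5 = a" and "n div D ^ 4 mod D = b" "n div D ^ 3 mod D = c" "n div D ^ 2 mod D = d"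
    "n div D mod D = e" "n mod D = f"
    using assms(1-6) unfolding n_def p div_mult2_eq by (simp_all only: step)
  have "n div D ^ 5 < D" using * assms by simp
  then have "n < D * D ^ 5" using assms(1) by (simp add: div_less_iff_less_mult)
  then show "n < D ^ 6" by (simp add: p mult_ac)
qed

lemma digits3:
  assumes "a < D" "b < D" "c < D"
  defines "n \<equiv> (a * D + b) * D + c"
  shows "n < D ^ 3" "n div D ^ 2 = a" "n div D mod D = b" "n mod D = c"
proof -
  have step: "(m * D + r) div D = m" "(m * D + r) mod D = r" if "r < D" for m r
    using that by auto
  have p: "D ^ 2 = D * D" "D ^ 3 = D * D * D" by (simp_all add: power_numeral_reduce mult.assoc)
  show *: "n div D ^ 2 = a" and "n div D mod D = b" "n mod D = c"
    using assms(1-3) unfolding n_def p div_mult2_eq by (simp_all only: step)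
  have "n div D ^ 2 < D" using * assms by simp
  then have "n < D * D ^ 2" using assms(1) by (simp add: div_less_iff_less_mult)
  then show "n < D ^ 3" by (simp add: p mult_ac)
qed

lemma digit_bounds: "c < D ^ 6 \<Longrightarrow> c div D ^ 5 < D" "v < D ^ 3 \<Longrightarrow> v div D ^ 2 < D" "c mod D < D"
proof -
  have D0: "0 < D" using D by simp
  show "c < D ^ 6 \<Longrightarrow> c div D ^ 5 < D" using D0
    by (simp add: div_less_iff_less_mult power_numeral_reduce mult.assoc)
  show "v < D ^ 3 \<Longrightarrow> v div D ^ 2 < D" using D0
    by (simp add: div_less_iff_less_mult power_numeral_reduce mult.assoc)
  show "c mod D < D" using D0 by simp
qed

theorem cnf_sat_iff:
  "(\<exists>\<alpha>. \<forall>c<D ^ 6. \<exists>v<D ^ 3. mlit c v (of_bool (\<alpha> v))) \<longleftrightarrow> (\<exists>y. 2 * length x + 1 + length y \<le> L \<and> acc y)"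
proof
  assume "\<exists>\<alpha>. \<forall>c<D ^ 6. \<exists>v<D ^ 3. mlit c v (of_bool (\<alpha> v))"
  then obtain \<alpha> where \<alpha>: "\<And>c. c < D ^ 6 \<Longrightarrow> \<exists>v<D ^ 3. mlit c v (of_bool (\<alpha> v))" by blast
  have "nsat (\<lambda>t q w. \<alpha> ((t * D + q) * D + w))" unfolding nsat_def
  proof (intro allI impI)
    fix kd ct cq cl cu cw assume lt: "kd < D" "ct < D" "cq < D" "cl < D" "cu < D" "cw < D"
    note d6 = digits6[OF lt]
    obtain v where v: "v < D ^ 3" "mlit (((((kd * D + ct) * D + cq) * D + cl) * D + cu) * D + cw) v (of_bool (\<alpha> v))"
      using \<alpha>[OF d6(1)] by blast
    have e: "(v div D ^ 2 * D + v div D mod D) * D + v mod D = v"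
    proof -
      have "v div D ^ 2 = v div D div D" by (simp add: power2_eq_square div_mult2_eq)
      then show ?thesis by simp
    qed
    have "clit P x R L D kd ct cq cl cu cw (v div D ^ 2) (v div D mod D) (v mod D)
       (of_bool (\<alpha> ((v div D ^ 2 * D + v div D mod D) * D + v mod D)))"
      using v(2) unfolding mlit_def d6(2-7) e .
    then show "\<exists>t<D. \<exists>q<D. \<exists>w<D. clit P x R L D kd ct cq cl cu cw t q w (of_bool (\<alpha> ((t * D + q) * D + w)))"
      using digit_bounds(2)[OF v(1)] digit_bounds(3) by blast
  qed
  then show "\<exists>y. 2 * length x + 1 + length y \<le> L \<and> acc y" by (rule accepting_of_sat)
next
  assume "\<exists>y. 2 * length x + 1 + length y \<le> L \<and> acc y"
  then obtain y where y: "2 * length x + 1 + length y \<le> L" "acc y" by blast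
  let ?A = "\<lambda>t q w. component R (state y t) q = w"
  let ?\<alpha> = "\<lambda>v. ?A (v div D ^ 2) (v div D mod D) (v mod D)"
  have "\<exists>v<D ^ 3. mlit c v (of_bool (?\<alpha> v))" if c: "c < D ^ 6" for c
  proof -
    obtain t q w where w: "t < D" "q < D" "w < D" "clit P x R L D (c div D ^ 5) (c div D ^ 4 mod D) (c div D ^ 3 mod D) (c div D ^ 2 mod D)
     (c div D mod D) (c mod D) t q w (of_bool (?A t q w))"
      using sat_of_accepting[OF y, unfolded nsat_def, rule_format, OF digit_bounds(1)[OF c] digit_bounds(3) digit_bounds(3)
        digit_bounds(3) digit_bounds(3) digit_bounds(3)] by blast
    show ?thesis
      by (rule exI[of _ "(t * D + q) * D + w"]) (use digits3[OF w(1-3)] w(4) in \<open>simp add: mlit_def\<close>)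
  qed
  then show "\<exists>\<alpha>. \<forall>c<D ^ 6. \<exists>v<D ^ 3. mlit c v (of_bool (\<alpha> v))" by (intro exI[of _ ?\<alpha>] allI impI)
qed

end

section \<open>Programming in the language\<close>

abbreviation add :: "expr \<Rightarrow> expr \<Rightarrow> expr" (infixl "+\<^sub>e" 65) where "a +\<^sub>e b \<equiv> Bin Plus a b"
abbreviation sub :: "expr \<Rightarrow> expr \<Rightarrow> expr" (infixl "-\<^sub>e" 65) where "a -\<^sub>e b \<equiv> Bin Minus a b"
abbreviation mul :: "expr \<Rightarrow> expr \<Rightarrow> expr" (infixl "*\<^sub>e" 70) where "a *\<^sub>e b \<equiv> Bin Times a b"
abbreviation quo :: "expr \<Rightarrow> expr \<Rightarrow> expr" (infixl "div\<^sub>e" 70) where "a div\<^sub>e b \<equiv> Bin Div a b"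

text \<open>The connectives are arithmetic on 0 and 1, based on truncated subtraction. A conditional
  evaluates both branches, so no jumps are required in the language.\<close>

definition enot :: "expr \<Rightarrow> expr" where "enot a = Num 1 -\<^sub>e a"
definition eand :: "expr \<Rightarrow> expr \<Rightarrow> expr" (infixr "\<and>\<^sub>e" 35) where "eand a b = enot (enot (a *\<^sub>e b))"
definition eor :: "expr \<Rightarrow> expr \<Rightarrow> expr" (infixr "\<or>\<^sub>e" 30) where "eor a b = enot (enot (a +\<^sub>e b))"
definition eleq :: "expr \<Rightarrow> expr \<Rightarrow> expr" (infix "\<le>\<^sub>e" 50) where "a \<le>\<^sub>e b = enot (a -\<^sub>e b)"
definition elt :: "expr \<Rightarrow> expr \<Rightarrow> expr" (infix "<\<^sub>e" 50) where "a <\<^sub>e b = enot (Num 1 +\<^sub>e a -\<^sub>e b)"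
definition eeq :: "expr \<Rightarrow> expr \<Rightarrow> expr" (infix "=\<^sub>e" 50) where "a =\<^sub>e b = enot ((a -\<^sub>e b) +\<^sub>e (b -\<^sub>e a))"
definition eif :: "expr \<Rightarrow> expr \<Rightarrow> expr \<Rightarrow> expr" where
  "eif c a b = enot (enot c) *\<^sub>e a +\<^sub>e enot c *\<^sub>e b"
definition emod :: "expr \<Rightarrow> expr \<Rightarrow> expr" (infixl "mod\<^sub>e" 70) where "a mod\<^sub>e b = a -\<^sub>e (a div\<^sub>e b) *\<^sub>e b"

lemma eval_logic [simp]:
  "eval x s (enot a) = of_bool (eval x s a = 0)"
  "eval x s (a \<and>\<^sub>e b) = of_bool (eval x s a \<noteq> 0 \<and> eval x s b \<noteq> 0)"
  "eval x s (a \<or>\<^sub>e b) = of_bool (eval x s a \<noteq> 0 \<or> eval x s b \<noteq> 0)"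
  "eval x s (a \<le>\<^sub>e b) = of_bool (eval x s a \<le> eval x s b)"
  "eval x s (a <\<^sub>e b) = of_bool (eval x s a < eval x s b)"
  "eval x s (a =\<^sub>e b) = of_bool (eval x s a = eval x s b)"
  "eval x s (eif c a b) = (if eval x s c \<noteq> 0 then eval x s a else eval x s b)"
  "eval x s (a mod\<^sub>e b) = eval x s a mod eval x s b"
  by (auto simp: enot_def eand_def eor_def eleq_def elt_def eeq_def eif_def emod_def minus_div_mult_eq_mod)

lemma vvars_logic [simp]:
  "vvars (enot a) = {}" "vvars (a \<and>\<^sub>e b) = {}" "vvars (a \<or>\<^sub>e b) = {}" "vvars (a \<le>\<^sub>e b) = {}"
  "vvars (a <\<^sub>e b) = {}" "vvars (a =\<^sub>e b) = {}" "vvars (eif c a b) = vvars a \<union> vvars b" "vvars (a mod\<^sub>e b) = vvars a"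
  by (auto simp: enot_def eand_def eor_def eleq_def elt_def eeq_def eif_def emod_def)

lemma cvars_logic [simp]:
  "cvars (enot a) = cvars a" "cvars (a \<and>\<^sub>e b) = cvars a \<union> cvars b" "cvars (a \<or>\<^sub>e b) = cvars a \<union> cvars b"
  "cvars (a \<le>\<^sub>e b) = cvars a \<union> cvars b" "cvars (a <\<^sub>e b) = cvars a \<union> cvars b"
  "cvars (a =\<^sub>e b) = cvars a \<union> cvars b" "cvars (eif c a b) = cvars c \<union> cvars a \<union> cvars b"
  "cvars (a mod\<^sub>e b) = cvars a \<union> cvars b"
  by (auto simp: enot_def eand_def eor_def eleq_def elt_def eeq_def eif_def emod_def)

text \<open>The cap 1 turns a running sum into a disjunction.\<close>

definition eex :: "nat \<Rightarrow> expr \<Rightarrow> expr \<Rightarrow> expr" where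
  "eex k n b = Fold k n (Num 1) (Num 0) (Var (Suc k) +\<^sub>e b)"

definition ecount :: "nat \<Rightarrow> expr \<Rightarrow> expr \<Rightarrow> expr" where
  "ecount k n b = Fold k n n (Num 0) (Var (Suc k) +\<^sub>e b)"

lemma cvars_quant [simp]:
  "cvars (eex k n b) = vvars n \<union> cvars n \<union> (cvars b - {k, Suc k})"
  "cvars (ecount k n b) = vvars n \<union> cvars n \<union> (cvars b - {k, Suc k})"
  "vvars (eex k n b) = {}" "vvars (ecount k n b) = vvars n"
  by (auto simp: eex_def ecount_def)

lemma eval_eex:
  assumes "\<And>j v. j < eval x s n \<Longrightarrow> eval x (s(k := j, Suc k := v)) b = of_bool (Q j)"
  shows "eval x s (eex k n b) = of_bool (\<exists>j<eval x s n. Q j)"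
proof -
  have "iter x s k (Num 1) (Num 0) (Var (Suc k) +\<^sub>e b) m = of_bool (\<exists>j<m. Q j)" if "m \<le> eval x s n" for m
    using that
  proof (induction m)
    case (Suc m)
    then show ?case using assms[of m] by (auto simp: iter_Suc less_Suc_eq)
  qed (simp add: iter_0)
  then show ?thesis by (simp add: eex_def eval_Fold)
qed

lemma eval_ecount:
  assumes "\<And>j v. j < eval x s n \<Longrightarrow> eval x (s(k := j, Suc k := v)) b = of_bool (Q j)"
  shows "eval x s (ecount k n b) = card {j. j < eval x s n \<and> Q j}"
proof -
  have "iter x s k n (Num 0) (Var (Suc k) +\<^sub>e b) m = card {j. j < m \<and> Q j}" if "m \<le> eval x s n" for m
    using that
  proof (induction m)
    case (Suc m)
    have "{j. j < Suc m \<and> Q j} = {j. j < m \<and> Q j} \<union> (if Q m then {m} else {})" by (auto simp: less_Suc_eq)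
    then have c: "card {j. j < Suc m \<and> Q j} = card {j. j < m \<and> Q j} + of_bool (Q m)"
      by (simp add: card_insert_if)
    have "card {j. j < Suc m \<and> Q j} \<le> card {..<Suc m}" by (intro card_mono) auto
    then have "card {j. j < Suc m \<and> Q j} \<le> eval x s n" using Suc.prems by simp
    then show ?case using Suc assms[of m] c by (simp add: iter_Suc)
  qed (simp add: iter_0)
  then show ?thesis by (simp add: ecount_def eval_Fold)
qed


subsection \<open>Parsing numbers\<close>

lemma binary_length_iff: "j < length (binary a) \<longleftrightarrow> 2 ^ j \<le> a"
proof (induction a arbitrary: j rule: less_induct)
  case (less a)
  show ?case
  proof (cases "a = 0")
    case True
    then show ?thesis by (simp add: binary.simps[of 0])
  next
    case False
    have b: "binary a = odd a # binary (a div 2)" using False by (subst binary.simps) simp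
    show ?thesis
    proof (cases j)
      case (Suc i)
      have "i < length (binary (a div 2)) \<longleftrightarrow> 2 ^ i \<le> a div 2" using less[of "a div 2" i] False by simp
      then show ?thesis using Suc b by (simp add: less_eq_div_iff_mult_less_eq mult.commute)
    qed (use False b in auto)
  qed
qed

lemma binary_nth: "j < length (binary a) \<Longrightarrow> binary a ! j \<longleftrightarrow> odd (a div 2 ^ j)"
proof (induction a arbitrary: j rule: less_induct)
  case (less a)
  have "a \<noteq> 0"
  proof
    assume "a = 0"
    moreover have "binary 0 = []" by (simp add: binary.simps)
    ultimately show False using less.prems by simp
  qed
  then have b: "binary a = odd a # binary (a div 2)" by (subst binary.simps) simp
  show ?case
  proof (cases j)
    case (Suc i)
    then show ?thesis using less.IH[of "a div 2" i] less.prems b \<open>a \<noteq> 0\<close> by (simp add: div_mult2_eq)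
  qed (use b in auto)
qed

lemma length_binary_le: "length (binary a) \<le> a"
proof (cases "length (binary a)")
  case (Suc l)
  then have "2 ^ l \<le> a" using binary_length_iff[of l a] by simp
  moreover have "l < 2 ^ l" by (rule less_exp)
  ultimately show ?thesis using Suc by linarith
qed simp

lemma less_power_length_binary: "a < 2 ^ length (binary a)"
  using binary_length_iff[of "length (binary a)" a] by simp

lemma self_delimiting_nth:
  "j < length b \<Longrightarrow> self_delimiting b ! (2 * j) = True"
  "j < length b \<Longrightarrow> self_delimiting b ! (2 * j + 1) = b ! j"
  "self_delimiting b ! (2 * length b) = False"
proof (induction b arbitrary: j)
  case (Cons a b)
  { case 1 then show ?case using Cons.IH(1)[of "j - 1"] by (cases j) (auto simp: self_delimiting_def) }
  { case 2 then show ?case using Cons.IH(2)[of "j - 1"] by (cases j) (auto simp: self_delimiting_def) }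
  { case 3 then show ?case using Cons.IH(3) by (simp add: self_delimiting_def) }
qed (auto simp: self_delimiting_def)

lemma length_enc_nat: "length (enc_nat a) = 2 * length (binary a) + 1"
  by (simp add: enc_nat_def length_self_delimiting)

definition code_pos :: "bool list \<Rightarrow> nat \<Rightarrow> nat \<Rightarrow> bool" where
  "code_pos x p a \<longleftrightarrow> (\<exists>u v. x = u @ enc_nat a @ v \<and> length u = p)"

lemma code_posD:
  assumes "code_pos x p a"
  shows "j < length (binary a) \<Longrightarrow> p + 2 * j + 1 < length x \<and> x ! (p + 2 * j) \<and> (x ! (p + 2 * j + 1) \<longleftrightarrow> odd (a div 2 ^ j))"
    "p + 2 * length (binary a) < length x \<and> \<not> x ! (p + 2 * length (binary a))"
proof -
  obtain u v where x: "x = u @ enc_nat a @ v" "length u = p" using assms by (auto simp: code_pos_def)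
  have n: "x ! (p + i) = enc_nat a ! i" if "i < length (enc_nat a)" for i
    using that x by (simp add: nth_append)
  show "j < length (binary a) \<Longrightarrow> p + 2 * j + 1 < length x \<and> x ! (p + 2 * j) \<and> (x ! (p + 2 * j + 1) \<longleftrightarrow> odd (a div 2 ^ j))"
    using n[of "2 * j"] n[of "2 * j + 1"] x self_delimiting_nth(1,2)[of j "binary a"]
    by (simp add: length_enc_nat binary_nth enc_nat_def length_self_delimiting)
  show "p + 2 * length (binary a) < length x \<and> \<not> x ! (p + 2 * length (binary a))"
    using n[of "2 * length (binary a)"] x self_delimiting_nth(3)[of "binary a"]
    by (simp add: length_enc_nat enc_nat_def length_self_delimiting)
qed

text \<open>The accumulator equals the counter as long as the marker bits are \<open>True\<close>;
  at the first \<open>False\<close> it falls behind and never moves again. Hence any upper bound on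
  the length will do as the number of rounds.\<close>

definition elen :: "nat \<Rightarrow> expr \<Rightarrow> expr \<Rightarrow> expr" where
  "elen k p n = Fold k n n (Num 0) (Var (Suc k) +\<^sub>e (Var (Suc k) =\<^sub>e Var k \<and>\<^sub>e Inp (p +\<^sub>e Num 2 *\<^sub>e Var k)))"

lemma eval_elen:
  assumes p: "\<And>j v. eval x (s(k := j, Suc k := v)) p = q" and c: "code_pos x q a"
    and n: "length (binary a) \<le> eval x s n"
  shows "eval x s (elen k p n) = length (binary a)"
proof -
  let ?L = "length (binary a)"
  let ?b = "Var (Suc k) +\<^sub>e (Var (Suc k) =\<^sub>e Var k \<and>\<^sub>e Inp (p +\<^sub>e Num 2 *\<^sub>e Var k))"
  have "iter x s k n (Num 0) ?b m = min m ?L" for m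
  proof (induction m)
    case (Suc m)
    consider "m < ?L" | "m = ?L" | "?L < m" by linarith
    then show ?case
    proof cases
      case 1
      then show ?thesis using Suc n code_posD(1)[OF c 1] by (simp add: iter_Suc p)
    next
      case 2
      then show ?thesis using Suc n code_posD(2)[OF c] by (simp add: iter_Suc p)
    next
      case 3
      then show ?thesis using Suc n by (simp add: iter_Suc p)
    qed
  qed (simp add: iter_0)
  then show ?thesis using n by (simp add: elen_def eval_Fold)
qed

text \<open>The least significant bit comes first in the code, so Horner's scheme reads it from the
  end; after \<open>m\<close> rounds the accumulator is \<open>a\<close> without its
  \<open>length (binary a) - m\<close> lowest bits.\<close>

definition enum :: "nat \<Rightarrow> expr \<Rightarrow> expr \<Rightarrow> expr \<Rightarrow> expr" where
  "enum k p l c = Fold k l c (Num 0) (Num 2 *\<^sub>e Var (Suc k) +\<^sub>e Inp (p +\<^sub>e Num 2 *\<^sub>e (l -\<^sub>e Num 1 -\<^sub>e Var k) +\<^sub>e Num 1))"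

lemma eval_enum:
  assumes p: "\<And>j v. eval x (s(k := j, Suc k := v)) p = q" and c: "code_pos x q a"
    and l: "\<And>j v. eval x (s(k := j, Suc k := v)) l = length (binary a)" "eval x s l = length (binary a)"
    and n: "a \<le> eval x s n"
  shows "eval x s (enum k p l n) = a"
proof -
  let ?L = "length (binary a)"
  let ?b = "Num 2 *\<^sub>e Var (Suc k) +\<^sub>e Inp (p +\<^sub>e Num 2 *\<^sub>e (l -\<^sub>e Num 1 -\<^sub>e Var k) +\<^sub>e Num 1)"
  have "iter x s k n (Num 0) ?b m = a div 2 ^ (?L - m)" if "m \<le> ?L" for m
    using that
  proof (induction m)
    case 0
    then show ?case using less_power_length_binary[of a] by (simp add: iter_0)
  next
    case (Suc m)
    define e where "e = ?L - Suc m"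
    have e: "?L - m = Suc e" "e < ?L" "?L - Suc 0 - m = e" using Suc.prems by (auto simp: e_def)
    have "eval x (s(k := m, Suc k := a div 2 ^ Suc e)) ?b = 2 * (a div 2 ^ Suc e) + of_bool (odd (a div 2 ^ e))"
      using code_posD(1)[OF c e(2)] e(3) by (simp add: p l)
    also have "\<dots> = a div 2 ^ e"
    proof -
      have "a div 2 ^ Suc e = (a div 2 ^ e) div 2" by (metis div_mult2_eq power_Suc2)
      then show ?thesis by (simp add: odd_two_times_div_two_succ del: power_Suc)
    qed
    finally have "eval x (s(k := m, Suc k := a div 2 ^ Suc e)) ?b = a div 2 ^ e" .
    moreover have "a div 2 ^ e \<le> eval x s n" using n div_le_dividend le_trans by blast
    ultimately show ?case using Suc e by (simp add: iter_Suc e_def[symmetric] del: eval.simps)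
  qed
  then show ?thesis using n l(2) by (simp add: enum_def eval_Fold)
qed

section \<open>Computing best red responses\<close>

text \<open>Variables: 1 is the number of targets, 3 the number of sensors, 5 and 6 are the positions of
  the matrix and of the ordering in the input, 7 and 8 are the lengths of the codes of the first two.\<close>

definition eM :: "nat \<Rightarrow> nat \<Rightarrow> expr" where "eM a b = Inp (Var 5 +\<^sub>e Var a *\<^sub>e Var 3 +\<^sub>e Var b)"
text \<open>The input length occurs only as a cap, so it does not enter the running time: the
  numbers of rounds depend on the index and the number of targets.\<close>

definition epos :: "nat \<Rightarrow> expr" where
  "epos a = Fold 50 (Var a) (Var 0) (Var 6) (Var 51 +\<^sub>e Num 2 *\<^sub>e elen 52 (Var 51) (Var 1) +\<^sub>e Num 1)"
definition esig :: "nat \<Rightarrow> expr" where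
  "esig a = enum 54 (epos a) (elen 52 (epos a) (Var 1)) (Var 1)"
definition enear :: "nat \<Rightarrow> nat \<Rightarrow> expr" where
  "enear a b = (esig a \<le>\<^sub>e esig b +\<^sub>e Num 3 \<and>\<^sub>e esig b \<le>\<^sub>e esig a +\<^sub>e Num 3)"
definition efar :: "nat \<Rightarrow> nat \<Rightarrow> expr" where "efar a b = (eM a b \<and>\<^sub>e enot (enear a b))"
definition ecf :: "nat \<Rightarrow> expr" where "ecf a = ecount 30 (Var 1) (efar a 30)"
definition eblocked :: "nat \<Rightarrow> nat \<Rightarrow> expr" where
  "eblocked a b = eex 32 (Var 1) (enot (Var 32 =\<^sub>e Var a) \<and>\<^sub>e enear a 32 \<and>\<^sub>e ecf 32 \<le>\<^sub>e Num 3 \<and>\<^sub>e efar 32 b)"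
definition egood :: "nat \<Rightarrow> nat \<Rightarrow> expr" where "egood a b = (efar a b \<and>\<^sub>e enot (eblocked a b))"
definition epick :: "nat \<Rightarrow> nat \<Rightarrow> expr" where
  "epick a b = eif (eex 34 (Var 1) (egood a 34))
     (egood a b \<and>\<^sub>e enot (eex 36 (Var b) (egood a 36))) (efar a b \<and>\<^sub>e enot (eex 36 (Var b) (efar a 36)))"
text \<open>The program knows neither \<open>g\<close> nor \<open>p\<close>. In the row of a guard
  only the diagonal entry is set; in the row of a light it is not, and the picked sensor can sense
  the light. So one formula treats both kinds of targets.\<close>

definition eplan :: expr where
  "eplan = (eM 10 11 \<and>\<^sub>e (Var 10 =\<^sub>e Var 11 \<or>\<^sub>e epick 10 11))"
text \<open>Beyond two bits per binary digit, the code of a value has a sign bit, an end marker and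
  four bits for the denominator 1, six in total. The length of a numerator is at most the square of
  the number of targets, which keeps the rounds independent of the number of sensors.\<close>

definition eskip :: expr where
  "eskip = Fold 24 (Var 1) (Var 0) (Var 4) (Var 25 +\<^sub>e Num 2 *\<^sub>e elen 26 (Var 25 +\<^sub>e Num 1) (Var 1 *\<^sub>e Var 1) +\<^sub>e Num 6)"

text \<open>Only the leading square of the output matrix requires computation; the remainder of each
  row belongs to idle sensors and is constant.\<close>

definition brr_body :: stmt where
  "brr_body = For 10 (Var 1) (Seq (For 11 (Var 1) (Emit eplan)) (For 11 (Var 3 -\<^sub>e Var 1) (Emit (Num 0))))"

text \<open>The 7 consists of the end marker of the second number and the six bits of the recharging
  time.\<close>

definition brr_prog :: stmt where
  "brr_prog = LetIn 7 (elen 20 (Num 0) (Var 0)) (LetIn 1 (enum 20 (Num 0) (Var 7) (Var 0))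
     (LetIn 2 (Num 2 *\<^sub>e Var 7 +\<^sub>e Num 1) (LetIn 8 (elen 20 (Var 2) (Var 0)) (LetIn 3 (enum 20 (Var 2) (Var 8) (Var 0))
     (LetIn 4 (Var 2 +\<^sub>e Num 2 *\<^sub>e Var 8 +\<^sub>e Num 7) (LetIn 5 eskip (LetIn 6 (Var 5 +\<^sub>e Var 1 *\<^sub>e Var 3) brr_body)))))))"

lemma concat_split:
  assumes "x = u @ concat (map f [0..<n]) @ v" "i < n"
  shows "\<exists>u' v'. x = u' @ f i @ v' \<and> length u' = length u + (\<Sum>j<i. length (f j))"
proof -
  have "[0..<n] = [0..<i] @ i # [Suc i..<n]" using assms(2) by (metis le_add2 le_add_same_cancel2 less_imp_le upt_add_eq_append upt_conv_Cons le_Suc_ex add.left_neutral)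
  then have "x = (u @ concat (map f [0..<i])) @ f i @ (concat (map f [Suc i..<n]) @ v)" using assms(1) by simp
  moreover have "length (concat (map f [0..<i])) = (\<Sum>j<i. length (f j))"
    by (simp add: length_concat comp_def interv_sum_list_conv_sum_set_nat atLeast0LessThan)
  ultimately show ?thesis by (intro exI[of _ "u @ concat (map f [0..<i])"] exI[of _ "concat (map f [Suc i..<n]) @ v"]) simp
qed

lemma length_enc_matrix: "length (enc_matrix n k M) = n * k"
  by (simp add: enc_matrix_def length_concat comp_def interv_sum_list_conv_sum_set_nat)

lemma enc_matrix_nth: "i < n \<Longrightarrow> j < k \<Longrightarrow> enc_matrix n k M ! (i * k + j) = M i j"
proof -
  assume i: "i < n" and j: "j < k"
  obtain u v where "enc_matrix n k M = u @ map (M i) [0..<k] @ v" "length u = (\<Sum>j<i. length (map (M j) [0..<k]))"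
    using concat_split[of "enc_matrix n k M" "[]" "\<lambda>i. map (M i) [0..<k]" n "[]" i] i by (auto simp: enc_matrix_def)
  then show ?thesis using j by (simp add: nth_append)
qed

lemma binary_small: "binary 0 = []" "binary (Suc 0) = [True]" "binary 3 = [True, True]"
proof -
  show 0: "binary 0 = []" by (subst binary.simps) simp
  show 1: "binary (Suc 0) = [True]" by (subst binary.simps) (simp add: 0)
  show "binary 3 = [True, True]" by (subst binary.simps) (simp add: 1)
qed

lemma enc_rat_of_nat: "enc_rat (of_nat w) = False # enc_nat w @ [False, True, True, False]"
proof -
  have "quotient_of (of_nat w) = (int w, 1)" using quotient_of_int[of "int w"] by (simp add: Rat.of_int_def)
  moreover have "enc_nat 1 = [True, True, False]"
    by (simp add: enc_nat_def self_delimiting_def binary_small)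
  ultimately show ?thesis by (simp add: enc_rat_def enc_int_def)
qed

section \<open>Correctness of the red player's program\<close>

locale brr_input = ordered_game +
  fixes w :: "nat \<Rightarrow> nat"
  assumes n1: "1 \<le> targets G" and w: "\<And>i. i < targets G \<Longrightarrow> target_value G i = of_nat (w i) \<and> w i \<le> targets G * targets G"
begin

abbreviation n :: nat where "n \<equiv> targets G"
abbreviation k :: nat where "k \<equiv> sensors G"
definition x :: "bool list" where "x = enc_esg G @ enc_ordering G \<sigma>"
definition vals :: "bool list" where "vals = concat (map (\<lambda>i. enc_rat (target_value G i)) [0..<n])"
definition p4 :: nat where "p4 = length (enc_nat n) + length (enc_nat k) + 6"
definition pm :: nat where "pm = p4 + length vals"
definition ps :: nat where "ps = pm + n * k"

lemma x_eq: "x = enc_nat n @ enc_nat k @ (True # enc_nat 3) @ vals @ enc_matrix n k (can_sense G) @ enc_ordering G \<sigma>"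
proof -
  have "enc_enat (recharge G) = True # enc_nat 3" by (simp add: recharge_3 enc_enat_def numeral_eq_enat)
  then show ?thesis by (simp add: x_def enc_esg_def vals_def)
qed

lemma len3: "length (enc_nat 3) = 5"
  by (simp add: length_enc_nat binary_small)

lemma lenx: "length x = ps + length (enc_ordering G \<sigma>)"
  by (simp add: x_eq ps_def pm_def p4_def length_enc_matrix len3)

lemma matrix_bit:
  assumes "i < n" "j < k" shows "pm + i * k + j < length x" "x ! (pm + i * k + j) = can_sense G i j"
proof -
  have "i * k + j < n * k" using assms mult_le_mono1[of "Suc i" n k] by simp
  then show "pm + i * k + j < length x" by (simp add: lenx ps_def)
  let ?u = "enc_nat n @ enc_nat k @ (True # enc_nat 3) @ vals"
  have "x = ?u @ enc_matrix n k (can_sense G) @ enc_ordering G \<sigma>" by (simp add: x_eq)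
  moreover have "length ?u = pm" by (simp add: pm_def p4_def len3)
  ultimately have "x ! (pm + (i * k + j)) = (enc_matrix n k (can_sense G) @ enc_ordering G \<sigma>) ! (i * k + j)"
    by (metis nth_append_length_plus)
  then show "x ! (pm + i * k + j) = can_sense G i j"
    using \<open>i * k + j < n * k\<close> enc_matrix_nth[OF assms] by (simp add: nth_append length_enc_matrix add.assoc)
qed

definition pos :: "nat \<Rightarrow> nat" where "pos a = ps + (\<Sum>b<a. 2 * length (binary (\<sigma> b)) + 1)"

lemma pos_code: "a < n \<Longrightarrow> code_pos x (pos a) (\<sigma> a)"
proof -
  assume a: "a < n"
  let ?u = "enc_nat n @ enc_nat k @ (True # enc_nat 3) @ vals @ enc_matrix n k (can_sense G)"
  have "x = ?u @ concat (map (\<lambda>i. enc_nat (\<sigma> i)) [0..<n]) @ []" by (simp add: x_eq enc_ordering_def)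
  from concat_split[OF this a]
  obtain u' v' where u': "x = u' @ enc_nat (\<sigma> a) @ v'" "length u' = length ?u + (\<Sum>j<a. length (enc_nat (\<sigma> j)))" by blast
  have "length ?u = ps" by (simp add: ps_def pm_def p4_def len3 length_enc_matrix)
  then have "length u' = pos a" using u'(2) by (simp add: pos_def length_enc_nat)
  then show ?thesis using u'(1) by (auto simp: code_pos_def)
qed

lemma sigma_le: "a < n \<Longrightarrow> \<sigma> a \<le> n"
  using ordering by (auto simp: target_ordering_def bij_betw_def)

lemma binary_sigma_le: "a < n \<Longrightarrow> length (binary (\<sigma> a)) \<le> n"
  using sigma_le length_binary_le le_trans by blast

lemma code_pos_lt: "code_pos x q a \<Longrightarrow> q < length x"
  by (auto simp: code_pos_def length_enc_nat)

definition benv :: "env \<Rightarrow> bool" where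
  "benv s \<longleftrightarrow> s 0 = length x \<and> s 1 = n \<and> s 3 = k \<and> s 5 = pm \<and> s 6 = ps"

text \<open>Variables bound by loops in the formulas for the response have numbers from 10 on, so
  entering a loop preserves the parsed header.\<close>

lemma benv_upd: "10 \<le> v \<Longrightarrow> benv (s(v := c)) \<longleftrightarrow> benv s"
  by (auto simp: benv_def)

lemma benv_simps:
  assumes "benv s" shows "s 0 = length x" "s 1 = n" "s (Suc 0) = n" "s 3 = k" "s 5 = pm" "s 6 = ps"
  using assms by (auto simp: benv_def)

lemma eval_epos:
  assumes "benv s" "s a < n" shows "eval x s (epos a) = pos (s a)"
proof -
  let ?b = "Var 51 +\<^sub>e Num 2 *\<^sub>e elen 52 (Var 51) (Var 1) +\<^sub>e Num 1"
  have "iter x s 50 (Var 0) (Var 6) ?b m = pos m" if "m \<le> s a" for m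
    using that
  proof (induction m)
    case 0
    have "ps \<le> length x" by (simp add: lenx)
    then show ?case using assms by (simp add: iter_0 benv_simps pos_def)
  next
    case (Suc m)
    then have m: "m < n" "Suc m < n" using assms by auto
    have "eval x (s(50 := m, Suc 50 := pos m)) (elen 52 (Var 51) (Var 1)) = length (binary (\<sigma> m))"
      by (rule eval_elen[OF _ pos_code[OF m(1)]]) (use assms binary_sigma_le[OF m(1)] in \<open>auto simp: benv_simps\<close>)
    then have "eval x (s(50 := m, Suc 50 := pos m)) ?b = pos (Suc m)" by (simp add: pos_def)
    moreover have "pos (Suc m) \<le> length x" using code_pos_lt[OF pos_code[OF m(2)]] by simp
    ultimately show ?case using Suc assms by (simp add: iter_Suc benv_simps del: eval.simps(3))
  qed
  then show ?thesis by (simp add: epos_def eval_Fold)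
qed

lemma eval_esig:
  assumes s: "benv s" and a: "a < 50" "s a < n" shows "eval x s (esig a) = \<sigma> (s a)"
proof -
  have pos: "eval x (s(v := c, Suc v := d)) (epos a) = pos (s a)" if "50 \<le> v" for v c d
    using eval_epos[of "s(v := c, Suc v := d)" a] s a that by (simp add: benv_upd)
  have len: "eval x t (elen 52 (epos a) (Var 1)) = length (binary (\<sigma> (s a)))"
    if "benv t" "t a = s a" for t
  proof (rule eval_elen[OF _ pos_code[OF a(2)]])
    show "eval x (t(52 := j, Suc 52 := v)) (epos a) = pos (s a)" for j v
      using eval_epos[of "t(52 := j, Suc 52 := v)" a] that a by (simp add: benv_upd)
    show "length (binary (\<sigma> (s a))) \<le> eval x t (Var 1)"
      using binary_sigma_le[OF a(2)] that by (simp add: benv_simps)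
  qed
  show ?thesis unfolding esig_def
  proof (rule eval_enum[OF _ pos_code[OF a(2)]])
    show "eval x (s(54 := j, Suc 54 := v)) (epos a) = pos (s a)" for j v by (rule pos) simp
    show "eval x (s(54 := j, Suc 54 := v)) (elen 52 (epos a) (Var 1)) = length (binary (\<sigma> (s a)))" for j v
      using s a by (intro len) (simp_all add: benv_upd)
    show "eval x s (elen 52 (epos a) (Var 1)) = length (binary (\<sigma> (s a)))" using s by (intro len) simp_all
    show "\<sigma> (s a) \<le> eval x s (Var 1)" using s sigma_le[OF a(2)] by (simp add: benv_simps)
  qed
qed

lemma eval_enear:
  assumes "benv s" "a < 50" "s a < n" "b < 50" "s b < n"
  shows "eval x s (enear a b) = of_bool (near (s a) (s b))"
  using eval_esig[OF assms(1-3)] eval_esig[OF assms(1,4,5)] by (simp add: enear_def near_def)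

lemma eval_efar:
  assumes "benv s" "a < 50" "s a < n" "b < 50" "s b < n"
  shows "eval x s (efar a b) = of_bool (s b \<in> far (s a))"
proof -
  have b: "s b < k" using assms(5) targets_le by simp
  have "eval x s (eM a b) = of_bool (can_sense G (s a) (s b))"
    using matrix_bit[OF assms(3) b] assms(1) by (simp add: eM_def benv_simps)
  then show ?thesis using eval_enear[OF assms] b by (simp add: efar_def far_def own_def)
qed

lemma far_lt: "e < n \<Longrightarrow> j \<in> far e \<Longrightarrow> j < n"
  using own_lt[of e j] far_guard[of e] by (cases "e < g") (auto simp: far_def)

text \<open>The condition on \<open>a\<close> excludes capture, as the counting loop binds 30 and
  31. The conditions in the following lemmas serve the same purpose.\<close>

lemma eval_ecf:
  assumes "benv s" "a < 30 \<or> 32 \<le> a" "a < 50" "s a < n"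
  shows "eval x s (ecf a) = card (far (s a))"
proof -
  have "eval x s (ecf a) = card {j. j < eval x s (Var 1) \<and> j \<in> far (s a)}"
    unfolding ecf_def
  proof (rule eval_ecount)
    fix j v assume "j < eval x s (Var 1)"
    then have j: "j < n" using assms by (simp add: benv_simps)
    have ne: "a \<noteq> 30" "a \<noteq> 31" using assms(2) by auto
    show "eval x (s(30 := j, Suc 30 := v)) (efar a 30) = of_bool (j \<in> far (s a))"
      using assms j ne by (subst eval_efar) (simp_all add: benv_upd)
  qed
  also have "{j. j < eval x s (Var 1) \<and> j \<in> far (s a)} = far (s a)"
    using far_lt[OF assms(4)] assms(1) by (auto simp: benv_simps)
  finally show ?thesis .
qed

lemma eval_eblocked:
  assumes "benv s" "a < 30 \<or> 34 \<le> a" "a < 50" "s a < n" "b < 30 \<or> 34 \<le> b" "b < 50" "s b < n"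
  shows "eval x s (eblocked a b) = of_bool (blocked (s a) (s b))"
proof -
  have "eval x s (eblocked a b) = of_bool (\<exists>f<eval x s (Var 1). f \<noteq> s a \<and> near (s a) f \<and> card (far f) \<le> 3 \<and> s b \<in> far f)"
    unfolding eblocked_def
  proof (rule eval_eex)
    fix f v assume "f < eval x s (Var 1)"
    then have f: "f < n" using assms by (simp add: benv_simps)
    have ne: "a \<noteq> 32" "a \<noteq> 33" "b \<noteq> 32" "b \<noteq> 33" using assms(2,5) by auto
    let ?s = "s(32 := f, Suc 32 := v)"
    have b: "benv ?s" using assms(1) by (simp add: benv_upd)
    have "eval x ?s (enear a 32) = of_bool (near (s a) f)"
      using eval_enear[OF b, of a 32] assms f ne by simp
    moreover have "eval x ?s (ecf 32) = card (far f)"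
      using eval_ecf[OF b, of 32] f by simp
    moreover have "eval x ?s (efar 32 b) = of_bool (s b \<in> far f)"
      using eval_efar[OF b, of 32 b] assms f ne by simp
    ultimately show "eval x ?s (enot (Var 32 =\<^sub>e Var a) \<and>\<^sub>e enear a 32 \<and>\<^sub>e ecf 32 \<le>\<^sub>e Num 3 \<and>\<^sub>e efar 32 b) =
      of_bool (f \<noteq> s a \<and> near (s a) f \<and> card (far f) \<le> 3 \<and> s b \<in> far f)" using ne by simp
  qed
  then show ?thesis using assms(1) by (simp add: blocked_def benv_simps)
qed

lemma eval_egood:
  assumes "benv s" "a < 30 \<or> 34 \<le> a" "a < 50" "s a < n" "b < 30 \<or> 34 \<le> b" "b < 50" "s b < n"
  shows "eval x s (egood a b) = of_bool (s b \<in> good (s a))"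
  using eval_eblocked[OF assms] eval_efar[OF assms(1,3,4,6,7)] by (simp add: egood_def good_def)

text \<open>Allows the program to test for each sensor whether it is the least one, instead of
  computing the minimum.\<close>

lemma least_iff: "(b :: nat) \<in> X \<and> \<not> (\<exists>j<b. j \<in> X) \<longleftrightarrow> X \<noteq> {} \<and> (LEAST j. j \<in> X) = b"
proof
  assume "X \<noteq> {} \<and> (LEAST j. j \<in> X) = b"
  then have b: "X \<noteq> {}" "b = (LEAST j. j \<in> X)" by simp_all
  then have "b \<in> X" using LeastI_ex[of "\<lambda>j. j \<in> X"] by blast
  moreover have "j \<notin> X" if "j < b" for j using not_less_Least[of j "\<lambda>j. j \<in> X"] that b(2) by blast
  ultimately show "b \<in> X \<and> \<not> (\<exists>j<b. j \<in> X)" by blast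
next
  assume b: "b \<in> X \<and> \<not> (\<exists>j<b. j \<in> X)"
  have "(LEAST j. j \<in> X) = b"
  proof (rule Least_equality)
    show "b \<in> X" using b by blast
    show "b \<le> y" if "y \<in> X" for y using b that not_less by blast
  qed
  then show "X \<noteq> {} \<and> (LEAST j. j \<in> X) = b" using b by blast
qed

lemma eval_epick:
  assumes s: "benv s" and a: "a < 30" "s a < n" and b: "b < 30" "s b < n"
  shows "eval x s (epick a b) = of_bool (far (s a) \<noteq> {} \<and> pick (s a) = s b)"
proof -
  have any: "eval x s (eex 34 (Var 1) (egood a 34)) = of_bool (\<exists>j<eval x s (Var 1). j \<in> good (s a))"
  proof (rule eval_eex)
    fix j v assume "j < eval x s (Var 1)"
    then show "eval x (s(34 := j, Suc 34 := v)) (egood a 34) = of_bool (j \<in> good (s a))"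
      using eval_egood[of "s(34 := j, Suc 34 := v)" a 34] s a by (simp add: benv_upd benv_simps)
  qed
  have gl: "j < n" if "j \<in> good (s a)" for j using that far_lt[OF a(2)] by (simp add: good_def)
  have any': "eval x s (eex 34 (Var 1) (egood a 34)) = of_bool (good (s a) \<noteq> {})"
    unfolding any using s gl by (auto simp: benv_simps)
  have lg: "eval x s (eex 36 (Var b) (egood a 36)) = of_bool (\<exists>j<eval x s (Var b). j \<in> good (s a))"
  proof (rule eval_eex)
    fix j v assume "j < eval x s (Var b)"
    then show "eval x (s(36 := j, Suc 36 := v)) (egood a 36) = of_bool (j \<in> good (s a))"
      using eval_egood[of "s(36 := j, Suc 36 := v)" a 36] s a b by (simp add: benv_upd)
  qed
  have lf: "eval x s (eex 36 (Var b) (efar a 36)) = of_bool (\<exists>j<eval x s (Var b). j \<in> far (s a))"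
  proof (rule eval_eex)
    fix j v assume "j < eval x s (Var b)"
    then show "eval x (s(36 := j, Suc 36 := v)) (efar a 36) = of_bool (j \<in> far (s a))"
      using eval_efar[of "s(36 := j, Suc 36 := v)" a 36] s a b by (simp add: benv_upd)
  qed
  have g: "eval x s (egood a b) = of_bool (s b \<in> good (s a))" using eval_egood[OF s, of a b] a b by simp
  have f: "eval x s (efar a b) = of_bool (s b \<in> far (s a))" using eval_efar[OF s, of a b] a b by simp
  have ne: "far (s a) \<noteq> {}" if "good (s a) \<noteq> {}" using that by (auto simp: good_def)
  show ?thesis
  proof (cases "good (s a) = {}")
    case True
    then show ?thesis using least_iff[of "s b" "far (s a)"]
      by (simp add: epick_def any'[unfolded One_nat_def] lf f pick_def)
  next
    case False
    then show ?thesis using least_iff[of "s b" "good (s a)"] ne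
      by (simp add: epick_def any'[unfolded One_nat_def] lg g pick_def)
  qed
qed

lemma eval_eplan:
  assumes s: "benv s" and i: "s 10 < n" and j: "s 11 < n"
  shows "eval x s eplan = of_bool (s 10 \<in> plan (s 11))"
proof -
  have jk: "s 11 < k" using j targets_le by simp
  have M: "eval x s (eM 10 11) = of_bool (can_sense G (s 10) (s 11))"
    using matrix_bit[OF i jk] s by (simp add: eM_def benv_simps)
  have "can_sense G (s 10) (s 11) \<and> (s 10 = s 11 \<or> far (s 10) \<noteq> {} \<and> pick (s 10) = s 11) \<longleftrightarrow> s 10 \<in> plan (s 11)"
  proof (cases "s 10 < g")
    case True
    then have "can_sense G (s 10) (s 11) \<longleftrightarrow> s 10 = s 11" using guard_sense jk by blast
    then show ?thesis using True by (auto simp: plan_def)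
  next
    case False
    then have l: "light (s 10)" using i by simp
    then have "can_sense G (s 10) (s 11) \<Longrightarrow> s 11 < g" using light_sense jk by blast
    moreover have "far (s 10) \<noteq> {} \<and> pick (s 10) = s 11 \<Longrightarrow> can_sense G (s 10) (s 11)"
      using pick_far[of "s 10"] by (auto simp: far_def own_def)
    ultimately show ?thesis using l False by (auto simp: plan_def)
  qed
  then show ?thesis using eval_epick[OF s, of 10 11] i j M by (simp add: eplan_def)
qed

end

section \<open>Running time of the red player's program\<close>

lemma cvars_esig: "cvars (esig a) \<subseteq> {a, 1}"
  by (auto simp: esig_def enum_def epos_def elen_def)

lemma cvars_enear: "cvars (enear a b) \<subseteq> {a, b, 1}"
  using cvars_esig[of a] cvars_esig[of b] by (auto simp: enear_def)

lemma cvars_efar: "cvars (efar a b) \<subseteq> {a, b, 1}"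
  using cvars_enear[of a b] by (auto simp: efar_def eM_def)

lemma cvars_ecf: "cvars (ecf a) \<subseteq> {a, 1}"
  using cvars_efar[of a 30] by (auto simp: ecf_def)

lemma cvars_eblocked: "cvars (eblocked a b) \<subseteq> {a, b, 1}"
  using cvars_enear[of a 32] cvars_ecf[of 32] cvars_efar[of 32 b] by (auto simp: eblocked_def)

lemma cvars_egood: "cvars (egood a b) \<subseteq> {a, b, 1}"
  using cvars_eblocked[of a b] cvars_efar[of a b] by (auto simp: egood_def)

lemma cvars_epick: "cvars (epick a b) \<subseteq> {a, b, 1}"
  using cvars_egood[of a b] cvars_egood[of a 34] cvars_egood[of a 36] cvars_efar[of a b] cvars_efar[of a 36]
  by (auto simp: epick_def)

text \<open>Row index, column index and number of targets; within the computed square all three are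
  bounded by the number of targets.\<close>

lemma cvars_eplan: "cvars eplan \<subseteq> {10, 11, 1}"
  using cvars_epick[of 10 11] by (auto simp: eplan_def eM_def)

lemma cvars_eskip: "cvars eskip \<subseteq> {1}"
  by (auto simp: eskip_def elen_def)

context brr_input begin

lemma n_le: "n \<le> length x" and k_le: "k \<le> length x" and nk_le: "n * k \<le> length x"
proof -
  show nk: "n * k \<le> length x" by (simp add: lenx ps_def)
  have "1 \<le> k" using n1 targets_le by simp
  then have "n * 1 \<le> n * k" "1 * k \<le> n * k" using n1 by (intro mult_le_mono; simp)+
  then show "n \<le> length x" "k \<le> length x" using nk by linarith+
qed

definition vpos :: "nat \<Rightarrow> nat" where "vpos i = p4 + (\<Sum>j<i. 2 * length (binary (w j)) + 6)"

lemma vals_eq: "vals = concat (map (\<lambda>i. False # enc_nat (w i) @ [False, True, True, False]) [0..<n])"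
proof -
  have "map (\<lambda>i. enc_rat (target_value G i)) [0..<n] = map (\<lambda>i. False # enc_nat (w i) @ [False, True, True, False]) [0..<n]"
    by (rule map_cong) (use w in \<open>auto simp: enc_rat_of_nat\<close>)
  then show ?thesis unfolding vals_def by (rule arg_cong)
qed

lemma vlen: "length (False # enc_nat a @ [False, True, True, False]) = 2 * length (binary a) + 6"
  by (simp add: length_enc_nat)

lemma vpos_code: "i < n \<Longrightarrow> code_pos x (vpos i + 1) (w i)"
proof -
  assume i: "i < n"
  let ?u = "enc_nat n @ enc_nat k @ (True # enc_nat 3)"
  have "x = ?u @ concat (map (\<lambda>i. False # enc_nat (w i) @ [False, True, True, False]) [0..<n]) @
      (enc_matrix n k (can_sense G) @ enc_ordering G \<sigma>)" by (simp add: x_eq vals_eq)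
  from concat_split[OF this i]
  obtain u' v' where u': "x = u' @ (False # enc_nat (w i) @ [False, True, True, False]) @ v'"
     "length u' = length ?u + (\<Sum>j<i. length (False # enc_nat (w j) @ [False, True, True, False]))" by blast
  have "length u' = vpos i" using u'(2) unfolding vlen by (simp add: vpos_def p4_def len3)
  moreover have "x = (u' @ [False]) @ enc_nat (w i) @ ([False, True, True, False] @ v')" using u'(1) by simp
  ultimately show ?thesis unfolding code_pos_def by (metis length_append_singleton Suc_eq_plus1)
qed

lemma vpos_n: "vpos n = pm"
proof -
  have "length vals = (\<Sum>i<n. length (False # enc_nat (w i) @ [False, True, True, False]))"
    by (simp only: vals_eq length_concat map_map comp_def interv_sum_list_conv_sum_set_nat set_upt atLeast0LessThan)
  then show ?thesis unfolding vlen by (simp add: vpos_def pm_def)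
qed

lemma pm_le: "pm \<le> length x" by (simp add: lenx ps_def)

lemma eval_eskip:
  assumes "s 0 = length x" "s 1 = n" "s 4 = p4" shows "eval x s eskip = pm"
proof -
  let ?b = "Var 25 +\<^sub>e Num 2 *\<^sub>e elen 26 (Var 25 +\<^sub>e Num 1) (Var 1 *\<^sub>e Var 1) +\<^sub>e Num 6"
  have vle: "vpos m \<le> length x" if "m \<le> n" for m
    using code_pos_lt[OF vpos_code, of m] vpos_n pm_le that by (cases "m = n") auto
  have "iter x s 24 (Var 0) (Var 4) ?b m = vpos m" if "m \<le> n" for m
    using that
  proof (induction m)
    case 0
    then show ?case using assms vle[of 0] by (simp add: iter_0 vpos_def)
  next
    case (Suc m)
    then have m: "m < n" by simp
    have "length (binary (w m)) \<le> n * n" using w[OF m] length_binary_le[of "w m"] by simp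
    then have "eval x (s(24 := m, Suc 24 := vpos m)) (elen 26 (Var 25 +\<^sub>e Num 1) (Var 1 *\<^sub>e Var 1)) = length (binary (w m))"
      by (intro eval_elen[OF _ vpos_code[OF m]]) (use assms in auto)
    then have "eval x (s(24 := m, Suc 24 := vpos m)) ?b = vpos (Suc m)" by (simp add: vpos_def)
    then show ?case using Suc assms vle[of "Suc m"] by (simp add: iter_Suc del: eval.simps(3))
  qed
  then show ?thesis using assms vpos_n by (simp add: eskip_def eval_Fold)
qed

lemma code_n: "code_pos x 0 n"
proof -
  have "x = [] @ enc_nat n @ (enc_nat k @ (True # enc_nat 3) @ vals @ enc_matrix n k (can_sense G) @ enc_ordering G \<sigma>)"
    unfolding append_Nil by (rule x_eq)
  then show ?thesis unfolding code_pos_def by (metis list.size(3))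
qed

lemma code_k: "code_pos x (2 * length (binary n) + 1) k"
  using x_eq length_enc_nat unfolding code_pos_def by metis

definition fin :: env where
  "fin = (env0 x)(7 := length (binary n), 1 := n, 2 := 2 * length (binary n) + 1, 8 := length (binary k),
     3 := k, 4 := p4, 5 := pm, 6 := ps)"

lemma lets:
  defines "s1 \<equiv> (env0 x)(7 := length (binary n))"
  defines "s2 \<equiv> s1(1 := n)"
  defines "s3 \<equiv> s2(2 := 2 * length (binary n) + 1)"
  defines "s4 \<equiv> s3(8 := length (binary k))"
  defines "s5 \<equiv> s4(3 := k)"
  defines "s6 \<equiv> s5(4 := p4)"
  defines "s7 \<equiv> s6(5 := pm)"
  shows "eval x (env0 x) (elen 20 (Num 0) (Var 0)) = length (binary n)"
    "eval x s1 (enum 20 (Num 0) (Var 7) (Var 0)) = n"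
    "eval x s2 (Num 2 *\<^sub>e Var 7 +\<^sub>e Num 1) = 2 * length (binary n) + 1"
    "eval x s3 (elen 20 (Var 2) (Var 0)) = length (binary k)"
    "eval x s4 (enum 20 (Var 2) (Var 8) (Var 0)) = k"
    "eval x s5 (Var 2 +\<^sub>e Num 2 *\<^sub>e Var 8 +\<^sub>e Num 7) = p4"
    "eval x s6 eskip = pm"
    "eval x s7 (Var 5 +\<^sub>e Var 1 *\<^sub>e Var 3) = ps"
    "s7(6 := ps) = fin"
proof -
  have ln: "length (binary n) \<le> length x" using length_binary_le[of n] n_le by simp
  have lk: "length (binary k) \<le> length x" using length_binary_le[of k] k_le by simp
  note d = s1_def s2_def s3_def s4_def s5_def s6_def s7_def env0_def
  show "eval x (env0 x) (elen 20 (Num 0) (Var 0)) = length (binary n)"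
    by (rule eval_elen[OF _ code_n]) (use ln in \<open>auto simp: env0_def\<close>)
  show "eval x s1 (enum 20 (Num 0) (Var 7) (Var 0)) = n"
    by (rule eval_enum[OF _ code_n]) (use n_le in \<open>auto simp: d\<close>)
  show "eval x s2 (Num 2 *\<^sub>e Var 7 +\<^sub>e Num 1) = 2 * length (binary n) + 1" by (simp add: d)
  show "eval x s3 (elen 20 (Var 2) (Var 0)) = length (binary k)"
    by (rule eval_elen[OF _ code_k]) (use lk in \<open>auto simp: d\<close>)
  show "eval x s4 (enum 20 (Var 2) (Var 8) (Var 0)) = k"
    by (rule eval_enum[OF _ code_k]) (use k_le in \<open>auto simp: d\<close>)
  show "eval x s5 (Var 2 +\<^sub>e Num 2 *\<^sub>e Var 8 +\<^sub>e Num 7) = p4" by (simp add: d p4_def length_enc_nat)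
  show "eval x s6 eskip = pm" by (rule eval_eskip) (simp_all add: d)
  show "eval x s7 (Var 5 +\<^sub>e Var 1 *\<^sub>e Var 3) = ps" by (simp add: d ps_def)
  show "s7(6 := ps) = fin" by (simp add: d fin_def)
qed

lemma fin_benv: "benv fin"
  by (simp add: benv_def fin_def env0_def)

lemma out_body: "out x fin brr_body = enc_plan G plan"
proof -
  have row: "out x (fin(10 := i)) (Seq (For 11 (Var 1) (Emit eplan)) (For 11 (Var 3 -\<^sub>e Var 1) (Emit (Num 0)))) =
      map (\<lambda>j. i \<in> plan j) [0..<k]" if i: "i < n" for i
  proof -
    have e1: "eval x (fin(10 := i)) (Var 1) = n" "eval x (fin(10 := i)) (Var 3 -\<^sub>e Var 1) = k - n"
      by (simp_all add: fin_def)
    have "(eval x (fin(10 := i, 11 := j)) eplan \<noteq> 0) = (i \<in> plan j)" if j: "j < n" for j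
      using eval_eplan[of "fin(10 := i, 11 := j)"] fin_benv i j by (simp add: benv_upd)
    then have "concat (map (\<lambda>j. [eval x (fin(10 := i, 11 := j)) eplan \<noteq> 0]) [0..<n]) = map (\<lambda>j. i \<in> plan j) [0..<n]"
      by (simp add: concat_map_singleton)
    moreover have "concat (map (\<lambda>j. [False]) [0..<k - n]) = map (\<lambda>j. i \<in> plan j) [n..<k]"
    proof -
      have "map (\<lambda>j. i \<in> plan j) [n..<k] = map (\<lambda>j. False) [n..<k]" using g_le by (auto simp: plan_def)
      then show ?thesis by (simp add: map_replicate_const concat_map_singleton)
    qed
    moreover have "[0..<k] = [0..<n] @ [n..<k]" using targets_le by (metis le0 le_add_diff_inverse upt_add_eq_append)
    ultimately show ?thesis using e1 by simp
  qed
  have "out x fin brr_body = concat (map (\<lambda>i. out x (fin(10 := i)) (Seq (For 11 (Var 1) (Emit eplan)) (For 11 (Var 3 -\<^sub>e Var 1) (Emit (Num 0))))) [0..<n])"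
    unfolding brr_body_def out.simps(3)[of x fin 10] by (simp add: fin_def)
  also have "\<dots> = concat (map (\<lambda>i. map (\<lambda>j. i \<in> plan j) [0..<k]) [0..<n])"
    using row by (intro arg_cong[of _ _ concat] map_cong) auto
  finally show ?thesis by (simp add: enc_plan_def enc_matrix_def)
qed

lemma out_brr: "out x (env0 x) brr_prog = enc_plan G plan"
  unfolding brr_prog_def out.simps(4) lets by (rule out_body)

lemma cost_parse:
  "cost x s (elen 20 (Num 0) (Var v)) \<le> 60 + 60 * s v" "cost x s (elen 20 (Var u) (Var v)) \<le> 60 + 60 * s v"
  "cost x s (enum 20 (Num 0) (Var u) (Var v)) \<le> 60 + 60 * s u" "cost x s (enum 20 (Var a) (Var u) (Var v)) \<le> 60 + 60 * s u"
  by (simp_all add: elen_def enum_def eand_def eeq_def enot_def)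

text \<open>Expensive entries number \<open>n * n\<close>; all other entries of the output have
  constant cost and are covered by the length of the input, which contains a matrix of the same
  size.\<close>

lemma scost_brr:
  assumes e: "\<And>i j. i < n \<Longrightarrow> j < n \<Longrightarrow> cost x (fin(10 := i, 11 := j)) eplan \<le> c"
    and s: "\<And>s. s 1 = n \<Longrightarrow> cost x s eskip \<le> c'"
  shows "scost x (env0 x) brr_prog \<le> 400 + 300 * length x + n * n * (c + 9) + c'"
proof -
  have row: "scost x (fin(10 := i)) (Seq (For 11 (Var 1) (Emit eplan)) (For 11 (Var 3 -\<^sub>e Var 1) (Emit (Num 0)))) \<le>
     14 + n * (c + 9) + 10 * k" if i: "i < n" for i
  proof -
    have e1: "eval x (fin(10 := i)) (Var 1) = n" "eval x (fin(10 := i)) (Var 3 -\<^sub>e Var 1) = k - n"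
      by (simp_all add: fin_def)
    have "(\<Sum>j<n. cost x (fin(10 := i, 11 := j)) eplan + 5 + 4) \<le> (\<Sum>j<n. c + 9)"
      using e[OF i] by (intro sum_mono) auto
    then show ?thesis unfolding scost.simps e1 by simp
  qed
  have "scost x fin brr_body = 1 + 5 + (\<Sum>i<n. scost x (fin(10 := i)) (Seq (For 11 (Var 1) (Emit eplan)) (For 11 (Var 3 -\<^sub>e Var 1) (Emit (Num 0)))) + 4)"
    unfolding brr_body_def scost.simps(3)[of x fin 10] by (simp add: fin_def)
  also have "\<dots> \<le> 1 + 5 + (\<Sum>i<n. 14 + n * (c + 9) + 10 * k + 4)"
    using row by (intro add_left_mono sum_mono add_right_mono) auto
  finally have body: "scost x fin brr_body \<le> 6 + 18 * n + n * n * (c + 9) + 10 * (n * k)"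
    by (simp add: algebra_simps)
  let ?s = "(env0 x)(7 := length (binary n))"
  have skip: "cost x (?s(1 := n, 2 := 2 * length (binary n) + 1, 8 := length (binary k), 3 := k, 4 := p4)) eskip \<le> c'"
    by (rule s) simp
  have ln: "length (binary n) \<le> length x" using length_binary_le[of n] n_le by simp
  have lk: "length (binary k) \<le> length x" using length_binary_le[of k] k_le by simp
  have "scost x (env0 x) brr_prog \<le> (60 + 60 * length x) + (60 + 60 * length x) + (60 + 60 * length x) + (60 + 60 * length x)
     + c' + scost x fin brr_body + 50"
    unfolding brr_prog_def scost.simps lets
    using cost_parse(1)[of "env0 x" 0] cost_parse(3)[of ?s 7 0]
      cost_parse(2)[of "?s(1 := n, 2 := 2 * length (binary n) + 1)" 2 0]
      cost_parse(4)[of "?s(1 := n, 2 := 2 * length (binary n) + 1, 8 := length (binary k))" 2 8 0] skip ln lk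
    by (simp add: env0_def)
  then show ?thesis using body n_le nk_le by linarith
qed

end

text \<open>The matrix has so many columns that a computation polynomial in the number of targets
  can be charged to a single row. Small values ensure that parsing them is such a
  computation.\<close>

definition brr_class :: "nat \<Rightarrow> esg set" where
  "brr_class d = {G. \<exists>g p w. guarded_game G g p \<and> 1 \<le> targets G \<and>
     (\<forall>i<targets G. target_value G i = of_nat (w i) \<and> w i \<le> targets G * targets G) \<and>
     (targets G + 2) ^ d \<le> sensors G}"

lemma brr_class_esg: "G \<in> brr_class d \<Longrightarrow> is_esg G \<and> recharge G = 3"
  unfolding brr_class_def is_esg_def using guarded_game.values_pos guarded_game.recharge_3 by blast

theorem brr_class_linear_time: "\<exists>d. brr_linear_time (brr_class d)"
proof -
  obtain c1 where c1: "\<And>x s B. 2 \<le> B \<Longrightarrow> \<forall>v\<in>cvars eplan. s v \<le> B \<Longrightarrow> cost x s eplan \<le> B ^ c1"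
    using cost_poly[of eplan] by metis
  obtain c2 where c2: "\<And>x s B. 2 \<le> B \<Longrightarrow> \<forall>v\<in>cvars eskip. s v \<le> B \<Longrightarrow> cost x s eskip \<le> B ^ c2"
    using cost_poly[of eskip] by metis
  obtain c3 where c3: "\<And>x. fits_stmt (poly_bound c3 (length x)) x (env0 x) brr_prog \<and>
     length x + length (out x (env0 x) brr_prog) + 1 \<le> poly_bound c3 (length x)"
    using stmt_poly_word[of brr_prog] by metis
  \<comment> \<open>The factor beyond \<open>c1\<close> pays for the loop along a row, and the loop
    over the rows is matched by the rows of the input matrix; \<open>c2\<close> pays for skipping
    the values.\<close>
  define d where "d = Suc c1 + c2"
  \<comment> \<open>The summand 1000 covers the linear running time, \<open>c3\<close> the word
    size.\<close>
  define c where "c = c3 + 1000"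
  have main: "\<exists>\<psi>. best_red_response G \<sigma> \<psi> \<and> ram_computes (cprog brr_prog) (enc_esg G @ enc_ordering G \<sigma>) (enc_plan G \<psi>)
     (c * length (enc_esg G @ enc_ordering G \<sigma>) + c) (poly_bound c (length (enc_esg G @ enc_ordering G \<sigma>)))"
    if G: "G \<in> brr_class d" and \<sigma>: "target_ordering G \<sigma>" for G \<sigma>
  proof -
    obtain g p w where gg: "guarded_game G g p" and n1: "1 \<le> targets G"
      and w: "\<And>i. i < targets G \<Longrightarrow> target_value G i = of_nat (w i) \<and> w i \<le> targets G * targets G"
      and k: "(targets G + 2) ^ d \<le> sensors G" using G unfolding brr_class_def by blast
    interpret guarded_game G g p by (rule gg)
    interpret ordered_game G g p \<sigma> by unfold_locales (rule \<sigma>)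
    interpret brr_input G g p \<sigma> w by unfold_locales (use n1 w in auto)
    let ?B = "n + 2"
    have B: "2 \<le> ?B" by simp
    have "cost x (fin(10 := i, 11 := j)) eplan \<le> ?B ^ c1" if "i < n" "j < n" for i j
    proof (rule c1[OF B], rule ballI)
      fix v assume "v \<in> cvars eplan"
      then have "v \<in> {10, 11, 1}" using cvars_eplan by blast
      then show "(fin(10 := i, 11 := j)) v \<le> ?B" using that by (auto simp: fin_def)
    qed
    moreover have "cost x s eskip \<le> ?B ^ c2" if "s 1 = n" for s
      using cvars_eskip that by (intro c2[OF B]) auto
    ultimately have sc: "scost x (env0 x) brr_prog \<le> 400 + 300 * length x + n * n * (?B ^ c1 + 9) + ?B ^ c2"
      by (rule scost_brr)
    have "n * n * (?B ^ c1 + 9) \<le> 10 * (n * k)"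
    proof -
      have "?B ^ c1 + 9 \<le> 10 * ?B ^ c1" using one_le_power[of ?B c1] by simp
      then have "n * (?B ^ c1 + 9) \<le> ?B * (10 * ?B ^ c1)" by (intro mult_le_mono) auto
      also have "\<dots> = 10 * ?B ^ Suc c1" by simp
      also have "?B ^ Suc c1 \<le> ?B ^ d" unfolding d_def by (intro power_increasing) auto
      finally have "n * (?B ^ c1 + 9) \<le> 10 * k" using k by simp
      from mult_le_mono2[OF this, of n] show ?thesis by (simp add: mult_ac)
    qed
    moreover have "?B ^ c2 \<le> k"
    proof -
      have "?B ^ c2 \<le> ?B ^ d" unfolding d_def by (intro power_increasing) auto
      then show ?thesis using k by (rule le_trans)
    qed
    ultimately have "scost x (env0 x) brr_prog \<le> 400 + 311 * length x" using sc nk_le k_le by linarith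
    moreover have "length (out x (env0 x) brr_prog) = n * k" unfolding out_brr by (simp add: enc_plan_def length_enc_matrix)
    ultimately have t: "scost x (env0 x) brr_prog + 7 * length (out x (env0 x) brr_prog) + 6 \<le> 1000 * length x + 1000"
      using nk_le by linarith
    also have "\<dots> \<le> c * length x + c" unfolding c_def by (simp add: algebra_simps)
    finally have t: "scost x (env0 x) brr_prog + 7 * length (out x (env0 x) brr_prog) + 6 \<le> c * length x + c" .
    have "poly_bound c3 (length x) \<le> poly_bound c (length x)"
    proof -
      have "length x ^ c3 \<le> length x ^ c" using n_le n1 unfolding c_def by (intro power_increasing) auto
      then show ?thesis by (simp add: poly_bound_def c_def)
    qed
    from ram_computes_mono[OF cprog_correct[OF conjunct1[OF c3] conjunct2[OF c3]] t this]
    have "ram_computes (cprog brr_prog) x (enc_plan G plan) (c * length x + c) (poly_bound c (length x))"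
      unfolding out_brr .
    then show ?thesis using plan_best unfolding x_def by blast
  qed
  have "brr_linear_time (brr_class d)"
    unfolding brr_linear_time_def Let_def using main by blast
  then show ?thesis by blast
qed

section \<open>The reduction\<close>

subsection \<open>Printing numbers\<close>

text \<open>The cap keeps the powers small. With cap \<open>a + 1\<close>, comparing with
  \<open>a\<close> gives the same result as for the true power.\<close>

definition epow2 :: "nat \<Rightarrow> expr \<Rightarrow> expr" where
  "epow2 v c = Fold 36 (Var v) c (Num 1) (Num 2 *\<^sub>e Var 37)"

lemma eval_epow2: "1 \<le> eval x s c \<Longrightarrow> eval x s (epow2 v c) = min (eval x s c) (2 ^ s v)"
proof -
  assume c: "1 \<le> eval x s c"
  have "iter x s 36 c (Num 1) (Num 2 *\<^sub>e Var 37) m = min (eval x s c) (2 ^ m)" for m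
    by (induction m) (use c in \<open>auto simp: iter_0 iter_Suc min_def\<close>)
  then show ?thesis by (simp add: epow2_def eval_Fold)
qed

definition print_nat :: "expr \<Rightarrow> stmt" where
  "print_nat e = LetIn 30 e (LetIn 31 (ecount 34 (Var 30) (epow2 34 (Var 30 +\<^sub>e Num 1) \<le>\<^sub>e Var 30))
     (Seq (For 32 (Var 31) (Seq (Emit (Num 1)) (Emit ((Var 30 div\<^sub>e epow2 32 (Var 30 +\<^sub>e Num 1)) mod\<^sub>e Num 2)))) (Emit (Num 0))))"

lemma binary_eq_map: "binary a = map (\<lambda>j. odd (a div 2 ^ j)) [0..<length (binary a)]"
  by (rule nth_equalityI) (auto simp: binary_nth)

lemma out_print_nat: "out x s (print_nat e) = enc_nat (eval x s e)"
proof -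
  define a where "a = eval x s e"
  let ?s = "s(30 := a)"
  have "eval x ?s (ecount 34 (Var 30) (epow2 34 (Var 30 +\<^sub>e Num 1) \<le>\<^sub>e Var 30)) = card {j. j < eval x ?s (Var 30) \<and> 2 ^ j \<le> a}"
    by (rule eval_ecount) (auto simp: eval_epow2 min_def)
  also have "{j. j < eval x ?s (Var 30) \<and> 2 ^ j \<le> a} = {..<length (binary a)}"
    using length_binary_le[of a] by (auto simp: binary_length_iff[symmetric])
  finally have l: "eval x ?s (ecount 34 (Var 30) (epow2 34 (Var 30 +\<^sub>e Num 1) \<le>\<^sub>e Var 30)) = length (binary a)"
    by (simp only: card_lessThan)
  let ?t = "?s(31 := length (binary a))"
  have bit: "eval x (?t(32 := j)) ((Var 30 div\<^sub>e epow2 32 (Var 30 +\<^sub>e Num 1)) mod\<^sub>e Num 2) \<noteq> 0 \<longleftrightarrow> odd (a div 2 ^ j)"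
    if "j < length (binary a)" for j
    using that by (auto simp: eval_epow2 min_def binary_length_iff odd_iff_mod_2_eq_one)
  have "out x ?t (For 32 (Var 31) (Seq (Emit (Num 1)) (Emit ((Var 30 div\<^sub>e epow2 32 (Var 30 +\<^sub>e Num 1)) mod\<^sub>e Num 2))))
    = concat (map (\<lambda>j. [True, eval x (?t(32 := j)) ((Var 30 div\<^sub>e epow2 32 (Var 30 +\<^sub>e Num 1)) mod\<^sub>e Num 2) \<noteq> 0]) [0..<length (binary a)])"
    by simp
  also have "\<dots> = concat (map (\<lambda>j. [True, odd (a div 2 ^ j)]) [0..<length (binary a)])"
    using bit by (intro arg_cong[of _ _ concat] map_cong) auto
  also have "\<dots> = concat (map (\<lambda>b. [True, b]) (binary a))"
    by (subst (2) binary_eq_map) (simp add: comp_def)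
  finally have "out x ?t (For 32 (Var 31) (Seq (Emit (Num 1)) (Emit ((Var 30 div\<^sub>e epow2 32 (Var 30 +\<^sub>e Num 1)) mod\<^sub>e Num 2))))
    = concat (map (\<lambda>b. [True, b]) (binary a))" .
  then show ?thesis unfolding print_nat_def out.simps(4) a_def[symmetric] l out.simps(2)
    by (simp add: enc_nat_def self_delimiting_def)
qed

definition print_rat :: "expr \<Rightarrow> stmt" where
  "print_rat e = Seq (Emit (Num 0)) (Seq (print_nat e)
     (Seq (Emit (Num 0)) (Seq (Emit (Num 1)) (Seq (Emit (Num 1)) (Emit (Num 0))))))"

lemma out_print_rat: "out x s (print_rat e) = enc_rat (of_nat (eval x s e))"
  by (simp add: print_rat_def out_print_nat enc_rat_of_nat)


subsection \<open>Literals of the formula\<close>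

fun epow :: "expr \<Rightarrow> nat \<Rightarrow> expr" where
  "epow e 0 = Num 1"
| "epow e (Suc k) = e *\<^sub>e epow e k"

lemma eval_epow [simp]: "eval x s (epow e k) = eval x s e ^ k"
  by (induction k) auto

text \<open>The simulated program is fixed, so looking up a line unrolls into nested
  conditionals.\<close>

fun etab :: "expr list \<Rightarrow> expr \<Rightarrow> expr \<Rightarrow> expr" where
  "etab [] d l = d"
| "etab (e # es) d l = eif (l =\<^sub>e Num 0) e (etab es d (l -\<^sub>e Num 1))"

lemma eval_etab: "eval x s (etab es d l) = (if eval x s l < length es then eval x s (es ! eval x s l) else eval x s d)"
proof (induction es arbitrary: l)
  case (Cons e es)
  show ?case using Cons[of "l -\<^sub>e Num 1"] by (cases "eval x s l") auto
qed simp

fun esrcA_instr :: "instr \<Rightarrow> expr \<Rightarrow> expr" where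
  "esrcA_instr (Const r a) q = q"
| "esrcA_instr (Arith f r a b) q = Num (1 + a)"
| "esrcA_instr (Load r a) q = Num (1 + a)"
| "esrcA_instr (Store a r) q = Num (1 + a)"
| "esrcA_instr (JumpIfZero r l) q = Num (1 + r)"

fun esrcB_instr :: "nat \<Rightarrow> instr \<Rightarrow> expr \<Rightarrow> expr \<Rightarrow> expr" where
  "esrcB_instr R (Const r a) q u = q"
| "esrcB_instr R (Arith f r a b) q u = eif (q =\<^sub>e Num (1 + r)) (Num (1 + b)) q"
| "esrcB_instr R (Load r a) q u = eif (q =\<^sub>e Num (1 + r)) (Num (1 + R) +\<^sub>e u) q"
| "esrcB_instr R (Store a r) q u = eif (q =\<^sub>e Num (1 + R) +\<^sub>e u) (Num (1 + r)) q"
| "esrcB_instr R (JumpIfZero r l) q u = q"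

fun eres_instr :: "instr \<Rightarrow> expr \<Rightarrow> expr \<Rightarrow> expr \<Rightarrow> expr \<Rightarrow> expr" where
  "eres_instr (Const r a) l q u w = eif (q =\<^sub>e Num 0) (l +\<^sub>e Num 1) (eif (q =\<^sub>e Num (1 + r)) (Num a) w)"
| "eres_instr (Arith f r a b) l q u w = eif (q =\<^sub>e Num 0) (l +\<^sub>e Num 1) (eif (q =\<^sub>e Num (1 + r)) (Bin f u w) w)"
| "eres_instr (Load r a) l q u w = eif (q =\<^sub>e Num 0) (l +\<^sub>e Num 1) w"
| "eres_instr (Store a r) l q u w = eif (q =\<^sub>e Num 0) (l +\<^sub>e Num 1) w"
| "eres_instr (JumpIfZero r l') l q u w = eif (q =\<^sub>e Num 0) (eif (u =\<^sub>e Num 0) (Num l') (l +\<^sub>e Num 1)) w"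

definition esrcA :: "instr list \<Rightarrow> expr \<Rightarrow> expr \<Rightarrow> expr" where
  "esrcA P l q = etab (map (\<lambda>i. esrcA_instr i q) P) q l"
definition esrcB :: "instr list \<Rightarrow> nat \<Rightarrow> expr \<Rightarrow> expr \<Rightarrow> expr \<Rightarrow> expr" where
  "esrcB P R l q u = etab (map (\<lambda>i. esrcB_instr R i q u) P) q l"
definition eres :: "instr list \<Rightarrow> expr \<Rightarrow> expr \<Rightarrow> expr \<Rightarrow> expr \<Rightarrow> expr" where
  "eres P l q u w = etab (map (\<lambda>i. eres_instr i l q u w) P) w l"

lemma eval_instr:
  "eval x s (esrcA_instr i q) = srcA_instr i (eval x s q)"
  "eval x s (esrcB_instr R i q u) = srcB_instr R i (eval x s q) (eval x s u)"
  "eval x s (eres_instr i l q u w) = res_instr i (eval x s l) (eval x s q) (eval x s u) (eval x s w)"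
  by (cases i; simp)+

lemma eval_src [simp]:
  "eval x s (esrcA P l q) = srcA P (eval x s l) (eval x s q)"
  "eval x s (esrcB P R l q u) = srcB P R (eval x s l) (eval x s q) (eval x s u)"
  "eval x s (eres P l q u w) = res P (eval x s l) (eval x s q) (eval x s u) (eval x s w)"
  by (simp_all add: esrcA_def esrcB_def eres_def eval_etab eval_instr srcA_def srcB_def res_def)

text \<open>Variables: 0 is the length of the input, 1 the side length \<open>D\<close> of the grid of variables of the formula.\<close>

definition esd :: "expr \<Rightarrow> expr" where
  "esd a = eif (a =\<^sub>e Num 2 *\<^sub>e Var 0) (Num 0) (eif (a mod\<^sub>e Num 2 =\<^sub>e Num 0) (Num 1) (Inp (a div\<^sub>e Num 2)))"

lemma eval_esd:
  assumes "s 0 = length x" "eval x s a < 2 * length x + 1"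
  shows "eval x s (esd a) = of_bool (self_delimiting x ! eval x s a)"
proof -
  define i where "i = eval x s a"
  consider "i = 2 * length x" | j where "i = 2 * j" "j < length x" | j where "i = 2 * j + 1" "j < length x"
    using assms(2) unfolding i_def[symmetric] by (metis Suc_eq_plus1 add_less_cancel_right evenE less_Suc_eq
      mult_less_cancel1 oddE mult_2 less_antisym not_less_eq Suc_lessD add_2_eq_Suc mult_Suc_right Suc_leI le_less)
  then show ?thesis
  proof cases
    case 1
    then show ?thesis using assms(1) self_delimiting_nth(3)[of x] by (simp add: esd_def i_def)
  next
    case 2
    then show ?thesis using assms(1) self_delimiting_nth(1)[of j x] by (simp add: esd_def i_def[symmetric])
  next
    case 3
    have "2 * j + 1 \<noteq> 2 * length x" by presburger
    then show ?thesis using 3 assms(1) self_delimiting_nth(2)[of j x] by (simp add: esd_def i_def[symmetric])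
  qed
qed

definition eini :: "nat \<Rightarrow> expr \<Rightarrow> expr \<Rightarrow> expr \<Rightarrow> expr" where
  "eini R L q w = eif (q =\<^sub>e Num 1) (Num 2 *\<^sub>e Var 0 +\<^sub>e Num 1 \<le>\<^sub>e w \<and>\<^sub>e w \<le>\<^sub>e L)
     (eif (q \<le>\<^sub>e Num R) (w =\<^sub>e Num 0)
     (eif (q -\<^sub>e Num 1 -\<^sub>e Num R <\<^sub>e Num 2 *\<^sub>e Var 0 +\<^sub>e Num 1) (w =\<^sub>e esd (q -\<^sub>e Num 1 -\<^sub>e Num R))
     (eif (q -\<^sub>e Num 1 -\<^sub>e Num R <\<^sub>e L) (w \<le>\<^sub>e Num 1) (w =\<^sub>e Num 0))))"

lemma eval_eini:
  assumes "s 0 = length x"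
  shows "eval x s (eini R L q w) = of_bool (ini x R (eval x s L) (eval x s q) (eval x s w))"
  using eval_esd[of s x "q -\<^sub>e Num 1 -\<^sub>e Num R"] assms by (auto simp: eini_def ini_def)

definition eclit :: "instr list \<Rightarrow> nat \<Rightarrow> expr \<Rightarrow> expr \<Rightarrow> expr \<Rightarrow> expr \<Rightarrow> expr \<Rightarrow> expr \<Rightarrow> expr \<Rightarrow>
    expr \<Rightarrow> expr \<Rightarrow> expr \<Rightarrow> expr \<Rightarrow> expr" where
  "eclit P R L kd ct cq cl cu cw t q w b =
    eif (kd =\<^sub>e Num 0 \<and>\<^sub>e ct +\<^sub>e Num 1 <\<^sub>e Var 1)
      ((b =\<^sub>e Num 0 \<and>\<^sub>e t =\<^sub>e ct \<and>\<^sub>e ((q =\<^sub>e Num 0 \<and>\<^sub>e w =\<^sub>e cl) \<or>\<^sub>e (q =\<^sub>e esrcA P cl cq \<and>\<^sub>e w =\<^sub>e cu) \<or>\<^sub>e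
         (q =\<^sub>e esrcB P R cl cq cu \<and>\<^sub>e w =\<^sub>e cw))) \<or>\<^sub>e
       (b =\<^sub>e Num 1 \<and>\<^sub>e t =\<^sub>e ct +\<^sub>e Num 1 \<and>\<^sub>e q =\<^sub>e cq \<and>\<^sub>e w =\<^sub>e eres P cl cq cu cw))
    (eif (kd =\<^sub>e Num 1) (b =\<^sub>e Num 1 \<and>\<^sub>e t =\<^sub>e Num 0 \<and>\<^sub>e q =\<^sub>e cq \<and>\<^sub>e eini R L cq w)
    (eif (kd =\<^sub>e Num 2 \<and>\<^sub>e Num (1 + R) +\<^sub>e cl \<le>\<^sub>e cq)
      ((b =\<^sub>e Num 0 \<and>\<^sub>e t =\<^sub>e Num 0 \<and>\<^sub>e q =\<^sub>e Num 1 \<and>\<^sub>e w =\<^sub>e cl) \<or>\<^sub>e (b =\<^sub>e Num 1 \<and>\<^sub>e t =\<^sub>e Num 0 \<and>\<^sub>e q =\<^sub>e cq \<and>\<^sub>e w =\<^sub>e Num 0))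
    (eif (kd =\<^sub>e Num 3 \<and>\<^sub>e enot (cw =\<^sub>e Num 1))
      (b =\<^sub>e Num 0 \<and>\<^sub>e t =\<^sub>e Var 1 -\<^sub>e Num 1 \<and>\<^sub>e q =\<^sub>e Num (1 + R) \<and>\<^sub>e w =\<^sub>e cw) (Num 1))))"

lemma eval_eclit:
  assumes "s 0 = length x"
  shows "eval x s (eclit P R L kd ct cq cl cu cw t q w b) =
    of_bool (clit P x R (eval x s L) (s 1) (eval x s kd) (eval x s ct) (eval x s cq) (eval x s cl)
      (eval x s cu) (eval x s cw) (eval x s t) (eval x s q) (eval x s w) (eval x s b))"
  unfolding eclit_def clit_def eval_logic eval_eini[of s x, OF assms] eval_src eval.simps binop_fun.simps of_bool_eq_0_iff
    of_bool_eq_1_iff not_not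
  by (auto split: if_splits)

definition emlit :: "instr list \<Rightarrow> nat \<Rightarrow> expr \<Rightarrow> expr \<Rightarrow> expr \<Rightarrow> expr \<Rightarrow> expr" where
  "emlit P R L c v b = eclit P R L (c div\<^sub>e epow (Var 1) 5) (c div\<^sub>e epow (Var 1) 4 mod\<^sub>e Var 1)
     (c div\<^sub>e epow (Var 1) 3 mod\<^sub>e Var 1) (c div\<^sub>e epow (Var 1) 2 mod\<^sub>e Var 1) (c div\<^sub>e Var 1 mod\<^sub>e Var 1) (c mod\<^sub>e Var 1)
     (v div\<^sub>e epow (Var 1) 2) (v div\<^sub>e Var 1 mod\<^sub>e Var 1) (v mod\<^sub>e Var 1) b"


subsection \<open>Printing the game\<close>

text \<open>Further variables: 2 is the number of clauses, 3 the number of slots, and 4 to 9 are the numbers of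
  triples, anchored elements, free elements, guards, targets and sensors.\<close>

definition esucc :: "expr \<Rightarrow> expr" where
  "esucc i = eif (i mod\<^sub>e Var 2 +\<^sub>e Num 1 =\<^sub>e Var 2) (i +\<^sub>e Num 1 -\<^sub>e Var 2) (i +\<^sub>e Num 1)"
definition ecx :: "expr \<Rightarrow> expr" where
  "ecx t = eif (t <\<^sub>e Var 6) (t div\<^sub>e Num 2) (Var 4 +\<^sub>e ((t -\<^sub>e Var 6) div\<^sub>e Num 2) mod\<^sub>e Var 2)"
definition ecy :: "expr \<Rightarrow> expr" where
  "ecy t = eif (t <\<^sub>e Var 6) (Var 3 +\<^sub>e eif (t mod\<^sub>e Num 2 =\<^sub>e Num 1) (t div\<^sub>e Num 2) (esucc (t div\<^sub>e Num 2))) t"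
definition ecz :: "expr \<Rightarrow> expr" where
  "ecz t = eif (t <\<^sub>e Var 6) (eif (t mod\<^sub>e Num 2 =\<^sub>e Num 1) (t -\<^sub>e Num 1) (t +\<^sub>e Num 1)) (t -\<^sub>e Var 6)"
definition ecok :: "instr list \<Rightarrow> nat \<Rightarrow> expr \<Rightarrow> expr \<Rightarrow> expr" where
  "ecok P R L t = (t <\<^sub>e Var 6 \<or>\<^sub>e
     emlit P R L ((t -\<^sub>e Var 6) div\<^sub>e Num 2 mod\<^sub>e Var 2) ((t -\<^sub>e Var 6) div\<^sub>e Num 2 div\<^sub>e Var 2) (t mod\<^sub>e Num 2))"

definition esense :: "instr list \<Rightarrow> nat \<Rightarrow> expr \<Rightarrow> expr \<Rightarrow> expr \<Rightarrow> expr" where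
  "esense P R L i j = eif (i <\<^sub>e Var 7) (i =\<^sub>e j)
    (eif (i <\<^sub>e Var 7 +\<^sub>e Var 4)
      ((Num 4 *\<^sub>e (i -\<^sub>e Var 7) \<le>\<^sub>e j \<and>\<^sub>e j <\<^sub>e Num 4 *\<^sub>e (i -\<^sub>e Var 7) +\<^sub>e Num 3) \<or>\<^sub>e
       (j =\<^sub>e Num 4 *\<^sub>e (i -\<^sub>e Var 7) +\<^sub>e Num 3 \<and>\<^sub>e enot (ecok P R L (i -\<^sub>e Var 7))) \<or>\<^sub>e
       j =\<^sub>e Num 4 *\<^sub>e Var 4 +\<^sub>e Num 5 *\<^sub>e Var 5 +\<^sub>e ecx (i -\<^sub>e Var 7) \<or>\<^sub>e
       j =\<^sub>e Num 4 *\<^sub>e Var 4 +\<^sub>e Num 5 *\<^sub>e Var 5 +\<^sub>e ecy (i -\<^sub>e Var 7) \<or>\<^sub>e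
       j =\<^sub>e Num 4 *\<^sub>e Var 4 +\<^sub>e Num 6 *\<^sub>e Var 5 +\<^sub>e ecz (i -\<^sub>e Var 7))
      (i <\<^sub>e Var 8 \<and>\<^sub>e ((Num 4 *\<^sub>e Var 4 +\<^sub>e Num 5 *\<^sub>e (i -\<^sub>e (Var 7 +\<^sub>e Var 4)) \<le>\<^sub>e j \<and>\<^sub>e
           j <\<^sub>e Num 4 *\<^sub>e Var 4 +\<^sub>e Num 5 *\<^sub>e (i -\<^sub>e (Var 7 +\<^sub>e Var 4)) +\<^sub>e Num 5) \<or>\<^sub>e
         j =\<^sub>e Num 4 *\<^sub>e Var 4 +\<^sub>e Num 5 *\<^sub>e Var 5 +\<^sub>e (i -\<^sub>e (Var 7 +\<^sub>e Var 4)))))"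

definition evalue :: "expr \<Rightarrow> expr" where
  "evalue i = eif (i <\<^sub>e Var 7) (Var 4 +\<^sub>e (Var 4 +\<^sub>e Num 1) *\<^sub>e Var 5 +\<^sub>e Num 1)
     (eif (i <\<^sub>e Var 7 +\<^sub>e Var 4) (Num 1) (Var 4 +\<^sub>e Num 1))"

definition print_game :: "instr list \<Rightarrow> nat \<Rightarrow> expr \<Rightarrow> stmt" where
  "print_game P R L = Seq (print_nat (Var 8)) (Seq (print_nat (Var 9)) (Seq (Emit (Num 1)) (Seq (print_nat (Num 3))
     (Seq (For 10 (Var 8) (print_rat (evalue (Var 10))))
     (Seq (For 10 (Var 8) (For 11 (Var 9) (Emit (esense P R L (Var 10) (Var 11)))))
       (print_rat ((Var 4 +\<^sub>e Num 1) *\<^sub>e Var 5 +\<^sub>e (Var 3 +\<^sub>e Var 2))))))))"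

text \<open>The number of sensors has one summand for the padding demanded by the class and one that
  provides a sensor for every target.\<close>

definition red_prog :: "instr list \<Rightarrow> nat \<Rightarrow> expr \<Rightarrow> expr \<Rightarrow> nat \<Rightarrow> stmt" where
  "red_prog P R L D d = LetIn 1 D (LetIn 2 (epow (Var 1) 6) (LetIn 3 (epow (Var 1) 3 *\<^sub>e Var 2) (LetIn 4 (Num 4 *\<^sub>e Var 3)
    (LetIn 5 (Num 4 *\<^sub>e Var 3 +\<^sub>e Var 2) (LetIn 6 (Num 2 *\<^sub>e Var 3)
    (LetIn 7 (Num 4 *\<^sub>e Var 4 +\<^sub>e Num 6 *\<^sub>e Var 5 +\<^sub>e Var 6) (LetIn 8 (Var 7 +\<^sub>e Var 4 +\<^sub>e Var 5)
    (LetIn 9 (epow (Var 8 +\<^sub>e Num 2) d +\<^sub>e Var 8) (print_game P R L)))))))))"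

text \<open>Abstract parameters keep the case distinction free of the large polynomials that they
  stand for.\<close>

lemma eval_esense_gen:
  assumes "s 7 = g" "s 4 = m" "s 5 = a" "s 8 = n" "eval x s (ecok P R L (i -\<^sub>e Var 7)) = of_bool (ok (eval x s i - g))"
    "eval x s (ecx (i -\<^sub>e Var 7)) = cx (eval x s i - g)" "eval x s (ecy (i -\<^sub>e Var 7)) = cy (eval x s i - g)"
    "eval x s (ecz (i -\<^sub>e Var 7)) = cz (eval x s i - g)"
  shows "eval x s (esense P R L i j) = of_bool
    (if eval x s i < g then eval x s i = eval x s j
     else if eval x s i < g + m then
       4 * (eval x s i - g) \<le> eval x s j \<and> eval x s j < 4 * (eval x s i - g) + 3 \<or>
       eval x s j = 4 * (eval x s i - g) + 3 \<and> \<not> ok (eval x s i - g) \<or>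
       eval x s j = 4 * m + 5 * a + cx (eval x s i - g) \<or> eval x s j = 4 * m + 5 * a + cy (eval x s i - g) \<or>
       eval x s j = 4 * m + 6 * a + cz (eval x s i - g)
     else eval x s i < n \<and> (4 * m + 5 * (eval x s i - (g + m)) \<le> eval x s j \<and>
         eval x s j < 4 * m + 5 * (eval x s i - (g + m)) + 5 \<or>
       eval x s j = 4 * m + 5 * a + (eval x s i - (g + m))))"
proof (cases "eval x s i < g")
  case True
  then show ?thesis unfolding esense_def eval_logic(7) eval_logic(5)[of x s i] by (simp add: assms(1))
next
  case False
  show ?thesis
  proof (cases "eval x s i < g + m")
    case True
    then show ?thesis using False unfolding esense_def
      by (simp only: eval_logic eval.simps(1-3) binop_fun.simps assms of_bool_eq_0_iff not_not if_True if_False simp_thms)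
  next
    case ge: False
    then show ?thesis using False unfolding esense_def
      by (simp only: eval_logic eval.simps(1-3) binop_fun.simps assms of_bool_eq_0_iff not_not if_True if_False simp_thms)
  qed
qed

section \<open>The game belonging to a machine and the program that prints it\<close>

locale reduction = machine +
  fixes d :: nat
begin

text \<open>Stated directly in terms of \<open>D\<close>, before \<open>slots\<close> is available:
  the number of sensors is a parameter of the formula locale and depends on this quantity.\<close>

definition nSlots :: nat where "nSlots = D ^ 3 * D ^ 6"
definition nTargets :: nat where "nTargets = 5 * (4 * nSlots) + 7 * (4 * nSlots + D ^ 6) + 2 * nSlots"

lemma D4: "4 \<le> D" using D by simp

sublocale cnf "D ^ 3" "D ^ 6" mlit "(nTargets + 2) ^ d + nTargets"
proof
  have "2 ^ 1 \<le> (2 :: nat) ^ 6" by (intro power_increasing) auto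
  also have "(2 :: nat) ^ 6 \<le> D ^ 6" using D4 by (intro power_mono) auto
  finally show "2 \<le> D ^ 6" by simp
qed

lemma slots_eq: "slots = nSlots" by (simp add: slots_def nSlots_def)

sublocale cnf_packing "D ^ 3" "D ^ 6" mlit "(nTargets + 2) ^ d + nTargets"
  by unfold_locales (simp add: slots_eq nTargets_def)

lemma n_eq: "n = nTargets" by (simp add: slots_eq nTargets_def)

definition threshold :: nat where
  "threshold = (4 * slots + 1) * (4 * slots + D ^ 6) + (slots + D ^ 6)"

lemma value_iff: "blue_leader_value game \<ge> of_nat threshold \<longleftrightarrow> (\<exists>y. 2 * length x + 1 + length y \<le> L \<and> acc y)"
  unfolding threshold_def cnf_game_value cnf_sat_iff[symmetric] sat_def by (rule refl)

definition renv :: "env \<Rightarrow> bool" where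
  "renv s \<longleftrightarrow> s 0 = length x \<and> s 1 = D \<and> s 2 = D ^ 6 \<and> s 3 = slots \<and> s 4 = 4 * slots \<and> s 5 = 4 * slots + D ^ 6 \<and>
     s 6 = 2 * slots \<and> s 7 = g \<and> s 8 = n \<and> s 9 = (nTargets + 2) ^ d + nTargets"

lemma renv_upd: "10 \<le> v \<Longrightarrow> renv (s(v := c)) \<longleftrightarrow> renv s"
  by (auto simp: renv_def)

lemma renvD:
  assumes "renv s"
  shows "s 0 = length x" "s 1 = D" "s (Suc 0) = D" "s 2 = D ^ 6" "s 3 = slots" "s 4 = 4 * slots" "s 5 = 4 * slots + D ^ 6"
     "s 6 = 2 * slots" "s 7 = g" "s 8 = n" "s 9 = (nTargets + 2) ^ d + nTargets"
  using assms by (auto simp: renv_def)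

lemma eval_emlit:
  assumes "renv s" "eval x s Le = L"
  shows "eval x s (emlit P R Le c v b) = of_bool (mlit (eval x s c) (eval x s v) (eval x s b))"
  using assms by (simp add: emlit_def eval_eclit renvD mlit_def)

lemma eval_triples:
  assumes "renv s"
  shows "eval x s (ecx t) = cx (eval x s t)" "eval x s (ecy t) = cy (eval x s t)" "eval x s (ecz t) = cz (eval x s t)"
  using assms by (simp_all add: ecx_def ecy_def ecz_def esucc_def renvD cx_def cy_def cz_def succ_def)

lemma eval_ecok:
  assumes "renv s" "eval x s Le = L"
  shows "eval x s (ecok P R Le t) = of_bool (cok (eval x s t))"
  using assms by (simp add: ecok_def eval_emlit renvD cok_def)

lemma eval_esense:
  assumes "renv s" "eval x s Le = L"
  shows "eval x s (esense P R Le i j) = of_bool (sense (eval x s i) (eval x s j))"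
  unfolding sense_def
  by (rule eval_esense_gen[where g = g and m = "4 * slots" and a = "4 * slots + D ^ 6" and n = n and ok = cok
        and cx = cx and cy = cy and cz = cz])
    (simp_all only: renvD[OF assms(1)] eval_triples[OF assms(1)] eval_ecok[OF assms] eval.simps binop_fun.simps)

lemma eval_evalue: "renv s \<Longrightarrow> eval x s (evalue i) = val (eval x s i)"
  unfolding evalue_def val_def by (simp only: eval_logic eval.simps binop_fun.simps renvD of_bool_eq_0_iff not_not)

lemma out_print_game:
  assumes s: "renv s" and L: "\<And>s. renv s \<Longrightarrow> eval x s Le = L"
  shows "out x s (print_game P R Le) = enc_esg game @ enc_rat (of_nat threshold)"
proof -
  have vals: "out x s (For 10 (Var 8) (print_rat (evalue (Var 10)))) = concat (map (\<lambda>i. enc_rat (of_nat (val i))) [0..<n])"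
    using s by (simp add: out_print_rat eval_evalue renv_upd renvD(10))
  have mat: "out x s (For 10 (Var 8) (For 11 (Var 9) (Emit (esense P R Le (Var 10) (Var 11))))) =
     enc_matrix n ((nTargets + 2) ^ d + nTargets) sense"
    using s L by (simp add: enc_matrix_def eval_esense renv_upd renvD(10,11) concat_map_singleton)
  have thr: "out x s (print_rat ((Var 4 +\<^sub>e Num 1) *\<^sub>e Var 5 +\<^sub>e (Var 3 +\<^sub>e Var 2))) = enc_rat (of_nat threshold)"
    unfolding out_print_rat threshold_def using s by (simp add: renvD)
  have rec: "enc_enat 3 = True # enc_nat 3" by (simp add: enc_enat_def numeral_eq_enat)
  have hd: "out x s (print_nat (Var 8)) = enc_nat n" "out x s (print_nat (Var 9)) = enc_nat ((nTargets + 2) ^ d + nTargets)"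
     "out x s (print_nat (Num 3)) = enc_nat 3"
    using s by (simp_all only: out_print_nat eval.simps renvD)
  show ?thesis unfolding print_game_def out.simps(2) vals mat thr hd enc_esg_def game_simps rec by simp
qed

lemma out_red_prog:
  assumes De: "eval x (env0 x) De = D" and L: "\<And>s. s 0 = length x \<Longrightarrow> eval x s Le = L"
  shows "out x (env0 x) (red_prog P R Le De d) = enc_esg game @ enc_rat (of_nat threshold)"
proof -
  define s where "s = (env0 x)(1 := D, 2 := D ^ 6, 3 := slots, 4 := 4 * slots, 5 := 4 * slots + D ^ 6, 6 := 2 * slots,
     7 := g, 8 := n, 9 := (n + 2) ^ d + n)"
  have "out x (env0 x) (red_prog P R Le De d) = out x s (print_game P R Le)"
    unfolding red_prog_def out.simps(4) De s_def by (simp add: slots_def del: print_game_def)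
  moreover have "s 9 = (nTargets + 2) ^ d + nTargets" unfolding s_def fun_upd_same n_eq ..
  then have "renv s" unfolding renv_def by (simp add: s_def env0_def)
  ultimately show ?thesis using out_print_game[of s Le] L renvD(1) by simp
qed

lemma game_in_class: "game \<in> brr_class d"
proof -
  have gg: "guarded_game game g (4 * (4 * slots) + 5 * (4 * slots + D ^ 6))" by (rule guarded)
  have a: "1 \<le> 4 * slots + D ^ 6" using nc2 by linarith
  then have n1: "1 \<le> n" by linarith
  have "val i \<le> n * n" for i
  proof -
    define m where "m = 4 * slots"
    define a where "a = 4 * slots + D ^ 6"
    have a1: "1 \<le> a" using a by (simp add: a_def)
    have "val i \<le> m + (m + 1) * a + 1" using a1 unfolding m_def a_def val_def by (auto simp del: One_nat_def)
    also have "\<dots> \<le> m * a + (m + 1) * a + a" using a1 mult_le_mono2[of 1 a m] by linarith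
    also have "\<dots> = (2 * m + 2) * a" by (simp add: algebra_simps)
    also have "\<dots> \<le> n * n" using a1 by (intro mult_le_mono) (simp_all add: m_def a_def)
    finally show ?thesis .
  qed
  then have "\<forall>i<targets game. target_value game i = of_nat (val i) \<and> val i \<le> targets game * targets game"
    unfolding game_simps by blast
  moreover have "(targets game + 2) ^ d \<le> sensors game" unfolding game_simps n_eq by (rule le_add1)
  moreover have "1 \<le> targets game" unfolding game_simps by (rule n1)
  ultimately show ?thesis unfolding brr_class_def using gg by blast
qed

end

text \<open>The verifier, its polynomial bounds and \<open>d\<close> are constants of a program in
  the language, so the reduction is in polynomial time by construction. Any exponent of padding is
  possible.\<close>

theorem blse_brr_class_NP_hard: "blse_NP_hard (brr_class d)"
  unfolding blse_NP_hard_def NP_hard_def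
proof (intro ballI)
  fix L assume "L \<in> class_NP"
  then obtain V c where V: "V \<in> class_P"
    and NP: "\<And>x. x \<in> L \<longleftrightarrow> (\<exists>y. length y \<le> poly_bound c (length x) \<and> self_delimiting x @ y \<in> V)"
    unfolding class_NP_def by blast
  obtain P c' where P: "\<And>z. ram_computes P z [z \<in> V] (poly_bound c' (length z)) (poly_bound c' (length z))"
    using V unfolding class_P_def poly_time_computable_def by blast
  define R where "R = Suc (sum_list (map regs_instr P))"
  define e where "e = R + 2 + max_target P + 3"
  define len where "len x = 2 * length x + 1 + poly_bound c (length x)" for x :: "bool list"
  \<comment> \<open>Bounds words and running time of the verifier on all inputs of length at most
    \<open>len x\<close>; it must also reach \<open>len x\<close> itself, the largest content of
    register 0 at the start.\<close>
  define W where "W x = poly_bound c' (len x) + len x" for x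
  define Le where "Le = Num 2 *\<^sub>e Var 0 +\<^sub>e Num 1 +\<^sub>e (epow (Var 0) c +\<^sub>e Num c)"
  define De where "De = epow Le c' +\<^sub>e Num c' +\<^sub>e Le +\<^sub>e Num e"
  define f where "f x = out x (env0 x) (red_prog P R Le De d)" for x
  have "(x \<in> L \<longrightarrow> f x \<in> {enc_esg G @ enc_rat l | G l. G \<in> brr_class d \<and> blue_leader_value G \<ge> l}) \<and>
    (x \<notin> L \<longrightarrow> f x \<in> {enc_esg G @ enc_rat l | G l. G \<in> brr_class d \<and> \<not> blue_leader_value G \<ge> l})" for x
  proof -
    interpret reduction P x R "len x" "W x" "W x + e" "\<lambda>y. self_delimiting x @ y \<in> V" d
    proof
      have "regs_instr i \<le> sum_list (map regs_instr P)" if "i \<in> set P" for i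
        using that by (intro member_le_sum_list) auto
      then show "\<forall>i\<in>set P. regs_instr i < R" by (auto simp: R_def less_Suc_eq_le)
      show "1 \<le> R" by (simp add: R_def)
      show "2 * length x + 1 \<le> len x" by (simp add: len_def)
      show "len x \<le> W x" by (simp add: W_def)
      show "W x + R + 2 + max_target P + 3 \<le> W x + e" by (simp add: e_def)
      fix y :: "bool list" assume "2 * length x + 1 + length y \<le> len x"
      then have "poly_bound c' (length (self_delimiting x @ y)) \<le> poly_bound c' (len x)"
        by (intro poly_bound_mono) (simp add: length_self_delimiting)
      then show "ram_computes P (self_delimiting x @ y) [self_delimiting x @ y \<in> V] (W x + e - 1) (W x)"
        by (intro ram_computes_mono[OF P]) (simp_all add: W_def e_def)
    qed
    have "f x = enc_esg game @ enc_rat (of_nat threshold)"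
      unfolding f_def
    proof (rule out_red_prog)
      show Le: "eval x s Le = len x" if "s 0 = length x" for s
        using that by (simp add: Le_def len_def poly_bound_def)
      show "eval x (env0 x) De = W x + e"
        using Le[of "env0 x"] by (simp add: De_def W_def poly_bound_def env0_def)
    qed
    moreover have "blue_leader_value game \<ge> of_nat threshold \<longleftrightarrow> x \<in> L"
      unfolding value_iff NP by (simp add: len_def)
    ultimately show ?thesis using game_in_class by blast
  qed
  moreover have "poly_time_computable f" unfolding f_def by (rule out_poly_time)
  ultimately show "\<exists>f. poly_time_computable f \<and>
    (\<forall>x. (x \<in> L \<longrightarrow> f x \<in> {enc_esg G @ enc_rat l | G l. G \<in> brr_class d \<and> blue_leader_value G \<ge> l}) \<and>
      (x \<notin> L \<longrightarrow> f x \<in> {enc_esg G @ enc_rat l | G l. G \<in> brr_class d \<and> \<not> blue_leader_value G \<ge> l}))"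
    by blast
qed

theorem theorem4:
  "\<exists>C. (\<forall>G\<in>C. is_esg G \<and> recharge G = 3) \<and> brr_linear_time C \<and> blse_NP_hard C"
proof -
  obtain d where "brr_linear_time (brr_class d)" using brr_class_linear_time by blast
  then show ?thesis using brr_class_esg blse_brr_class_NP_hard by blast
qed

end
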